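(* Let $\mathbb{K}=\mathbb{R}$ or $\mathbb{C}$, let $n\ge2$ and $m\ge1$ be integers, let $G=GL(n,\mathbb{K})$, let $P$ be its maximal parabolic subgroup such that $G/P\cong\mathbb{P}^{n-1}\mathbb{K}$, let $\mathcal{P}=\mathcal{P}_{n,m}$, and let $\pi\colon\mathrm{diag}(G)\backslash G^m/P^m\twoheadrightarrow\mathcal{P}$ be the surjection sending $\mathrm{diag}(G)\cdot F$ to the unique $p\in\mathcal{P}$ such that $F$ is $p$-constructible. There exists an open $\mathrm{diag}(G)$-orbit on $G^m/P^m$ if and only if $n+1\ge m$, and open orbits in the cases where $n+1\ge m$ are given explicitly as follows ($e_1,\ldots,e_n$ is the standard basis of $\mathbb{K}^n$): (1) If $n\ge m$, then $p_o=(\{\{j\}\}_{j=1}^m,\emptyset,\emptyset)$ is an element of $\mathcal{P}$, and $\pi^{-1}(p_o)$ is a singleton. The only orbit $$\mathrm{diag}(G)\cdot\Big(F(\emptyset)^{\oplus(n-m)}\oplus\bigoplus_{j=1}^mF(\{j\})\Big)=\mathrm{diag}(G)\cdot(\mathbb{K}^n;\mathbb{K}e_1,\mathbb{K}e_2,\ldots,\mathbb{K}e_m)$$ contained in $\pi^{-1}(p_o)$ is an open orbit. (2) If $n+1=m$, then $p_o=(\emptyset,\{\{1,2,\ldots,m\}\},\emptyset)$ is an element of $\mathcal{P}$, and $\pi^{-1}(p_o)$ is a singleton. The only orbit $$\mathrm{diag}(G)\cdot D(\{1,2,\ldots,m\})=\mathrm{diag}(G)\cdot\Big(\mathbb{K}^n;\mathbb{K}e_1,\ldots,\mathbb{K}e_n,\mathbb{K}\sum_{i=1}^ne_i\Big)$$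 contained in $\pi^{-1}(p_o)$ is an open orbit.
   Context: Notation: $\mathbb{N}=\{0,1,2,\ldots\}$; all vector spaces are over $\mathbb{K}$ and finite-dimensional. $\mathrm{diag}(G)\subset G^m$ is the diagonal subgroup. Multiple flags. Let $\mathbf{d}=(r;d^{(1)},\ldots,d^{(m)})$ be non-negative integers with $d^{(i)}\le r$. For an $r$-dimensional vector space $V$, $Fl_{\mathbf{d}}(V)=\prod_{i=1}^m\mathrm{Gr}_{d^{(i)}}(V)$, with elements written $(V;V^{(1)},\ldots,V^{(m)})$, $V^{(i)}\subset V$ of dimension $d^{(i)}$. Such an element is called an $m$-tuple flag of dimension $\mathbf{d}$ (written $\dim D=\mathbf{d}$). Direct sum: $(V;V^{(i)})_i\oplus(W;W^{(i)})_i=(V\oplus W;V^{(i)}\oplus W^{(i)})_i$. Two $m$-tuple flags $(V;V^{(i)})_i$, $(W;W^{(i)})_i$ are isomorphic if there is a linear isomorphism $f\colon V\to W$ with $f(V^{(i)})=W^{(i)}$ for all $i$. An $m$-tuple flag is indecomposable if it is not isomorphic to a direct sum of two non-trivial ones (trivial means dimension $(0;0,\ldots,0)$). $G^m/P^m$ is identified with $Fl_{(n;1,\ldots,1)}(\mathbb{K}^n)=(\mathbb{P}^{n-1}\mathbb{K})^m$ (with its usual topology), with $G$ acting diagonally; two elements are in the same $\mathrm{diag}(G)$-orbit iff they are isomorphic, so any $m$-tuple flag of dimension $(n;1,\ldots,1)$ determines a $\mathrm{diag}(G)$-orbit after identifying its whole space with $\mathbb{K}^n$ by a linear isomorphism.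 For $K\subset\{1,\ldots,m\}$ and $r\in\mathbb{N}$ put $\mathbf{d}(K,r)=(r;\delta_{1,K},\ldots,\delta_{m,K})$, where $\delta_{i,K}=1$ if $i\in K$ and $0$ otherwise. The set $\mathcal{P}_{n,m}$: all tuples $p=(\{I_a\}_{a=1}^{A},\{J_b\}_{b=1}^{B},\{(K_c,r_c)\}_{c=1}^{C})$ (unordered families, each possibly empty) such that $\{1,\ldots,m\}$ is the disjoint union of all the $I_a$, $J_b$, $K_c$; $\#I_a\ge1$, $\#J_b\ge 3$, $r_c\in\mathbb{N}$, $4\le r_c+2\le \#K_c$ for all $a,b,c$; and $0\le r(p)\le n$, where $r(p):=A+\sum_{b=1}^B(\#J_b-1)+\sum_{c=1}^C r_c$. $p$-constructible: an $m$-tuple flag $F$ is $p$-constructible if $F$ is isomorphic to $\bigoplus_{k=1}^{n-r(p)}F_{\emptyset,k}\oplus\bigoplus_{a=1}^A F_a\oplus\bigoplus_{b=1}^B D_b\oplus\bigoplus_{c=1}^C E_c$ with all summands indecomposable $m$-tuple flags and $\dim F_{\emptyset,k}=\mathbf{d}(\emptyset,1)$, $\dim F_a=\mathbf{d}(I_a,1)$, $\dim D_b=\mathbf{d}(J_b,\#J_b-1)$, $\dim E_c=\mathbf{d}(K_c,r_c)$. Every $F\in G^m/P^m$ is $p$-constructible for exactly one $p\in\mathcal{P}_{n,m}$, and the resulting map $\pi$ is surjective. Representatives: for $I\subset\{1,\ldots,m\}$, $F(I)=(\mathbb{K};V^{(i)})_i$ with $V^{(i)}=\mathbb{K}$ if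 $i\in I$, $0$ otherwise. For $J=\{j_1<\cdots<j_{r+1}\}\subset\{1,\ldots,m\}$ with $r\ge2$, $D(J)=(\mathbb{K}^r;V^{(i)})_i$ with $V^{(j_h)}=\mathbb{K}e_h$ for $1\le h\le r$, $V^{(j_{r+1})}=\mathbb{K}\sum_{h=1}^r e_h$ (standard basis of $\mathbb{K}^r$), and $V^{(i)}=0$ for $i\notin J$. *)

theory Defs
  imports "HOL-Analysis.Analysis" "HOL-Library.Function_Algebras" "HOL-Library.Disjoint_Sets"
begin

text \<open>
  All vector spaces are finite-dimensional subspaces of some coordinate space \<open>'i \<Rightarrow> 'k\<close> with
  pointwise operations, so spaces of varying dimension live in one type.  Over \<open>nat \<Rightarrow> 'k\<close> every
  finite-dimensional space occurs up to isomorphism.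

  Topological statements are made for a scalar type of sort
  \<open>{real_normed_field, euclidean_space}\<close>.  By Frobenius' theorem a finite-dimensional
  commutative real division algebra is isomorphic to the field of real or of complex numbers, so
  this sort says exactly ``\<open>\<real>\<close> or \<open>\<complex>\<close>''; both \<open>real\<close> and \<open>complex\<close> are instances.
\<close>

section \<open>Linear algebra in coordinate spaces\<close>

definition cscale :: "'k::field \<Rightarrow> ('i \<Rightarrow> 'k) \<Rightarrow> 'i \<Rightarrow> 'k" where
  "cscale c v = (\<lambda>i. c * v i)"

interpretation coord: vector_space "cscale :: 'k::field \<Rightarrow> ('i \<Rightarrow> 'k) \<Rightarrow> 'i \<Rightarrow> 'k"
  by unfold_locales (auto simp: cscale_def fun_eq_iff algebra_simps)

definition fd_subspace :: "('i \<Rightarrow> 'k::field) set \<Rightarrow> bool" where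
  "fd_subspace V \<longleftrightarrow> coord.subspace V \<and> (\<exists>B. finite B \<and> coord.span B = V)"

text \<open>Only the values of \<open>f\<close> on \<open>V\<close> matter.\<close>

definition lin_iso :: "('i \<Rightarrow> 'k::field) set \<Rightarrow> ('j \<Rightarrow> 'k) set \<Rightarrow> (('i \<Rightarrow> 'k) \<Rightarrow> 'j \<Rightarrow> 'k) \<Rightarrow> bool" where
  "lin_iso V W f \<longleftrightarrow> bij_betw f V W \<and>
     (\<forall>x\<in>V. \<forall>y\<in>V. f (x + y) = f x + f y) \<and> (\<forall>c. \<forall>x\<in>V. f (cscale c x) = cscale c (f x))"

definition Kn :: "nat \<Rightarrow> (nat \<Rightarrow> 'k::field) set" where
  "Kn n = {x. \<forall>i. i \<notin> {1..n} \<longrightarrow> x i = 0}"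

definition evec :: "nat \<Rightarrow> nat \<Rightarrow> 'k::field" where
  "evec j = (\<lambda>i. if i = j then 1 else 0)"

definition GL :: "nat \<Rightarrow> ((nat \<Rightarrow> 'k::field) \<Rightarrow> nat \<Rightarrow> 'k) set" where
  "GL n = {g. lin_iso (Kn n) (Kn n) g}"

definition Gr :: "nat \<Rightarrow> ('i \<Rightarrow> 'k::field) set \<Rightarrow> ('i \<Rightarrow> 'k) set set" where
  "Gr d V = {W. coord.subspace W \<and> W \<subseteq> V \<and> coord.dim W = d}"

section \<open>Multiple flags\<close>

text \<open>In an \<open>m\<close>-tuple flag only \<open>part F i\<close> with \<open>i \<in> {1..m}\<close> is relevant.\<close>

datatype ('i, 'k) flag = Flag (whole: "('i \<Rightarrow> 'k) set") (part: "nat \<Rightarrow> ('i \<Rightarrow> 'k) set")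

definition is_flag :: "nat \<Rightarrow> ('i, 'k::field) flag \<Rightarrow> bool" where
  "is_flag m F \<longleftrightarrow> fd_subspace (whole F) \<and>
     (\<forall>i\<in>{1..m}. coord.subspace (part F i) \<and> part F i \<subseteq> whole F)"

definition has_dim :: "nat \<Rightarrow> ('i, 'k::field) flag \<Rightarrow> nat \<times> (nat \<Rightarrow> nat) \<Rightarrow> bool" where
  "has_dim m F d \<longleftrightarrow> is_flag m F \<and> coord.dim (whole F) = fst d \<and>
     (\<forall>i\<in>{1..m}. coord.dim (part F i) = snd d i)"

definition flag_iso :: "nat \<Rightarrow> ('i, 'k::field) flag \<Rightarrow> ('j, 'k) flag \<Rightarrow> bool" where
  "flag_iso m F F' \<longleftrightarrow>
     (\<exists>f. lin_iso (whole F) (whole F') f \<and> (\<forall>i\<in>{1..m}. f ` part F i = part F' i))"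

text \<open>
  External direct sums: coordinates of \<open>V \<oplus> W\<close> are indexed by the sum type, those of a family by
  pairs (summand, coordinate).
\<close>

definition dsum :: "('i \<Rightarrow> 'k) set \<Rightarrow> ('j \<Rightarrow> 'k) set \<Rightarrow> ('i + 'j \<Rightarrow> 'k) set" where
  "dsum V W = {case_sum v w | v w. v \<in> V \<and> w \<in> W}"

definition dSum :: "'s set \<Rightarrow> ('s \<Rightarrow> ('i \<Rightarrow> 'k::field) set) \<Rightarrow> ('s \<times> 'i \<Rightarrow> 'k) set" where
  "dSum S V = {x. (\<forall>s\<in>S. (\<lambda>i. x (s, i)) \<in> V s) \<and> (\<forall>s i. s \<notin> S \<longrightarrow> x (s, i) = 0)}"

definition flag_plus :: "('i, 'k) flag \<Rightarrow> ('j, 'k) flag \<Rightarrow> ('i + 'j, 'k) flag" (infixr \<open>\<oplus>\<^sub>F\<close> 65)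
  where "F \<oplus>\<^sub>F F' = Flag (dsum (whole F) (whole F')) (\<lambda>i. dsum (part F i) (part F' i))"

definition flag_Sum :: "'s set \<Rightarrow> ('s \<Rightarrow> ('i, 'k::field) flag) \<Rightarrow> ('s \<times> 'i, 'k) flag" where
  "flag_Sum S F = Flag (dSum S (\<lambda>s. whole (F s))) (\<lambda>i. dSum S (\<lambda>s. part (F s) i))"

definition indecomposable :: "nat \<Rightarrow> ('i, 'k::field) flag \<Rightarrow> bool" where
  "indecomposable m F \<longleftrightarrow> is_flag m F \<and>
     \<not> (\<exists>(D::(nat, 'k) flag) (D'::(nat, 'k) flag).
           is_flag m D \<and> is_flag m D' \<and>
           \<not> has_dim m D (0, \<lambda>_. 0) \<and> \<not> has_dim m D' (0, \<lambda>_. 0) \<and>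
           flag_iso m F (D \<oplus>\<^sub>F D'))"

definition dvec :: "nat set \<Rightarrow> nat \<Rightarrow> nat \<times> (nat \<Rightarrow> nat)" where
  "dvec K r = (r, \<lambda>i. if i \<in> K then 1 else 0)"

section \<open>The variety \<open>G\<^sup>m/P\<^sup>m = (\<P>\<^bsup>n-1\<^esup>)\<^sup>m\<close>, its topology and diagonal orbits\<close>

type_synonym 'k flag_point = "nat \<Rightarrow> (nat \<Rightarrow> 'k) set"

definition Fl :: "nat \<Rightarrow> nat \<Rightarrow> 'k::field flag_point set" where
  "Fl n m = PiE {1..m} (\<lambda>_. Gr 1 (Kn n))"

text \<open>
  The quotient topology on the set of lines along \<open>x \<mapsto> \<K>x\<close>.  The type \<open>nat \<Rightarrow> 'k\<close> carries the
  product topology, which induces the usual topology on \<open>Kn n\<close>.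
\<close>

definition proj_topology :: "nat \<Rightarrow> (nat \<Rightarrow> 'k::{field, topological_space}) set topology" where
  "proj_topology n = topology (\<lambda>U. U \<subseteq> Gr 1 (Kn n) \<and>
     openin (top_of_set (Kn n - {0})) {x \<in> Kn n - {0}. coord.span {x} \<in> U})"

lemma openin_proj_topology:
  "openin (proj_topology n) U \<longleftrightarrow> U \<subseteq> Gr 1 (Kn n) \<and>
     openin (top_of_set (Kn n - {0})) {x \<in> Kn n - {0}. coord.span {x} \<in> U}"
proof -
  have "istopology (\<lambda>U. U \<subseteq> Gr 1 (Kn n) \<and>
     openin (top_of_set (Kn n - {0})) {x \<in> Kn n - {0}. coord.span {x} \<in> U})" (is "istopology ?P")
    unfolding istopology_def
  proof (intro conjI allI impI)
    fix S T assume "?P S" "?P T"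
    moreover have "{x \<in> Kn n - {0}. coord.span {x} \<in> S \<inter> T} =
        {x \<in> Kn n - {0}. coord.span {x} \<in> S} \<inter> {x \<in> Kn n - {0}. coord.span {x} \<in> T}" by auto
    ultimately show "S \<inter> T \<subseteq> Gr 1 (Kn n)"
      and "openin (top_of_set (Kn n - {0})) {x \<in> Kn n - {0}. coord.span {x} \<in> S \<inter> T}"
      by (auto intro: openin_Int)
  next
    fix \<U> assume P: "\<forall>K\<in>\<U>. ?P K"
    then show "\<Union>\<U> \<subseteq> Gr 1 (Kn n)" by blast
    have "{x \<in> Kn n - {0}. coord.span {x} \<in> \<Union>\<U>} =
        (\<Union>K\<in>\<U>. {x \<in> Kn n - {0}. coord.span {x} \<in> K})" by auto
    then show "openin (top_of_set (Kn n - {0})) {x \<in> Kn n - {0}. coord.span {x} \<in> \<Union>\<U>}"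
      using P by (auto intro: openin_Union)
  qed
  then show ?thesis
    unfolding proj_topology_def by (rule topology_inverse'[THEN fun_cong])
qed

definition Fl_topology :: "nat \<Rightarrow> nat \<Rightarrow> 'k::{field, topological_space} flag_point topology" where
  "Fl_topology n m = product_topology (\<lambda>_. proj_topology n) {1..m}"

definition diag_orbit :: "nat \<Rightarrow> nat \<Rightarrow> 'k::field flag_point \<Rightarrow> 'k flag_point set" where
  "diag_orbit n m X = {\<lambda>i\<in>{1..m}. g ` X i | g. g \<in> GL n}"

definition diag_orbits :: "nat \<Rightarrow> nat \<Rightarrow> 'k::field flag_point set set" where
  "diag_orbits n m = diag_orbit n m ` Fl n m"

text \<open>
  The orbit determined by a flag of dimension \<open>(n; 1, \<dots>, 1)\<close>: its images under all
  identifications of its whole space with \<open>Kn n\<close>.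
\<close>

definition flag_orbit :: "nat \<Rightarrow> nat \<Rightarrow> ('i, 'k::field) flag \<Rightarrow> 'k flag_point set" where
  "flag_orbit n m F = {\<lambda>i\<in>{1..m}. f ` part F i | f. lin_iso (whole F) (Kn n) f}"

section \<open>The parameter set and the map to it\<close>

text \<open>
  The members of the three families are non-empty and disjoint, hence no member is repeated, and
  the unordered families can be taken to be sets.
\<close>

type_synonym param = "nat set set \<times> nat set set \<times> (nat set \<times> nat) set"

definition block :: "nat set + nat set + (nat set \<times> nat) \<Rightarrow> nat set" where
  "block = case_sum id (case_sum id fst)"

fun rk :: "param \<Rightarrow> nat" where
  "rk (Is, Js, Ks) = card Is + (\<Sum>J\<in>Js. card J - 1) + (\<Sum>(K, r)\<in>Ks. r)"

definition Params :: "nat \<Rightarrow> nat \<Rightarrow> param set" where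
  "Params n m = {(Is, Js, Ks).
     disjoint_family_on block (Is <+> Js <+> Ks) \<and>
     (\<Union>s\<in>Is <+> Js <+> Ks. block s) = {1..m} \<and>
     (\<forall>I\<in>Is. card I \<ge> 1) \<and>
     (\<forall>J\<in>Js. card J \<ge> 3) \<and>
     (\<forall>(K, r)\<in>Ks. 4 \<le> r + 2 \<and> r + 2 \<le> card K) \<and>
     rk (Is, Js, Ks) \<le> n}"

fun constructible :: "nat \<Rightarrow> nat \<Rightarrow> param \<Rightarrow> ('i, 'k::field) flag \<Rightarrow> bool" where
  "constructible n m (Is, Js, Ks) F \<longleftrightarrow> is_flag m F \<and>
     (\<exists>(F0 :: nat \<Rightarrow> (nat, 'k) flag) (FI :: nat set \<Rightarrow> (nat, 'k) flag)
        (DJ :: nat set \<Rightarrow> (nat, 'k) flag) (EK :: nat set \<times> nat \<Rightarrow> (nat, 'k) flag).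
        (\<forall>k\<in>{1..n - rk (Is, Js, Ks)}. indecomposable m (F0 k) \<and> has_dim m (F0 k) (dvec {} 1)) \<and>
        (\<forall>I\<in>Is. indecomposable m (FI I) \<and> has_dim m (FI I) (dvec I 1)) \<and>
        (\<forall>J\<in>Js. indecomposable m (DJ J) \<and> has_dim m (DJ J) (dvec J (card J - 1))) \<and>
        (\<forall>(K, r)\<in>Ks. indecomposable m (EK (K, r)) \<and> has_dim m (EK (K, r)) (dvec K r)) \<and>
        flag_iso m F
          (flag_Sum {1..n - rk (Is, Js, Ks)} F0 \<oplus>\<^sub>F flag_Sum Is FI \<oplus>\<^sub>F flag_Sum Js DJ \<oplus>\<^sub>F flag_Sum Ks EK))"

definition orbit_param :: "nat \<Rightarrow> nat \<Rightarrow> 'k::field flag_point set \<Rightarrow> param" where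
  "orbit_param n m \<Omega> =
     (THE p. p \<in> Params n m \<and> (\<exists>X\<in>\<Omega>. constructible n m p (Flag (Kn n) X)))"

definition orbit_fibre :: "nat \<Rightarrow> nat \<Rightarrow> param \<Rightarrow> 'k::field flag_point set set" where
  "orbit_fibre n m p = {\<Omega> \<in> diag_orbits n m. orbit_param n m \<Omega> = p}"

section \<open>Representatives\<close>

definition F_rep :: "nat set \<Rightarrow> (nat, 'k::field) flag" where
  "F_rep I = Flag (Kn 1) (\<lambda>i. if i \<in> I then Kn 1 else {0})"

text \<open>The position of \<open>i = j\<^sub>h\<close> in \<open>J = {j\<^sub>1 < \<dots> < j\<^bsub>r+1\<^esub>}\<close> is \<open>h = card {j \<in> J. j \<le> i}\<close>.\<close>

definition D_rep :: "nat set \<Rightarrow> (nat, 'k::field) flag" where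
  "D_rep J = (let r = card J - 1 in
     Flag (Kn r) (\<lambda>i. if i \<in> J then
        (let h = card {j \<in> J. j \<le> i} in
         if h \<le> r then coord.span {evec h} else coord.span {\<Sum>h=1..r. evec h})
       else {0}))"

end

theory Submission
  imports Defs
begin

text \<open>
  A tuple of lines \<open>\<K>v\<^sub>i\<close> decomposes along the connected components of the matroid of the
  vectors \<open>v\<^sub>i\<close>: a set of lines is indecomposable in its span iff no proper splitting of it spans a
  direct sum, and any two decompositions have the same blocks. Hence the parameter of an orbit is read
  off from the components and their ranks. The parameter is \<open>p\<^sub>o\<close> of case (1) iff all the lines are
  independent, and \<open>p\<^sub>o\<close> of case (2) iff any \<open>n\<close> of the \<open>n + 1\<close> lines are; \<open>GL n\<close> is transitive on the
  tuples of either kind, and independence is an open condition.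

  Conversely let \<open>m \<ge> n + 2\<close> and let an orbit be open. Its points all carry the same matroid, so a
  dependency among \<open>n\<close> of the lines would survive every small perturbation of one of them, which is
  impossible. Thus the first \<open>n + 1\<close> lines are in general position, their stabilizer consists of
  scalars, and so line number \<open>n + 2\<close> cannot move, although the orbit is open.
\<close>

section \<open>Linear algebra\<close>

text \<open>\<open>orbit_param\<close> is a definite description, so no fibre can be computed before
  existence and uniqueness of the parameter are known. For general flags, uniqueness of a
  decomposition into indecomposables is the Krull-Schmidt theorem and holds up to isomorphism only.
  Here it is elementary: at each index exactly one summand has a nonzero part, so a block is an
  actual subset of \<open>{1..m}\<close>, and two partitions into connected blocks can be compared
  directly. The summands with empty block carry no line; only their number counts, and it is
  \<open>n - rk p\<close>.

  Openness is proved without determinants. Independent vectors have dual functionals, which extend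
  to a linear map; a family whose image under this map is near the identity matrix is independent by
  diagonal dominance.

  \<open>lin_iso\<close> and \<open>GL\<close> constrain a map on a subspace only. Such maps are
  replaced by globally linear ones that agree with them there.\<close>

interpretation coord2: vector_space_pair
  "cscale :: 'k::field \<Rightarrow> ('i \<Rightarrow> 'k) \<Rightarrow> 'i \<Rightarrow> 'k" "cscale :: 'k \<Rightarrow> ('j \<Rightarrow> 'k) \<Rightarrow> 'j \<Rightarrow> 'k"
  by unfold_locales

abbreviation lin :: "(('i \<Rightarrow> 'k::field) \<Rightarrow> 'j \<Rightarrow> 'k) \<Rightarrow> bool" where
  "lin \<equiv> Vector_Spaces.linear cscale cscale"

section \<open>Dimensions of spans and of direct sums\<close>

lemma dim_mono_span:
  fixes A B :: "('i \<Rightarrow> 'k::field) set"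
  assumes "finite B" "A \<subseteq> coord.span B"
  shows "coord.dim A \<le> coord.dim B"
proof -
  obtain a where a: "a \<subseteq> A" "coord.independent a" "A \<subseteq> coord.span a" "card a = coord.dim A"
    using coord.basis_exists by blast
  obtain b where b: "b \<subseteq> B" "coord.independent b" "B \<subseteq> coord.span b" "card b = coord.dim B"
    using coord.basis_exists by blast
  \<comment> \<open>An infinite basis has cardinality 0, so \<open>coord.dim\<close> is monotone
    only below a finite spanning set.\<close>
  have "finite b" using b(1) assms(1) by (rule finite_subset)
  have "coord.span B \<subseteq> coord.span b" using b(3) by (simp add: coord.span_minimal)
  then have "card a \<le> card b"
    using coord.independent_span_bound[OF \<open>finite b\<close> a(2)] a(1) assms(2) by blast
  then show ?thesis using a b by simp
qed

lemma dim_insert_notin: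
  fixes A :: "('i \<Rightarrow> 'k::field) set"
  assumes "finite A" "x \<notin> coord.span A"
  shows "coord.dim (insert x A) = Suc (coord.dim A)"
proof -
  obtain a where a: "a \<subseteq> A" "coord.independent a" "A \<subseteq> coord.span a" "card a = coord.dim A"
    using coord.basis_exists by blast
  have fin: "finite a" using a(1) assms(1) by (rule finite_subset)
  have "coord.span a = coord.span A"
    by (metis a(1,3) coord.span_eq coord.span_superset subset_trans)
  then have "x \<notin> coord.span a" using assms by simp
  then have "coord.independent (insert x a)" "x \<notin> a"
    using coord.independent_insertI[OF _ a(2)] by (auto intro: coord.span_base)
  moreover have "insert x A \<subseteq> coord.span (insert x a)"
    using a(3) coord.span_mono[of a "insert x a"] by (auto intro: coord.span_base)
  moreover have "insert x a \<subseteq> insert x A" using a(1) by blast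
  ultimately have "coord.dim (insert x A) = card (insert x a)"
    using coord.basis_card_eq_dim by metis
  then show ?thesis using \<open>x \<notin> a\<close> fin a by simp
qed

lemma span_eq_of_dim_eq:
  fixes A B :: "('i \<Rightarrow> 'k::field) set"
  assumes "finite B" "finite A" "A \<subseteq> coord.span B" "coord.dim A = coord.dim B"
  shows "coord.span A = coord.span B"
proof (rule antisym)
  show "coord.span A \<subseteq> coord.span B" using assms(3) by (simp add: coord.span_minimal)
  show "coord.span B \<subseteq> coord.span A"
  proof (rule ccontr)
    assume "\<not> ?thesis"
    then obtain x where x: "x \<in> coord.span B" "x \<notin> coord.span A" by blast
    have "coord.dim (insert x A) \<le> coord.dim B"
      using dim_mono_span[OF assms(1)] x(1) assms(3) by simp
    then show False using dim_insert_notin[OF assms(2) x(2)] assms(4) by simp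
  qed
qed

lemma independent_Un_direct:
  fixes A B :: "('i \<Rightarrow> 'k::field) set"
  assumes "finite A" "finite B" "coord.independent A" "coord.independent B"
    and "coord.span A \<inter> coord.span B = {0}"
  shows "coord.independent (A \<union> B)" "A \<inter> B = {}"
proof -
  show disj: "A \<inter> B = {}"
  proof (rule ccontr)
    assume "A \<inter> B \<noteq> {}"
    then obtain x where "x \<in> A" "x \<in> B" by blast
    then have "x \<in> coord.span A \<inter> coord.span B" by (simp add: coord.span_base)
    then have "x = 0" using assms(5) by simp
    then show False using coord.dependent_zero[of A] assms(3) \<open>x \<in> A\<close> by simp
  qed
  show "coord.independent (A \<union> B)"
  proof (rule coord.independent_if_scalars_zero)
    show "finite (A \<union> B)" using assms by simp
    fix f x assume 0: "(\<Sum>x\<in>A \<union> B. cscale (f x) x) = 0" and x: "x \<in> A \<union> B"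
    let ?a = "\<Sum>x\<in>A. cscale (f x) x" and ?b = "\<Sum>x\<in>B. cscale (f x) x"
    have ab: "?a + ?b = 0" using 0 disj assms(1,2) by (simp add: sum.union_disjoint)
    have "?a \<in> coord.span A" "- ?b \<in> coord.span B"
      by (intro coord.span_neg coord.span_sum coord.span_scale coord.span_base; assumption)+
    moreover have "?a = - ?b" using ab by (rule eq_neg_iff_add_eq_0[THEN iffD2])
    ultimately have "?a \<in> coord.span A \<inter> coord.span B" by (simp only: Int_iff)
    then have a0: "?a = 0" using assms(5) by blast
    then have b0: "?b = 0" using ab by simp
    show "f x = 0"
      using x coord.independentD[OF assms(3,1) subset_refl a0]
        coord.independentD[OF assms(4,2) subset_refl b0] by blast
  qed
qed

lemma dim_Un_direct:
  fixes A B :: "('i \<Rightarrow> 'k::field) set"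
  assumes "finite A" "finite B" "coord.span A \<inter> coord.span B = {0}"
  shows "coord.dim (A \<union> B) = coord.dim A + coord.dim B"
proof -
  obtain a where a: "a \<subseteq> A" "coord.independent a" "A \<subseteq> coord.span a" "card a = coord.dim A"
    using coord.basis_exists by blast
  obtain b where b: "b \<subseteq> B" "coord.independent b" "B \<subseteq> coord.span b" "card b = coord.dim B"
    using coord.basis_exists by blast
  have fin: "finite a" "finite b" using a b assms by (auto intro: finite_subset)
  have "coord.span a \<inter> coord.span b = {0}"
    using coord.span_mono[OF a(1)] coord.span_mono[OF b(1)] assms(3)
      coord.span_zero[of a] coord.span_zero[of b] by blast
  note i = independent_Un_direct[OF fin a(2) b(2) this]
  have "A \<union> B \<subseteq> coord.span (a \<union> b)"
    using a(3) b(3) coord.span_mono[of a "a \<union> b"] coord.span_mono[of b "a \<union> b"] by blast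
  moreover have "a \<union> b \<subseteq> A \<union> B" using a b by blast
  ultimately have "coord.dim (A \<union> B) = card (a \<union> b)"
    using i(1) coord.basis_card_eq_dim by metis
  then show ?thesis using card_Un_disjoint[OF fin i(2)] a b by simp
qed

section \<open>Independent families\<close>

text \<open>Injectivity is included so that a repeated vector counts as a dependency, which the
  image set alone would hide.\<close>

definition indep_fam :: "('s \<Rightarrow> 'i \<Rightarrow> 'k::field) \<Rightarrow> 's set \<Rightarrow> bool" where
  "indep_fam v S \<longleftrightarrow> inj_on v S \<and> coord.independent (v ` S)"

lemma indep_fam_iff: "indep_fam v S \<longleftrightarrow> (\<forall>j\<in>S. v j \<notin> coord.span (v ` (S - {j})))"
proof
  assume *: "indep_fam v S"
  show "\<forall>j\<in>S. v j \<notin> coord.span (v ` (S - {j}))"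
  proof
    fix j assume j: "j \<in> S"
    have "v ` (S - {j}) = v ` S - {v j}"
      using * j by (auto simp: indep_fam_def inj_on_def)
    then show "v j \<notin> coord.span (v ` (S - {j}))"
      using * j unfolding indep_fam_def coord.dependent_def by auto
  qed
next
  assume *: "\<forall>j\<in>S. v j \<notin> coord.span (v ` (S - {j}))"
  have inj: "inj_on v S"
  proof (rule inj_onI, rule ccontr)
    fix i j assume "i \<in> S" "j \<in> S" "v i = v j" "i \<noteq> j"
    then have "v j \<in> coord.span (v ` (S - {j}))"
      by (metis coord.span_base Diff_iff image_eqI singletonD)
    then show False using * \<open>j \<in> S\<close> by blast
  qed
  then have "v ` (S - {j}) = v ` S - {v j}" if "j \<in> S" for j
    using that by (auto simp: inj_on_def)
  then show "indep_fam v S"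
    using * inj unfolding indep_fam_def coord.dependent_def by auto
qed

lemma indep_fam_mono: "indep_fam v S \<Longrightarrow> T \<subseteq> S \<Longrightarrow> indep_fam v T"
  unfolding indep_fam_def by (meson coord.independent_mono image_mono inj_on_subset)

lemma dim_image_le_card: "finite S \<Longrightarrow> coord.dim (v ` S) \<le> card S"
  by (meson card_image_le coord.dim_le_card coord.span_superset finite_imageI le_trans)

lemma span_image_redundant:
  assumes "j \<in> S" "v j \<in> coord.span (v ` (S - {j}))"
  shows "coord.span (v ` S) = coord.span (v ` (S - {j}))"
proof -
  have "v ` S = insert (v j) (v ` (S - {j}))" using assms(1) by blast
  then show ?thesis using coord.span_redundant[OF assms(2)] by simp
qed

text \<open>A dimension depends on the span only. In this form independence passes between families
  that span the same space, in particular between different vectors representing the same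
  lines.\<close>

lemma indep_fam_iff_dim:
  assumes "finite S"
  shows "indep_fam v S \<longleftrightarrow> coord.dim (v ` S) = card S"
proof
  show "indep_fam v S \<Longrightarrow> coord.dim (v ` S) = card S"
    unfolding indep_fam_def by (simp add: card_image coord.dim_eq_card_independent)
next
  assume *: "coord.dim (v ` S) = card S"
  show "indep_fam v S"
    unfolding indep_fam_iff
  proof (intro ballI notI)
    fix j assume j: "j \<in> S" "v j \<in> coord.span (v ` (S - {j}))"
    have "coord.dim (v ` S) = coord.dim (v ` (S - {j}))"
      using span_image_redundant[OF j] by (rule coord.span_eq_dim)
    also have "\<dots> \<le> card (S - {j})" by (rule dim_image_le_card) (use assms in simp)
    also have "\<dots> < card S" using j(1) assms by (rule card_Diff1_less[rotated])
    finally show False using * by simp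
  qed
qed

lemma indep_famD:
  assumes "indep_fam v S" "finite S" "(\<Sum>i\<in>S. cscale (c i) (v i)) = 0" "j \<in> S"
  shows "c j = 0"
proof -
  have inj: "inj_on v S" and ind: "coord.independent (v ` S)"
    using assms(1) by (auto simp: indep_fam_def)
  define d where "d = c \<circ> the_inv_into S v"
  have d: "d (v i) = c i" if "i \<in> S" for i using inj that by (simp add: d_def the_inv_into_f_f)
  have "(\<Sum>x\<in>v ` S. cscale (d x) x) = (\<Sum>i\<in>S. cscale (c i) (v i))"
    using d by (simp add: sum.reindex[OF inj])
  then have "d (v j) = 0"
    using coord.independentD[OF ind finite_imageI[OF assms(2)] subset_refl] assms by simp
  then show ?thesis using d assms(4) by simp
qed

text \<open>The coefficients are indexed by the family rather than by its set of values, so that no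
  injectivity is involved: the sums on the right form a subspace containing every
  \<open>v i\<close>.\<close>

lemma in_span_image_finite:
  assumes "finite S" "x \<in> coord.span (v ` S)"
  obtains c where "x = (\<Sum>i\<in>S. cscale (c i) (v i))"
proof -
  have "coord.subspace {y. \<exists>c. y = (\<Sum>i\<in>S. cscale (c i) (v i))}"
  proof (rule coord.subspaceI)
    show "0 \<in> {y. \<exists>c. y = (\<Sum>i\<in>S. cscale (c i) (v i))}"
      by (auto intro!: exI[of _ "\<lambda>_. 0"])
    show "a + b \<in> {y. \<exists>c. y = (\<Sum>i\<in>S. cscale (c i) (v i))}"
      if "a \<in> {y. \<exists>c. y = (\<Sum>i\<in>S. cscale (c i) (v i))}"
        and "b \<in> {y. \<exists>c. y = (\<Sum>i\<in>S. cscale (c i) (v i))}" for a b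
    proof -
      from that obtain c d where "a = (\<Sum>i\<in>S. cscale (c i) (v i))" "b = (\<Sum>i\<in>S. cscale (d i) (v i))"
        by blast
      then have "a + b = (\<Sum>i\<in>S. cscale (c i + d i) (v i))"
        by (simp add: coord.scale_left_distrib sum.distrib)
      then show ?thesis by (auto intro!: exI[of _ "\<lambda>i. c i + d i"])
    qed
    show "cscale k a \<in> {y. \<exists>c. y = (\<Sum>i\<in>S. cscale (c i) (v i))}"
      if "a \<in> {y. \<exists>c. y = (\<Sum>i\<in>S. cscale (c i) (v i))}" for a k
    proof -
      from that obtain c where "a = (\<Sum>i\<in>S. cscale (c i) (v i))" by blast
      then have "cscale k a = (\<Sum>i\<in>S. cscale (k * c i) (v i))"
        by (simp add: coord.scale_sum_right)
      then show ?thesis by (auto intro!: exI[of _ "\<lambda>i. k * c i"])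
    qed
  qed
  moreover have "v ` S \<subseteq> {y. \<exists>c. y = (\<Sum>i\<in>S. cscale (c i) (v i))}"
  proof (intro image_subsetI CollectI)
    fix j assume j: "j \<in> S"
    have "(\<Sum>i\<in>S. cscale (if i = j then 1 else 0) (v i)) = (\<Sum>i\<in>S. if i = j then v i else 0)"
      by (rule sum.cong) auto
    also have "\<dots> = v j" using assms(1) j by simp
    finally show "\<exists>c. v j = (\<Sum>i\<in>S. cscale (c i) (v i))" by metis
  qed
  ultimately have "coord.span (v ` S) \<subseteq> {y. \<exists>c. y = (\<Sum>i\<in>S. cscale (c i) (v i))}"
    by (simp add: coord.span_minimal)
  then show ?thesis using assms(2) that by blast
qed

lemma indep_famI:
  assumes "finite S" "\<And>c. (\<Sum>i\<in>S. cscale (c i) (v i)) = 0 \<Longrightarrow> \<forall>i\<in>S. c i = 0"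
  shows "indep_fam v S"
  unfolding indep_fam_iff
proof (intro ballI notI)
  fix j assume j: "j \<in> S" "v j \<in> coord.span (v ` (S - {j}))"
  obtain u where u: "v j = (\<Sum>i\<in>S - {j}. cscale (u i) (v i))"
    using in_span_image_finite[OF _ j(2)] assms(1) by blast
  \<comment> \<open>The coefficient -1 at \<open>j\<close> turns the expression of
    \<open>v j\<close> by the others into a vanishing combination.\<close>
  define c where "c = u(j := -1)"
  have "(\<Sum>i\<in>S. cscale (c i) (v i)) = cscale (c j) (v j) + (\<Sum>i\<in>S - {j}. cscale (c i) (v i))"
    using assms(1) j(1) by (rule sum.remove)
  also have "(\<Sum>i\<in>S - {j}. cscale (c i) (v i)) = v j"
    unfolding u by (rule sum.cong) (auto simp: c_def)
  also have "cscale (c j) (v j) + v j = 0" by (simp add: c_def)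
  finally have "c j = 0" using assms(2) j(1) by blast
  then show False by (simp add: c_def)
qed

section \<open>Lines and spaces of small dimension\<close>

lemma span_singleton_eq: "coord.span {x} = coord.span {y} \<longleftrightarrow> (\<exists>c. c \<noteq> 0 \<and> y = cscale c x)"
  for x y :: "'i \<Rightarrow> 'k::field"
proof
  assume *: "coord.span {x} = coord.span {y}"
  have "y \<in> coord.span {x}" "x \<in> coord.span {y}"
    using * coord.span_base[of x "{x}"] coord.span_base[of y "{y}"] by auto
  then obtain c d where c: "y = cscale c x" "x = cscale d y"
    unfolding coord.span_singleton by blast
  show "\<exists>c. c \<noteq> 0 \<and> y = cscale c x"
  proof (cases "c = 0")
    case True
    then have "y = 0" "x = 0" using c by auto
    \<comment> \<open>Both vectors are zero here, so any nonzero scalar serves.\<close>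
    then show ?thesis by (intro exI[of _ 1]) simp
  qed (use c in blast)
next
  assume "\<exists>c. c \<noteq> 0 \<and> y = cscale c x"
  then obtain c where c: "c \<noteq> 0" "y = cscale c x" by blast
  then have "x = cscale (inverse c) y" by simp
  then have "x \<in> coord.span {y}" "y \<in> coord.span {x}"
    using c by (metis coord.span_base coord.span_scale singletonI)+
  then show "coord.span {x} = coord.span {y}"
    by (simp add: coord.span_eq)
qed

lemma in_span_singleton_nonzero:
  fixes x y :: "'i \<Rightarrow> 'k::field"
  assumes "x \<in> coord.span {y}" "x \<noteq> 0"
  shows "coord.span {x} = coord.span {y}"
proof -
  obtain c where "x = cscale c y" using assms(1) unfolding coord.span_singleton by blast
  then show ?thesis using assms(2) by (metis coord.scale_zero_left span_singleton_eq)
qed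

lemma dim_singleton: "coord.dim {x} = (if x = 0 then 0 else 1)" for x :: "'i \<Rightarrow> 'k::field"
proof (cases "x = 0")
  case True
  have "coord.span {x} = coord.span {}" using True by simp
  then have "coord.dim {x} = coord.dim ({} :: ('i \<Rightarrow> 'k) set)" by (rule coord.span_eq_dim)
  also have "\<dots> = 0" using coord.dim_eq_card_independent[OF coord.independent_empty] by simp
  finally show ?thesis using True by simp
next
  case False
  then show ?thesis using coord.dim_eq_card_independent[of "{x}"] by simp
qed

lemma dim_zero_space: "coord.dim {0} = 0"
  by (simp add: dim_singleton)

lemma dim_pos:
  assumes "finite B" "A \<subseteq> coord.span B" "x \<in> A" "x \<noteq> 0"
  shows "coord.dim A > 0"
proof -
  have f: "finite (a::('a \<Rightarrow> 'b) set)" if "a \<subseteq> A" "coord.independent a" for a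
    using coord.independent_span_bound[OF assms(1) that(2)] that assms by blast
  obtain a where a: "a \<subseteq> A" "coord.independent a" "A \<subseteq> coord.span a" "card a = coord.dim A"
    using coord.basis_exists by blast
  have "a \<noteq> {}" using a(3) assms by auto
  then show ?thesis using a f[OF a(1,2)] card_gt_0_iff by metis
qed

lemma dim_eq_1_iff:
  fixes W :: "('i \<Rightarrow> 'k::field) set"
  assumes "coord.subspace W"
  shows "coord.dim W = 1 \<longleftrightarrow> (\<exists>w. w \<noteq> 0 \<and> W = coord.span {w})"
proof
  assume *: "coord.dim W = 1"
  obtain a where a: "a \<subseteq> W" "coord.independent a" "W \<subseteq> coord.span a" "card a = coord.dim W"
    using coord.basis_exists by blast
  then obtain w where "a = {w}" using * by (metis card_1_singletonE)
  then show "\<exists>w. w \<noteq> 0 \<and> W = coord.span {w}"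
    using a assms by (metis coord.dependent_single coord.span_minimal subset_antisym)
qed (auto simp: dim_singleton)

lemma fd_subspace_span: "finite B \<Longrightarrow> fd_subspace (coord.span B)"
  unfolding fd_subspace_def by blast

section \<open>Finite-dimensional subspaces and complements\<close>

lemma fd_subspace_sub:
  fixes A V :: "('i \<Rightarrow> 'k::field) set"
  assumes "fd_subspace V" "coord.subspace A" "A \<subseteq> V"
  shows "fd_subspace A"
proof -
  obtain B where B: "finite B" "coord.span B = V" using assms(1) unfolding fd_subspace_def by blast
  obtain a where a: "a \<subseteq> A" "coord.independent a" "A \<subseteq> coord.span a" "card a = coord.dim A"
    using coord.basis_exists by blast
  have "finite a" using coord.independent_span_bound[OF B(1) a(2)] a(1) assms(3) B(2) by blast
  moreover have "coord.span a = A" using a assms(2) by (simp add: coord.span_minimal subset_antisym)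
  ultimately show ?thesis using fd_subspace_span by metis
qed

lemma dim_eq_0_fd:
  assumes "fd_subspace V"
  shows "coord.dim V = 0 \<longleftrightarrow> V = {0}"
proof
  assume "coord.dim V = 0"
  obtain B where B: "finite B" "coord.span B = V" using assms(1) unfolding fd_subspace_def by blast
  have "\<forall>x\<in>V. x = 0" using dim_pos[OF B(1), of V] B(2) \<open>coord.dim V = 0\<close> by fastforce
  moreover have "0 \<in> V" using assms unfolding fd_subspace_def by (simp add: coord.subspace_0)
  ultimately show "V = {0}" by blast
qed (simp add: dim_zero_space)

lemma fd_subspace_basis:
  assumes "fd_subspace V"
  obtains B where "finite B" "coord.independent B" "coord.span B = V" "card B = coord.dim V"
proof -
  obtain A where A: "finite A" "coord.span A = V" using assms unfolding fd_subspace_def by blast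
  obtain B where B: "B \<subseteq> A" "coord.independent B" "A \<subseteq> coord.span B" "card B = coord.dim A"
    using coord.basis_exists by blast
  have "coord.span B = V"
    using A(2) B(1,3) by (metis coord.span_eq coord.span_superset subset_trans)
  then show ?thesis using that[of B] B A by (metis finite_subset coord.dim_span)
qed

text \<open>A basis of \<open>A\<close> extends to one of \<open>V\<close>, and the added vectors
  are \<open>C\<close>. The complement is delivered through its basis because the later count of
  summands with empty block uses these vectors one by one.\<close>

lemma fd_complement:
  fixes A V :: "('i \<Rightarrow> 'k::field) set"
  assumes "fd_subspace V" "coord.subspace A" "A \<subseteq> V"
  obtains C where "finite C" "coord.independent C" "C \<subseteq> V" "A \<inter> coord.span C = {0}"
    "\<And>x. x \<in> V \<Longrightarrow> \<exists>a\<in>A. \<exists>c\<in>coord.span C. x = a + c"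
    "coord.dim A + card C = coord.dim V"
proof -
  obtain a where a: "finite a" "coord.independent a" "coord.span a = A" "card a = coord.dim A"
    using fd_subspace_basis[OF fd_subspace_sub[OF assms]] by blast
  have "a \<subseteq> V" using a(3) assms(3) coord.span_superset by blast
  then obtain b where b: "a \<subseteq> b" "b \<subseteq> V" "coord.independent b" "V \<subseteq> coord.span b"
    using coord.maximal_independent_subset_extend[OF _ a(2)] by blast
  obtain B where B: "finite B" "coord.span B = V" using assms(1) unfolding fd_subspace_def by blast
  have fb: "finite b" using coord.independent_span_bound[OF B(1) b(3)] b(2) B(2) by blast
  have sb: "coord.span b = V"
    using b(2,4) assms(1) unfolding fd_subspace_def by (simp add: coord.span_minimal subset_antisym)
  let ?C = "b - a"
  have bU: "b = a \<union> ?C" using b(1) by blast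
  have "A \<inter> coord.span ?C \<subseteq> {0}"
  proof
    fix x assume x: "x \<in> A \<inter> coord.span ?C"
    obtain c where c: "x = (\<Sum>i\<in>a. cscale (c i) i)"
      using in_span_image_finite[OF a(1), of x id] x a(3) by auto
    obtain d where d: "x = (\<Sum>i\<in>?C. cscale (d i) i)"
      using in_span_image_finite[of ?C x id] x fb by auto
    \<comment> \<open>The two expansions of \<open>x\<close>, one with reversed sign, form a single
      relation over the independent set \<open>b\<close>.\<close>
    define e where "e i = (if i \<in> a then c i else - d i)" for i
    have "(\<Sum>i\<in>b. cscale (e i) i) = (\<Sum>i\<in>a. cscale (e i) i) + (\<Sum>i\<in>?C. cscale (e i) i)"
      using fb a(1) by (subst bU) (rule sum.union_disjoint, auto)
    also have "(\<Sum>i\<in>a. cscale (e i) i) = x" unfolding c by (rule sum.cong) (auto simp: e_def)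
    also have "(\<Sum>i\<in>?C. cscale (e i) i) = - x"
      unfolding d sum_negf[symmetric] by (rule sum.cong) (auto simp: e_def)
    finally have "(\<Sum>i\<in>b. cscale (e i) i) = 0" by (simp only: add.right_inverse)
    then have "\<forall>i\<in>b. e i = 0" using coord.independentD[OF b(3) fb subset_refl] by blast
    then have "\<forall>i\<in>a. c i = 0" using b(1) unfolding e_def by (metis subsetD)
    then show "x \<in> {0}" unfolding c by simp
  qed
  then have "A \<inter> coord.span ?C = {0}"
    using coord.subspace_0[OF assms(2)] coord.span_zero by blast
  moreover have "\<exists>a\<in>A. \<exists>c\<in>coord.span ?C. x = a + c" if "x \<in> V" for x
  proof -
    have "x \<in> coord.span (a \<union> ?C)" using that sb bU by simp
    then show ?thesis unfolding coord.span_Un a(3) by blast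
  qed
  moreover have "coord.dim A + card ?C = coord.dim V"
  proof -
    have "coord.dim V = card b" using coord.dim_span_eq_card_independent[OF b(3)] sb by simp
    then show ?thesis using card_Diff_subset[OF a(1) b(1)] card_mono[OF fb b(1)] a(4) by simp
  qed
  moreover have "coord.independent ?C" by (rule coord.independent_mono[OF b(3)]) blast
  moreover have "finite ?C" "?C \<subseteq> V" using fb b(2) by auto
  ultimately show ?thesis by (intro that[of ?C])
qed

subsection \<open>Linear isomorphisms\<close>

lemma lin_isoI:
  assumes "lin g" "inj_on g V" "g ` V = W"
  shows "lin_iso V W g"
  unfolding lin_iso_def bij_betw_def
  using assms(2,3) coord2.linear_add[OF assms(1)] coord2.linear_scale[OF assms(1)] by blast

text \<open>The map \<open>f\<close> may be arbitrary off \<open>V\<close>. Its values on a basis of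
  \<open>V\<close> determine a globally linear \<open>g\<close>, and the set where \<open>f\<close>
  and \<open>g\<close> agree is a subspace containing that basis.\<close>

lemma lin_isoE:
  fixes V :: "('i \<Rightarrow> 'k::field) set" and W :: "('j \<Rightarrow> 'k) set"
  assumes "lin_iso V W f" "coord.subspace V"
  obtains g where "lin g" "\<And>x. x \<in> V \<Longrightarrow> g x = f x" "inj_on g V" "g ` V = W"
proof -
  obtain B where B: "B \<subseteq> V" "coord.independent B" "V \<subseteq> coord.span B" "card B = coord.dim V"
    using coord.basis_exists by blast
  define g where "g = coord2.construct B f"
  have g: "lin g" unfolding g_def by (rule coord2.linear_construct[OF B(2)])
  have f: "f (x + y) = f x + f y" "f (cscale c x) = cscale c (f x)" if "x \<in> V" "y \<in> V" for x y c
    using assms(1) that unfolding lin_iso_def by auto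
  have "coord.subspace {x \<in> V. g x = f x}"
  proof (rule coord.subspaceI)
    have "f 0 = 0" using f(2)[of 0 0 0] coord.subspace_0[OF assms(2)] by simp
    then show "0 \<in> {x \<in> V. g x = f x}"
      using coord.subspace_0[OF assms(2)] by (simp add: coord2.linear_0[OF g])
    show "x + y \<in> {x \<in> V. g x = f x}" if "x \<in> {x \<in> V. g x = f x}" "y \<in> {x \<in> V. g x = f x}" for x y
      using that coord.subspace_add[OF assms(2), of x y] coord2.linear_add[OF g, of x y] f(1)[of x y]
      unfolding mem_Collect_eq by metis
    show "cscale c x \<in> {x \<in> V. g x = f x}" if "x \<in> {x \<in> V. g x = f x}" for c x
      using that coord.subspace_scale[OF assms(2), of x c] coord2.linear_scale[OF g, of c x] f(2)[of x x c]
      unfolding mem_Collect_eq by metis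
  qed
  moreover have "B \<subseteq> {x \<in> V. g x = f x}"
    using B unfolding g_def by (auto simp: coord2.construct_basis)
  ultimately have "V \<subseteq> {x \<in> V. g x = f x}" using B(3) coord.span_minimal by blast
  then have eq: "g x = f x" if "x \<in> V" for x using that by blast
  moreover have "inj_on g V" "g ` V = W"
    using assms(1) eq unfolding lin_iso_def bij_betw_def by (auto cong: inj_on_cong)
  ultimately show ?thesis using that g by blast
qed

lemma lin_iso_sym:
  assumes "lin_iso V W f" "coord.subspace V"
  shows "lin_iso W V (inv_into V f)"
  unfolding lin_iso_def
proof (intro conjI ballI allI)
  have b: "bij_betw f V W" and
    a: "\<And>x y. x \<in> V \<Longrightarrow> y \<in> V \<Longrightarrow> f (x + y) = f x + f y"
    "\<And>x c. x \<in> V \<Longrightarrow> f (cscale c x) = cscale c (f x)"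
    using assms(1) unfolding lin_iso_def by auto
  show "bij_betw (inv_into V f) W V" using b by (rule bij_betw_inv_into)
  have i: "inv_into V f y \<in> V" "f (inv_into V f y) = y" if "y \<in> W" for y
    using b that by (auto simp: bij_betw_def inv_into_into f_inv_into_f)
  have u: "inv_into V f y = x" if "x \<in> V" "f x = y" for x y
    using b that by (auto simp: bij_betw_def)
  fix x assume x: "x \<in> W"
  show "inv_into V f (x + y) = inv_into V f x + inv_into V f y" if "y \<in> W" for y
    by (rule u) (use a i x that in \<open>auto simp: coord.subspace_add[OF assms(2)]\<close>)
  show "inv_into V f (cscale c x) = cscale c (inv_into V f x)" for c
    by (rule u) (use a i x in \<open>auto simp: coord.subspace_scale[OF assms(2)]\<close>)
qed

lemma lin_iso_trans:
  assumes "lin_iso U V f" "lin_iso V W g"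
  shows "lin_iso U W (g \<circ> f)"
proof -
  have "f x \<in> V" if "x \<in> U" for x
    using assms(1) that unfolding lin_iso_def bij_betw_def by blast
  then show ?thesis using assms unfolding lin_iso_def by (auto intro: bij_betw_trans)
qed

lemma lin_span: "lin g \<Longrightarrow> g ` coord.span A = coord.span (g ` A)"
  by (simp add: coord2.linear_span_image)

lemma dim_lin_image:
  fixes g :: "('i \<Rightarrow> 'k::field) \<Rightarrow> 'j \<Rightarrow> 'k"
  assumes "lin g" "inj_on g (coord.span A)"
  shows "coord.dim (g ` A) = coord.dim A"
proof -
  obtain B where B: "B \<subseteq> A" "coord.independent B" "A \<subseteq> coord.span B" "card B = coord.dim A"
    using coord.basis_exists by blast
  have s: "coord.span B \<subseteq> coord.span A" using B(1) by (rule coord.span_mono)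
  have "coord.independent (g ` B)"
    using coord2.linear_independent_injective_image[OF assms(1) B(2)] assms(2) s inj_on_subset by blast
  moreover have "g ` A \<subseteq> coord.span (g ` B)" using B(3) lin_span[OF assms(1)] by blast
  moreover have "card (g ` B) = card B"
    using assms(2) B(1) by (meson card_image coord.span_superset inj_on_subset subset_trans)
  moreover have "g ` B \<subseteq> g ` A" using B(1) by blast
  ultimately show ?thesis using B(4) coord.basis_card_eq_dim[of "g ` B" "g ` A"] by simp
qed

lemma lin_extend_family:
  fixes v :: "'s \<Rightarrow> 'i \<Rightarrow> 'k::field" and w :: "'s \<Rightarrow> 'j \<Rightarrow> 'k"
  assumes "indep_fam v S"
  obtains g where "lin g" "\<And>s. s \<in> S \<Longrightarrow> g (v s) = w s"
proof -
  have i: "coord.independent (v ` S)" and j: "inj_on v S" using assms by (auto simp: indep_fam_def)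
  define g where "g = coord2.construct (v ` S) (w \<circ> the_inv_into S v)"
  have "lin g" unfolding g_def by (rule coord2.linear_construct[OF i])
  moreover have "g (v s) = w s" if "s \<in> S" for s
    using that i j by (simp add: g_def coord2.construct_basis the_inv_into_f_f)
  ultimately show ?thesis using that by blast
qed

lemma inj_on_span_indep_fam:
  assumes "lin g" "indep_fam (g \<circ> v) S"
  shows "inj_on g (coord.span (v ` S))"
proof -
  have "coord.independent (g ` v ` S)" "inj_on g (v ` S)"
    using assms(2) unfolding indep_fam_def image_comp by (auto intro: inj_on_imageI)
  then show ?thesis using coord2.linear_inj_on_span_independent_image[OF assms(1)] by blast
qed

subsection \<open>The space \<open>Kn n\<close>\<close>

lemma subspace_Kn [simp]: "coord.subspace (Kn n)"
  by (rule coord.subspaceI) (auto simp: Kn_def cscale_def)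

lemma evec_in_Kn: "j \<in> {1..n} \<Longrightarrow> evec j \<in> Kn n"
  by (auto simp: evec_def Kn_def)

lemma sum_fun_apply: "(\<Sum>i\<in>S. f i) x = (\<Sum>i\<in>S. f i x)"
  by (induction S rule: infinite_finite_induct) auto

lemma Kn_expand:
  assumes "x \<in> Kn n"
  shows "x = (\<Sum>j\<in>{1..n}. cscale (x j) (evec j))"
proof
  fix i
  have "(\<Sum>j\<in>{1..n}. cscale (x j) (evec j)) i = (\<Sum>j\<in>{1..n}. if j = i then x j else 0)"
    unfolding sum_fun_apply by (rule sum.cong) (auto simp: cscale_def evec_def)
  also have "\<dots> = x i" using assms by (auto simp: Kn_def)
  finally show "x i = (\<Sum>j\<in>{1..n}. cscale (x j) (evec j)) i" by simp
qed

lemma span_evec: "coord.span (evec ` {1..n}) = (Kn n :: (nat \<Rightarrow> 'k::field) set)"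
proof
  show "coord.span (evec ` {1..n}) \<subseteq> (Kn n :: (nat \<Rightarrow> 'k) set)"
    by (rule coord.span_minimal) (auto intro: evec_in_Kn[unfolded atLeastAtMost_iff])
  show "(Kn n :: (nat \<Rightarrow> 'k) set) \<subseteq> coord.span (evec ` {1..n})"
  proof
    fix x :: "nat \<Rightarrow> 'k" assume "x \<in> Kn n"
    then show "x \<in> coord.span (evec ` {1..n})"
      by (subst Kn_expand) (auto intro!: coord.span_sum coord.span_scale intro: coord.span_base)
  qed
qed

lemma indep_fam_evec: "indep_fam (evec :: nat \<Rightarrow> nat \<Rightarrow> 'k::field) {1..n}"
proof (rule indep_famI)
  fix c :: "nat \<Rightarrow> 'k" assume 0: "(\<Sum>i\<in>{1..n}. cscale (c i) (evec i)) = 0"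
  show "\<forall>i\<in>{1..n}. c i = 0"
  proof
    fix i assume i: "i \<in> {1..n}"
    have "0 = (\<Sum>j\<in>{1..n}. cscale (c j) (evec j)) i" using 0 by simp
    also have "\<dots> = (\<Sum>j\<in>{1..n}. if j = i then c j else 0)"
      unfolding sum_fun_apply by (rule sum.cong) (auto simp: cscale_def evec_def)
    also have "\<dots> = c i" using i by auto
    finally show "c i = 0" by simp
  qed
qed simp

lemma dim_Kn [simp]: "coord.dim (Kn n :: (nat \<Rightarrow> 'k::field) set) = n"
proof -
  have "coord.dim (coord.span (evec ` {1..n}) :: (nat \<Rightarrow> 'k) set) = n"
    using indep_fam_evec[of n] by (simp add: indep_fam_iff_dim)
  then show ?thesis unfolding span_evec .
qed

lemma fd_subspace_Kn [simp]: "fd_subspace (Kn n)"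
  unfolding span_evec[symmetric] by (rule fd_subspace_span) simp

lemma span_image_Kn:
  assumes "\<And>i. i \<in> S \<Longrightarrow> v i \<in> Kn n"
  shows "coord.span (v ` S) \<subseteq> Kn n"
  using assms by (intro coord.span_minimal) auto

lemma indep_fam_card_le:
  fixes v :: "'s \<Rightarrow> nat \<Rightarrow> 'k::field"
  assumes "indep_fam v S" "finite S" "\<And>i. i \<in> S \<Longrightarrow> v i \<in> Kn n"
  shows "card S \<le> n"
proof -
  have "coord.dim (v ` S) \<le> coord.dim (evec ` {1..n} :: (nat \<Rightarrow> 'k) set)"
    by (rule dim_mono_span) (use assms(3) in \<open>auto simp: span_evec simp del: One_nat_def\<close>)
  also have "\<dots> = n" by (metis coord.dim_span dim_Kn span_evec)
  finally show ?thesis using assms by (simp add: indep_fam_iff_dim)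
qed

lemma indep_fam_span_Kn:
  fixes v :: "'s \<Rightarrow> nat \<Rightarrow> 'k::field"
  assumes "indep_fam v S" "finite S" "card S = n" "\<And>i. i \<in> S \<Longrightarrow> v i \<in> Kn n"
  shows "coord.span (v ` S) = Kn n"
proof -
  have "coord.span (v ` S) = coord.span (evec ` {1..n} :: (nat \<Rightarrow> 'k) set)"
  proof (rule span_eq_of_dim_eq)
    have "coord.dim (evec ` {1..n} :: (nat \<Rightarrow> 'k) set) = n" by (metis coord.dim_span dim_Kn span_evec)
    then show "coord.dim (v ` S) = coord.dim (evec ` {1..n} :: (nat \<Rightarrow> 'k) set)"
      using assms by (simp add: indep_fam_iff_dim)
  qed (use assms in \<open>auto simp: span_evec simp del: One_nat_def\<close>)
  then show ?thesis by (simp only: span_evec)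
qed

text \<open>By the count of members, both \<open>v\<close> and its image under \<open>g\<close> are
  bases of \<open>Kn n\<close>.\<close>

lemma lin_iso_KnI:
  fixes g :: "(nat \<Rightarrow> 'k::field) \<Rightarrow> nat \<Rightarrow> 'k"
  assumes "lin g" "indep_fam v S" "finite S" "card S = n" "\<And>i. i \<in> S \<Longrightarrow> v i \<in> Kn n"
    and "indep_fam (g \<circ> v) S" "\<And>i. i \<in> S \<Longrightarrow> g (v i) \<in> Kn n"
  shows "lin_iso (Kn n) (Kn n) g"
proof (rule lin_isoI[OF assms(1)])
  have s: "coord.span (v ` S) = Kn n" using assms by (intro indep_fam_span_Kn)
  have s': "coord.span ((g \<circ> v) ` S) = Kn n" using assms by (intro indep_fam_span_Kn) auto
  show "inj_on g (Kn n)" using inj_on_span_indep_fam[OF assms(1,6)] s by simp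
  show "g ` Kn n = Kn n" using lin_span[OF assms(1), of "v ` S"] s s' by (simp add: image_comp)
qed

section \<open>Connected components of a vector configuration\<close>

text \<open>A configuration is connected when its matroid is; \<open>decomp v S P\<close> says that \<open>P\<close> is the
  partition of \<open>S\<close> into the connected components.\<close>

definition conn :: "('s \<Rightarrow> 'i \<Rightarrow> 'k::field) \<Rightarrow> 's set \<Rightarrow> bool" where
  "conn v K \<longleftrightarrow> K \<noteq> {} \<and>
     (\<forall>T. T \<subseteq> K \<longrightarrow> T \<noteq> {} \<longrightarrow> T \<noteq> K \<longrightarrow> coord.span (v ` T) \<inter> coord.span (v ` (K - T)) \<noteq> {0})"

definition decomp :: "('s \<Rightarrow> 'i \<Rightarrow> 'k::field) \<Rightarrow> 's set \<Rightarrow> 's set set \<Rightarrow> bool" where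
  "decomp v S P \<longleftrightarrow> partition_on S P \<and>
     (\<forall>K\<in>P. conn v K \<and> coord.span (v ` K) \<inter> coord.span (v ` (S - K)) = {0})"

lemma decompD:
  assumes "decomp v S P"
  shows "\<Union>P = S" "K \<in> P \<Longrightarrow> K \<subseteq> S" "K \<in> P \<Longrightarrow> K \<noteq> {}" "K \<in> P \<Longrightarrow> conn v K"
    "K \<in> P \<Longrightarrow> coord.span (v ` K) \<inter> coord.span (v ` (S - K)) = {0}"
    "K \<in> P \<Longrightarrow> L \<in> P \<Longrightarrow> K \<noteq> L \<Longrightarrow> K \<inter> L = {}"
    "partition_on S P"
proof -
  have "partition_on S P" and a: "\<forall>K\<in>P. conn v K \<and> coord.span (v ` K) \<inter> coord.span (v ` (S - K)) = {0}"
    using assms unfolding decomp_def by simp_all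
  then have b: "\<Union>P = S" "{} \<notin> P" "disjoint P" unfolding partition_on_def by simp_all
  show "\<Union>P = S" by (rule b(1))
  show "K \<in> P \<Longrightarrow> K \<subseteq> S" using b(1) by (metis Union_upper)
  show "K \<in> P \<Longrightarrow> K \<noteq> {}" using b(2) by metis
  show "K \<in> P \<Longrightarrow> conn v K" using a by simp
  show "K \<in> P \<Longrightarrow> coord.span (v ` K) \<inter> coord.span (v ` (S - K)) = {0}" using a by simp
  show "K \<in> P \<Longrightarrow> L \<in> P \<Longrightarrow> K \<noteq> L \<Longrightarrow> K \<inter> L = {}" using b(3) by (metis disjointD)
  show "partition_on S P" by fact
qed

lemma connD:
  assumes "conn v K" "T \<subseteq> K" "T \<noteq> {}" "T \<noteq> K"
    "coord.span (v ` T) \<inter> coord.span (v ` (K - T)) = {0}"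
  shows False
  using assms unfolding conn_def by simp

lemma direct_mono:
  assumes "coord.span A \<inter> coord.span B = {0}" "A' \<subseteq> A" "B' \<subseteq> B"
  shows "coord.span A' \<inter> coord.span B' = {0}"
  using assms(1) coord.span_mono[OF assms(2)] coord.span_mono[OF assms(3)]
    coord.span_zero[of A'] coord.span_zero[of B'] by blast

text \<open>If \<open>x = b + c\<close>, then \<open>c = x - b\<close> lies in the span of
  \<open>A \<union> B\<close> and vanishes, which leaves \<open>x = b\<close>. This regroups nested
  splittings: a part of a part is direct against everything else.\<close>

lemma direct_assoc:
  fixes A B C :: "('i \<Rightarrow> 'k::field) set"
  assumes "coord.span (A \<union> B) \<inter> coord.span C = {0}" "coord.span A \<inter> coord.span B = {0}"
  shows "coord.span A \<inter> coord.span (B \<union> C) = {0}"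
proof -
  have "x = 0" if x: "x \<in> coord.span A" "x \<in> coord.span (B \<union> C)" for x
  proof -
    obtain b c where bc: "b \<in> coord.span B" "c \<in> coord.span C" "x = b + c"
      using x(2) unfolding coord.span_Un by blast
    have "x \<in> coord.span (A \<union> B)" "b \<in> coord.span (A \<union> B)"
      using x(1) bc(1) coord.span_mono[of A "A \<union> B"] coord.span_mono[of B "A \<union> B"] by auto
    then have "x - b \<in> coord.span (A \<union> B)" by (rule coord.span_diff)
    then have "c \<in> coord.span (A \<union> B)" using bc(3) by (simp only: add_diff_cancel_left')
    then have "c = 0" using bc(2) assms(1) by blast
    then have "x \<in> coord.span A \<inter> coord.span B" using x(1) bc(1,3) by (simp only: add_0_right Int_iff)
    then show ?thesis using assms(2) by blast
  qed
  then show ?thesis using coord.span_zero[of A] coord.span_zero[of "B \<union> C"] by blast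
qed

text \<open>Suppose that a block \<open>K\<close> of one decomposition meets a block
  \<open>L\<close> of another. Restricted to \<open>K\<close>, the direct sum belonging to
  \<open>L\<close> separates \<open>K \<inter> L\<close> from the rest of \<open>K\<close>, so
  connectivity of \<open>K\<close> forces \<open>K \<subseteq> L\<close>. By symmetry the two blocks
  coincide.\<close>

lemma decomp_mono:
  assumes "decomp v S P" "decomp v S Q"
  shows "P \<subseteq> Q"
proof
  have sub: "K \<subseteq> L" if K: "decomp v S P" "K \<in> P" and L: "decomp v S Q" "L \<in> Q" and KL: "K \<inter> L \<noteq> {}"
    for K L P Q
  proof (rule ccontr)
    assume *: "\<not> K \<subseteq> L"
    have KS: "K \<subseteq> S" by (rule decompD(2)[OF K])
    have "coord.span (v ` (K \<inter> L)) \<inter> coord.span (v ` (K - (K \<inter> L))) = {0}"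
      by (rule direct_mono[OF decompD(5)[OF L]]) (use KS in auto)
    then show False by (rule connD[OF decompD(4)[OF K] _ KL, rotated 2]) (use * in auto)
  qed
  fix K assume K: "K \<in> P"
  obtain x where x: "x \<in> K" "x \<in> S" using decompD(2,3)[OF assms(1) K] by auto
  then obtain L where L: "L \<in> Q" "x \<in> L" using decompD(1)[OF assms(2)] by auto
  have "K \<subseteq> L" by (rule sub[OF assms(1) K assms(2) L(1)]) (use x L(2) in auto)
  moreover have "L \<subseteq> K" by (rule sub[OF assms(2) L(1) assms(1) K]) (use x L(2) in auto)
  ultimately show "K \<in> Q" using L(1) by simp
qed

lemma decomp_unique: "decomp v S P \<Longrightarrow> decomp v S Q \<Longrightarrow> P = Q"
  by (simp add: decomp_mono subset_antisym)

lemma decomp_conn: "conn v S \<Longrightarrow> decomp v S {S}"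
  using coord.span_zero[of "v ` S"] unfolding decomp_def conn_def partition_on_def by auto

text \<open>If \<open>S\<close> is neither empty nor connected, it splits directly into two smaller
  sets. Decompositions of these combine, since by \<open>direct_assoc\<close> each of their blocks
  is direct against the rest of \<open>S\<close>.\<close>

lemma decomp_exists:
  assumes "finite S"
  shows "\<exists>P. decomp v S P"
  using assms
proof (induction S rule: finite_psubset_induct)
  case (psubset S)
  consider "S = {}" | "conn v S" |
    T where "T \<subseteq> S" "T \<noteq> {}" "T \<noteq> S" "coord.span (v ` T) \<inter> coord.span (v ` (S - T)) = {0}"
    unfolding conn_def by metis
  then show ?case
  proof cases
    case 1
    then have "decomp v S {}" unfolding decomp_def partition_on_def by simp
    then show ?thesis ..
  next
    case 2
    then show ?thesis using decomp_conn by blast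
  next
    case 3
    have "T \<subset> S" "S - T \<subset> S" using 3(1,2,3) by auto
    then obtain P Q where P: "decomp v T P" and Q: "decomp v (S - T) Q"
      using psubset.IH[of T] psubset.IH[of "S - T"] by auto
    have aux: "coord.span (v ` K) \<inter> coord.span (v ` (S - K)) = {0}"
      if "decomp v U R" "K \<in> R" "U \<subseteq> S" "coord.span (v ` U) \<inter> coord.span (v ` (S - U)) = {0}" for U K R
    proof -
      have K: "K \<subseteq> U" "coord.span (v ` K) \<inter> coord.span (v ` (U - K)) = {0}"
        using decompD(2,5)[OF that(1,2)] by auto
      have e: "v ` K \<union> v ` (U - K) = v ` U" "v ` (S - K) = v ` (U - K) \<union> v ` (S - U)"
        using K(1) that(3) by auto
      show ?thesis unfolding e(2) by (rule direct_assoc) (use e(1) K(2) that(4) in simp_all)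
    qed
    have "S - (S - T) = T" using 3(1) by blast
    then have "coord.span (v ` (S - T)) \<inter> coord.span (v ` (S - (S - T))) = {0}" using 3(4) by auto
    then have "coord.span (v ` K) \<inter> coord.span (v ` (S - K)) = {0}" if "K \<in> P \<union> Q" for K
      using aux[OF P _ 3(1,4)] aux[OF Q _ Diff_subset] that by (metis UnE)
    moreover have "partition_on S (P \<union> Q)"
    proof -
      have 1: "\<Union>(P \<union> Q) = S" using decompD(1)[OF P] decompD(1)[OF Q] 3(1) by auto
      have "K \<inter> L = {}" if "K \<in> P" "L \<in> Q" for K L
        using decompD(2)[OF P that(1)] decompD(2)[OF Q that(2)] by auto
      then have "K \<inter> L = {}" if "K \<in> P \<union> Q" "L \<in> P \<union> Q" "K \<noteq> L" for K L
        using decompD(6)[OF P _ _ that(3)] decompD(6)[OF Q _ _ that(3)] that(1,2) by (metis UnE inf_commute)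
      then have 2: "disjoint (P \<union> Q)" unfolding disjoint_def by simp
      have "{} \<notin> P \<union> Q" using decompD(3)[OF P] decompD(3)[OF Q] by auto
      then show ?thesis using 1 2 unfolding partition_on_def by simp
    qed
    moreover have "conn v K" if "K \<in> P \<union> Q" for K
      using that decompD(4)[OF P] decompD(4)[OF Q] by (metis UnE)
    ultimately have "decomp v S (P \<union> Q)" unfolding decomp_def by simp
    then show ?thesis ..
  qed
qed

lemma decomp_finite:
  assumes "decomp v S P" "finite S"
  shows "finite P" "K \<in> P \<Longrightarrow> finite K"
  using decompD(1)[OF assms(1)] assms(2) finite_UnionD apply metis
  using decompD(2)[OF assms(1)] assms(2) finite_subset by metis

text \<open>Blocks are added one at a time: a block is direct against all that lies outside it, in
  particular against the union of the blocks already counted.\<close>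

lemma decomp_dim:
  fixes v :: "'s \<Rightarrow> 'i \<Rightarrow> 'k::field"
  assumes "decomp v S P" "finite S"
  shows "(\<Sum>K\<in>P. coord.dim (v ` K)) = coord.dim (v ` S)"
proof -
  have "(\<Sum>K\<in>Q. coord.dim (v ` K)) = coord.dim (v ` \<Union>Q)" if "Q \<subseteq> P" for Q
    using finite_subset[OF that decomp_finite(1)[OF assms]] that
  proof (induction Q rule: finite_induct)
    case empty
    then show ?case using coord.dim_eq_card_independent[OF coord.independent_empty] by simp
  next
    case (insert K Q)
    have K: "K \<in> P" and Q: "\<And>L. L \<in> Q \<Longrightarrow> L \<in> P" using insert.prems by auto
    have "L \<subseteq> S - K" if "L \<in> Q" for L
      using decompD(2)[OF assms(1) Q[OF that]] decompD(6)[OF assms(1) Q[OF that] K] insert.hyps(2) that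
      by auto
    then have "\<Union>Q \<subseteq> S - K" by (rule Union_least)
    then have d: "coord.span (v ` K) \<inter> coord.span (v ` \<Union>Q) = {0}"
      by (intro direct_mono[OF decompD(5)[OF assms(1) K]] image_mono) auto
    have "finite (v ` K)" "finite (v ` \<Union>Q)"
      using insert.prems decomp_finite[OF assms] insert.hyps by auto
    from dim_Un_direct[OF this d]
    have "coord.dim (v ` (K \<union> \<Union>Q)) = coord.dim (v ` K) + coord.dim (v ` \<Union>Q)"
      by (simp add: image_Un)
    then show ?case using insert by simp
  qed
  from this[OF subset_refl] show ?thesis using decompD(1)[OF assms(1)] by simp
qed

lemma conn_dim_pos:
  assumes "conn v K" "finite K" "\<And>i. i \<in> K \<Longrightarrow> v i \<noteq> 0"
  shows "coord.dim (v ` K) \<ge> 1"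
proof -
  obtain i where i: "i \<in> K" using assms(1) unfolding conn_def by auto
  have "coord.dim (v ` K) > 0"
    by (rule dim_pos[of "v ` K" _ "v i"]) (use i assms in \<open>auto intro: coord.span_base\<close>)
  then show ?thesis by simp
qed

text \<open>The splitting of \<open>K\<close> into \<open>{j}\<close> and the rest is not direct, so
  the line of \<open>v j\<close> meets the span of the rest in a nonzero vector, and that vector
  spans the line.\<close>

lemma conn_in_span:
  fixes v :: "'s \<Rightarrow> 'i \<Rightarrow> 'k::field"
  assumes "conn v K" "K \<noteq> {j}" "j \<in> K"
  shows "v j \<in> coord.span (v ` (K - {j}))"
proof -
  have "coord.span (v ` {j}) \<inter> coord.span (v ` (K - {j})) \<noteq> {0}"
    using assms connD[of v K "{j}"] by auto
  then obtain x where x: "x \<in> coord.span {v j}" "x \<in> coord.span (v ` (K - {j}))" "x \<noteq> 0"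
    using coord.span_zero[of "{v j}"] coord.span_zero[of "v ` (K - {j})"] by auto
  have "v j \<in> coord.span {x}"
    using in_span_singleton_nonzero[OF x(1,3)] by (simp add: coord.span_base)
  also have "\<dots> \<subseteq> coord.span (v ` (K - {j}))" using x(2) by (simp add: coord.span_minimal)
  finally show ?thesis .
qed

lemma conn_dim_less:
  assumes "conn v K" "finite K" "card K \<noteq> 1"
  shows "coord.dim (v ` K) + 1 \<le> card K"
proof -
  obtain j where j: "j \<in> K" using assms(1) unfolding conn_def by auto
  have "K \<noteq> {j}" using assms(3) by auto
  then have "v j \<in> coord.span (v ` (K - {j}))" using conn_in_span[OF assms(1) _ j] by simp
  then have "coord.dim (v ` K) = coord.dim (v ` (K - {j}))"
    using span_image_redundant[OF j] by (intro coord.span_eq_dim)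
  also have "\<dots> \<le> card (K - {j})" by (rule dim_image_le_card) (use assms in simp)
  also have "\<dots> + 1 = card K" using j assms(2) by (metis Suc_eq_plus1 card.remove)
  finally show ?thesis by simp
qed

text \<open>The three alternatives are the three families of \<open>Params\<close>: a class of
  parallel vectors, a circuit, and a connected configuration of nullity at least two. A pair of
  parallel vectors is also a circuit; the bound \<open>card K \<ge> 3\<close> assigns it to the
  first family.\<close>

lemma conn_cases:
  assumes "conn v K" "finite K" "\<And>i. i \<in> K \<Longrightarrow> v i \<noteq> 0"
  obtains "coord.dim (v ` K) = 1" "card K \<ge> 1" |
    "card K \<ge> 3" "coord.dim (v ` K) = card K - 1" "coord.dim (v ` K) \<noteq> 1" |
    "4 \<le> coord.dim (v ` K) + 2" "coord.dim (v ` K) + 2 \<le> card K"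
proof -
  have d: "coord.dim (v ` K) \<ge> 1" by (rule conn_dim_pos) (use assms in auto)
  have c: "card K \<ge> 1" using assms(1,2) unfolding conn_def by (simp add: Suc_leI card_gt_0_iff)
  show ?thesis
  proof (cases "card K = 1")
    case True
    then have "coord.dim (v ` K) = 1" using dim_image_le_card[OF assms(2), of v] d by simp
    then show ?thesis using that(1) c by blast
  next
    case False
    then show ?thesis using conn_dim_less[OF assms(1,2)] d c that by linarith
  qed
qed

subsection \<open>The parameter of a decomposition\<close>

text \<open>For connected blocks of nonzero vectors the three conditions are exhaustive and exclude
  each other, so every block is listed exactly once. The rank is recorded in the third family, where
  the block does not determine it.\<close>

definition param_of :: "(nat \<Rightarrow> 'i \<Rightarrow> 'k::field) \<Rightarrow> nat set set \<Rightarrow> param" where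
  "param_of v P =
     ({K \<in> P. coord.dim (v ` K) = 1},
      {K \<in> P. card K \<ge> 3 \<and> coord.dim (v ` K) = card K - 1},
      (\<lambda>K. (K, coord.dim (v ` K))) ` {K \<in> P. 4 \<le> coord.dim (v ` K) + 2 \<and> coord.dim (v ` K) + 2 \<le> card K})"

text \<open>In each of the three families the number contributed to \<open>rk\<close> is the
  dimension of the span of the block. By \<open>decomp_dim\<close> these numbers add up to the rank
  of the whole configuration, which cannot exceed \<open>n\<close>.\<close>

lemma
  fixes v :: "nat \<Rightarrow> nat \<Rightarrow> 'k::field"
  assumes P: "decomp v {1..m} P" and v: "\<And>i. i \<in> {1..m} \<Longrightarrow> v i \<noteq> 0"
  shows rk_param_of: "rk (param_of v P) = coord.dim (v ` {1..m})"
    and param_of_in_Params: "(\<And>i. i \<in> {1..m} \<Longrightarrow> v i \<in> Kn n) \<Longrightarrow> param_of v P \<in> Params n m"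
proof -
  let ?d = "\<lambda>K. coord.dim (v ` K)"
  define A where "A = {K \<in> P. ?d K = 1}"
  define B where "B = {K \<in> P. card K \<ge> 3 \<and> ?d K = card K - 1}"
  define C where "C = {K \<in> P. 4 \<le> ?d K + 2 \<and> ?d K + 2 \<le> card K}"
  have p: "param_of v P = (A, B, (\<lambda>K. (K, ?d K)) ` C)"
    by (simp add: param_of_def A_def B_def C_def)
  have part: "partition_on {1..m} P" and con: "\<And>K. K \<in> P \<Longrightarrow> conn v K"
    using decompD(7,4)[OF P] by auto
  have fin: "finite P" "\<And>K. K \<in> P \<Longrightarrow> finite K" using decomp_finite[OF P] by auto
  have sub: "K \<subseteq> {1..m}" if "K \<in> P" for K by (rule decompD(2)[OF P that])
  \<comment> \<open>Nonzero vectors leave no block of rank 0, so \<open>conn_cases\<close> covers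
    all of \<open>P\<close>.\<close>
  have cov: "P = A \<union> B \<union> C"
  proof
    show "P \<subseteq> A \<union> B \<union> C"
    proof
      fix K assume K: "K \<in> P"
      have nz: "v i \<noteq> 0" if "i \<in> K" for i using v sub[OF K] that by auto
      show "K \<in> A \<union> B \<union> C"
        by (rule conn_cases[OF con[OF K] fin(2)[OF K] nz]) (use K in \<open>auto simp: A_def B_def C_def\<close>)
    qed
  qed (auto simp: A_def B_def C_def)
  have finABC: "finite A" "finite B" "finite C" using fin(1) cov by auto
  have dis: "A \<inter> B = {}" "(A \<union> B) \<inter> C = {}" by (auto simp: A_def B_def C_def)
  have injC: "inj_on (\<lambda>K. (K, ?d K)) C" by (auto intro: inj_onI)
  have "rk (param_of v P) = (\<Sum>K\<in>A. ?d K) + (\<Sum>K\<in>B. ?d K) + (\<Sum>K\<in>C. ?d K)"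
  proof -
    have "(\<Sum>K\<in>A. ?d K) = card A" by (simp add: A_def)
    moreover have "(\<Sum>K\<in>B. ?d K) = (\<Sum>J\<in>B. card J - 1)" by (rule sum.cong) (auto simp: B_def)
    moreover have "(\<Sum>(K, r)\<in>(\<lambda>K. (K, ?d K)) ` C. r) = (\<Sum>K\<in>C. ?d K)"
      by (simp add: sum.reindex[OF injC])
    ultimately show ?thesis unfolding p by simp
  qed
  also have "\<dots> = (\<Sum>K\<in>P. ?d K)"
    unfolding cov using finABC dis by (simp add: sum.union_disjoint)
  also have "\<dots> = coord.dim (v ` {1..m})" using decomp_dim[OF P] by simp
  finally show rk: "rk (param_of v P) = coord.dim (v ` {1..m})" .
  show "param_of v P \<in> Params n m" if vn: "\<And>i. i \<in> {1..m} \<Longrightarrow> v i \<in> Kn n"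
  proof -
    have "coord.dim (v ` {1..m}) \<le> coord.dim (evec ` {1..n} :: (nat \<Rightarrow> 'k) set)"
      by (rule dim_mono_span) (use vn in \<open>auto simp: span_evec simp del: One_nat_def\<close>)
    also have "\<dots> = n" by (metis coord.dim_span dim_Kn span_evec)
    finally have le: "rk (A, B, (\<lambda>K. (K, ?d K)) ` C) \<le> n" using rk p by simp
    define T where "T = A <+> B <+> (\<lambda>K. (K, ?d K)) ` C"
    have bl: "block s \<in> P" if "s \<in> T" for s
      using that unfolding T_def block_def A_def B_def C_def by auto
    \<comment> \<open>The three conditions exclude each other and a block determines its rank, so no
      block occurs twice in the disjoint sum.\<close>
    have injb: "s = t" if "s \<in> T" "t \<in> T" "block s = block t" for s t
      using that unfolding T_def block_def A_def B_def C_def by auto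
    have surj: "block ` T = P"
    proof
      show "P \<subseteq> block ` T"
      proof
        fix K assume "K \<in> P"
        then consider "K \<in> A" | "K \<in> B" | "K \<in> C" using cov by blast
        then show "K \<in> block ` T"
        proof cases
          case 1 then show ?thesis by (intro image_eqI[of _ _ "Inl K"]) (auto simp: T_def block_def)
        next
          case 2 then show ?thesis by (intro image_eqI[of _ _ "Inr (Inl K)"]) (auto simp: T_def block_def)
        next
          case 3 then show ?thesis
            by (intro image_eqI[of _ _ "Inr (Inr (K, ?d K))"]) (auto simp: T_def block_def)
        qed
      qed
    qed (use bl in blast)
    have "disjoint_family_on block T"
      unfolding disjoint_family_on_def
    proof (intro ballI impI)
      fix s t assume "s \<in> T" "t \<in> T" "s \<noteq> t"
      then have "block s \<in> P" "block t \<in> P" "block s \<noteq> block t" using bl injb by metis+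
      then show "block s \<inter> block t = {}" by (rule decompD(6)[OF P])
    qed
    moreover have "(\<Union>s\<in>T. block s) = {1..m}"
      using surj decompD(1)[OF P] by simp
    moreover have "card I \<ge> 1" if "I \<in> A" for I
    proof -
      have "I \<in> P" using that cov by blast
      then have "I \<noteq> {}" "finite I" using decompD(3)[OF P] fin by auto
      then show ?thesis by (simp add: Suc_leI card_gt_0_iff)
    qed
    moreover have "\<forall>J\<in>B. card J \<ge> 3" by (simp add: B_def)
    moreover have "\<forall>(K, r)\<in>(\<lambda>K. (K, ?d K)) ` C. 4 \<le> r + 2 \<and> r + 2 \<le> card K"
      by (auto simp: C_def)
    ultimately show ?thesis using le unfolding p Params_def T_def by simp
  qed
qed

section \<open>Flags and direct sums\<close>

lemma linI:
  assumes "\<And>x y. g (x + y) = g x + g y" "\<And>c x. g (cscale c x) = cscale c (g x)"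
  shows "lin g"
  unfolding Vector_Spaces.linear_iff by (intro conjI allI coord.vector_space_axioms assms)

lemma flag_iso_refl: "flag_iso m F F"
  unfolding flag_iso_def lin_iso_def by (rule exI[of _ "\<lambda>x. x"]) (simp add: bij_betw_def)

lemma flag_iso_sym:
  assumes "flag_iso m F F'" "coord.subspace (whole F)" "\<And>i. i \<in> {1..m} \<Longrightarrow> part F i \<subseteq> whole F"
  shows "flag_iso m F' F"
proof -
  obtain f where f: "lin_iso (whole F) (whole F') f" "\<And>i. i \<in> {1..m} \<Longrightarrow> f ` part F i = part F' i"
    using assms(1) unfolding flag_iso_def by auto
  have "inv_into (whole F) f ` part F' i = part F i" if "i \<in> {1..m}" for i
    using f(1) assms(3)[OF that] inv_into_image_cancel[of f "whole F" "part F i"]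
    unfolding f(2)[OF that, symmetric] lin_iso_def bij_betw_def by simp
  then show ?thesis using lin_iso_sym[OF f(1) assms(2)] unfolding flag_iso_def by blast
qed

lemma flag_iso_trans:
  assumes "flag_iso m F F'" "flag_iso m F' F''"
  shows "flag_iso m F F''"
proof -
  obtain f where f: "lin_iso (whole F) (whole F') f" "\<And>i. i \<in> {1..m} \<Longrightarrow> f ` part F i = part F' i"
    using assms(1) unfolding flag_iso_def by auto
  obtain g where g: "lin_iso (whole F') (whole F'') g" "\<And>i. i \<in> {1..m} \<Longrightarrow> g ` part F' i = part F'' i"
    using assms(2) unfolding flag_iso_def by auto
  have "(g \<circ> f) ` part F i = part F'' i" if "i \<in> {1..m}" for i
    by (simp only: image_comp[symmetric] f(2)[OF that] g(2)[OF that])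
  then show ?thesis using lin_iso_trans[OF f(1) g(1)] unfolding flag_iso_def by blast
qed

lemma flag_isoI:
  assumes "lin g" "inj_on g (whole F)" "g ` whole F = whole F'"
    "\<And>i. i \<in> {1..m} \<Longrightarrow> g ` part F i = part F' i"
  shows "flag_iso m F F'"
  unfolding flag_iso_def using lin_isoI[OF assms(1-3)] assms(4) by blast

lemma flag_isoE:
  fixes F :: "('i, 'k::field) flag" and F' :: "('j, 'k) flag"
  assumes "flag_iso m F F'" "coord.subspace (whole F)" "\<And>i. i \<in> {1..m} \<Longrightarrow> part F i \<subseteq> whole F"
  obtains g where "lin g" "inj_on g (whole F)" "g ` whole F = whole F'"
    "\<And>i. i \<in> {1..m} \<Longrightarrow> g ` part F i = part F' i"
proof -
  obtain f where f: "lin_iso (whole F) (whole F') f" "\<And>i. i \<in> {1..m} \<Longrightarrow> f ` part F i = part F' i"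
    using assms(1) unfolding flag_iso_def by auto
  obtain g where g: "lin g" "\<And>x. x \<in> whole F \<Longrightarrow> g x = f x" "inj_on g (whole F)" "g ` whole F = whole F'"
    using lin_isoE[OF f(1) assms(2)] by blast
  have "g ` part F i = f ` part F i" if "i \<in> {1..m}" for i
    using g(2) assms(3)[OF that] by (auto intro!: image_cong)
  then show ?thesis using that[OF g(1,3,4)] f(2) by simp
qed

section \<open>External direct sums of spaces\<close>

lemma case_sum_add: "case_sum v w + case_sum v' w' = case_sum (v + v') (w + w')"
  by (rule ext) (simp split: sum.split)

lemma case_sum_cscale: "cscale c (case_sum v w) = case_sum (cscale c v) (cscale c w)"
  by (rule ext) (simp add: cscale_def split: sum.split)

lemma case_sum_0: "case_sum 0 0 = 0"
  by (rule ext) (simp split: sum.split)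

lemma case_sum_fun_inject: "case_sum v w = case_sum v' w' \<longleftrightarrow> v = v' \<and> w = w'"
  by (metis case_sum_o_inj(1,2))

lemma dsumI: "v \<in> V \<Longrightarrow> w \<in> W \<Longrightarrow> case_sum v w \<in> dsum V W"
  unfolding dsum_def by blast

lemma dsumE:
  assumes "x \<in> dsum V W"
  obtains v w where "x = case_sum v w" "v \<in> V" "w \<in> W"
  using assms unfolding dsum_def by blast

lemma subspace_dsum:
  assumes "coord.subspace V" "coord.subspace W"
  shows "coord.subspace (dsum V W)"
proof (rule coord.subspaceI)
  show "0 \<in> dsum V W"
    using dsumI[OF coord.subspace_0[OF assms(1)] coord.subspace_0[OF assms(2)]] by (simp only: case_sum_0)
  show "x + y \<in> dsum V W" if x: "x \<in> dsum V W" and y: "y \<in> dsum V W" for x y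
    by (rule dsumE[OF x], rule dsumE[OF y])
      (simp only: case_sum_add dsumI coord.subspace_add[OF assms(1)] coord.subspace_add[OF assms(2)])
  show "cscale c x \<in> dsum V W" if x: "x \<in> dsum V W" for x c
    by (rule dsumE[OF x])
      (simp only: case_sum_cscale dsumI coord.subspace_scale[OF assms(1)] coord.subspace_scale[OF assms(2)])
qed

lemma dsum_mono: "V \<subseteq> V' \<Longrightarrow> W \<subseteq> W' \<Longrightarrow> dsum V W \<subseteq> dsum V' W'"
  unfolding dsum_def by blast

lemma dSumI:
  "(\<And>s. s \<in> S \<Longrightarrow> (\<lambda>i. x (s, i)) \<in> V s) \<Longrightarrow> (\<And>s i. s \<notin> S \<Longrightarrow> x (s, i) = 0) \<Longrightarrow> x \<in> dSum S V"
  unfolding dSum_def by blast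

lemma dSumD:
  assumes "x \<in> dSum S V"
  shows "s \<in> S \<Longrightarrow> (\<lambda>i. x (s, i)) \<in> V s" "s \<notin> S \<Longrightarrow> x (s, i) = 0"
  using assms unfolding dSum_def by blast+

lemma lin_comp: "lin (\<lambda>x i. x (s, i))"
  by (rule linI) (auto simp: fun_eq_iff cscale_def)

lemma subspace_dSum:
  fixes V :: "'s \<Rightarrow> ('i \<Rightarrow> 'k::field) set"
  assumes "\<And>s. s \<in> S \<Longrightarrow> coord.subspace (V s)"
  shows "coord.subspace (dSum S V)"
proof (rule coord.subspaceI)
  show "0 \<in> dSum S V"
  proof (rule dSumI)
    show "(\<lambda>i. (0 :: 's \<times> 'i \<Rightarrow> 'k) (s, i)) \<in> V s" if "s \<in> S" for s
      using coord.subspace_0[OF assms[OF that]] coord2.linear_0[OF lin_comp] by metis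
  qed simp
  show "x + y \<in> dSum S V" if x: "x \<in> dSum S V" and y: "y \<in> dSum S V" for x y
  proof (rule dSumI)
    show "(\<lambda>i. (x + y) (s, i)) \<in> V s" if "s \<in> S" for s
      using coord.subspace_add[OF assms dSumD(1)[OF x] dSumD(1)[OF y]] that
        coord2.linear_add[OF lin_comp, of x y s] by metis
  qed (use dSumD(2)[OF x] dSumD(2)[OF y] in simp)
  show "cscale c x \<in> dSum S V" if x: "x \<in> dSum S V" for x c
  proof (rule dSumI)
    show "(\<lambda>i. cscale c x (s, i)) \<in> V s" if "s \<in> S" for s
      using coord.subspace_scale[OF assms dSumD(1)[OF x]] that
        coord2.linear_scale[OF lin_comp, of c x s] by metis
  qed (use dSumD(2)[OF x] in \<open>simp add: cscale_def\<close>)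
qed

lemma dSum_mono: "(\<And>s. s \<in> S \<Longrightarrow> V s \<subseteq> V' s) \<Longrightarrow> dSum S V \<subseteq> dSum S V'"
  unfolding dSum_def by blast

subsection \<open>Indecomposability as an internal property\<close>

lemma subset_sum_left:
  assumes "W = {a + b | a b. a \<in> A \<and> b \<in> B}" "coord.subspace A" "coord.subspace B"
  shows "A \<subseteq> W" "B \<subseteq> W"
proof -
  show "A \<subseteq> W"
  proof
    fix x assume "x \<in> A"
    moreover have "x = x + 0" by simp
    ultimately show "x \<in> W" unfolding assms(1) using coord.subspace_0[OF assms(3)] by blast
  qed
  show "B \<subseteq> W"
  proof
    fix x assume "x \<in> B"
    moreover have "x = 0 + x" by simp
    ultimately show "x \<in> W" unfolding assms(1) using coord.subspace_0[OF assms(2)] by blast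
  qed
qed

lemma has_dim_0_iff: "is_flag m D \<Longrightarrow> has_dim m D (0, \<lambda>_. 0) \<longleftrightarrow> whole D = {0}"
proof
  assume "is_flag m D" "has_dim m D (0, \<lambda>_. 0)"
  then show "whole D = {0}" by (simp add: has_dim_def is_flag_def dim_eq_0_fd)
next
  assume D: "is_flag m D" "whole D = {0}"
  have "part D i = {0}" if "i \<in> {1..m}" for i
    using D coord.subspace_0[of "part D i"] that unfolding is_flag_def by auto
  then show "has_dim m D (0, \<lambda>_. 0)" using D by (simp add: has_dim_def dim_zero_space)
qed

lemma lin_add_halves: "lin (\<lambda>z j. z (Inl j) + z (Inr j))"
  by (rule linI) (auto simp: fun_eq_iff cscale_def algebra_simps)

text \<open>The definition quantifies over external sums. An internal splitting is turned into one
  by restricting the flag to \<open>A\<close> and to \<open>B\<close>; addition of the two halves is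
  the isomorphism. Every part is required to lie on one side, as lines and zero spaces do in the
  applications.\<close>

lemma indecomposable_splitD:
  fixes F :: "(nat, 'k::field) flag"
  assumes "indecomposable m F" "coord.subspace A" "coord.subspace B" "A \<inter> B = {0}"
    and "whole F = {a + b | a b. a \<in> A \<and> b \<in> B}"
    and "\<And>i. i \<in> {1..m} \<Longrightarrow> part F i \<subseteq> A \<or> part F i \<subseteq> B"
  shows "A = {0} \<or> B = {0}"
proof (rule ccontr)
  assume ne: "\<not> ?thesis"
  have F: "is_flag m F" using assms(1) unfolding indecomposable_def by simp
  have A0: "0 \<in> A" and B0: "0 \<in> B" using assms(2,3) by (auto intro: coord.subspace_0)
  have AB: "A \<subseteq> whole F" "B \<subseteq> whole F"
    by (rule subset_sum_left[OF assms(5,2,3)])+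
  have fd: "fd_subspace (whole F)" using F unfolding is_flag_def by simp
  define D where "D = Flag A (\<lambda>i. part F i \<inter> A)"
  define D' where "D' = Flag B (\<lambda>i. part F i \<inter> B)"
  have pF: "coord.subspace (part F i)" "part F i \<subseteq> whole F" if "i \<in> {1..m}" for i
    using F that unfolding is_flag_def by auto
  have D: "is_flag m D" "is_flag m D'"
    unfolding is_flag_def D_def D'_def
    using fd_subspace_sub[OF fd assms(2) AB(1)] fd_subspace_sub[OF fd assms(3) AB(2)] pF(1) assms(2,3)
    by (auto intro: coord.subspace_inter)
  have n: "\<not> has_dim m D (0, \<lambda>_. 0)" "\<not> has_dim m D' (0, \<lambda>_. 0)"
    using ne by (simp_all only: has_dim_0_iff[OF D(1)] has_dim_0_iff[OF D(2)]) (simp_all add: D_def D'_def)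
  let ?g = "\<lambda>z j. z (Inl j) + z (Inr j) :: 'k"
  have g: "?g (case_sum a b) = a + b" for a b :: "nat \<Rightarrow> 'k" by (simp add: fun_eq_iff)
  have img: "?g ` dsum V W = {a + b | a b. a \<in> V \<and> b \<in> W}"
    for V W :: "(nat \<Rightarrow> 'k) set"
  proof
    show "?g ` dsum V W \<subseteq> {a + b | a b. a \<in> V \<and> b \<in> W}"
    proof
      fix x assume "x \<in> ?g ` dsum V W"
      then obtain a b where "x = ?g (case_sum a b)" "a \<in> V" "b \<in> W" by (auto elim: dsumE)
      then show "x \<in> {a + b | a b. a \<in> V \<and> b \<in> W}" unfolding g by blast
    qed
    show "{a + b | a b. a \<in> V \<and> b \<in> W} \<subseteq> ?g ` dsum V W"
    proof
      fix x assume "x \<in> {a + b | a b. a \<in> V \<and> b \<in> W}"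
      then obtain a b where ab: "x = a + b" "a \<in> V" "b \<in> W" by blast
      show "x \<in> ?g ` dsum V W"
        by (rule image_eqI[of _ _ "case_sum a b"]) (simp_all only: g ab dsumI)
    qed
  qed
  have "flag_iso m (D \<oplus>\<^sub>F D') F"
  proof (rule flag_isoI[OF lin_add_halves])
    show "inj_on ?g (whole (D \<oplus>\<^sub>F D'))"
    proof (rule inj_onI)
      fix x y assume xy: "x \<in> whole (D \<oplus>\<^sub>F D')" "y \<in> whole (D \<oplus>\<^sub>F D')" "?g x = ?g y"
      obtain a b where x: "x = case_sum a b" "a \<in> A" "b \<in> B"
        using xy(1) by (auto simp: flag_plus_def dsum_def D_def D'_def)
      obtain c d where y: "y = case_sum c d" "c \<in> A" "d \<in> B"
        using xy(2) by (auto simp: flag_plus_def dsum_def D_def D'_def)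
      have "a + b = c + d" using xy(3) unfolding x(1) y(1) g .
      then have e: "a - c = d - b" by (metis add.commute add_diff_cancel_left' diff_add_eq)
      have "a - c \<in> A" "d - b \<in> B"
        using x y coord.subspace_diff[OF assms(2)] coord.subspace_diff[OF assms(3)] by auto
      then have "a - c \<in> A \<inter> B" using e by (simp only: Int_iff)
      then have "a - c = 0" unfolding assms(4) by simp
      moreover from this have "d - b = 0" unfolding e .
      ultimately show "x = y" unfolding x(1) y(1) by (simp only: right_minus_eq)
    qed
    show "?g ` whole (D \<oplus>\<^sub>F D') = whole F"
      unfolding assms(5) by (simp only: img flag_plus_def D_def D'_def flag.sel)
    fix i assume i: "i \<in> {1..m}"
    have "part F i = {a + b | a b. a \<in> part F i \<inter> A \<and> b \<in> part F i \<inter> B}"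
    proof
      show "{a + b | a b. a \<in> part F i \<inter> A \<and> b \<in> part F i \<inter> B} \<subseteq> part F i"
        using coord.subspace_add[OF pF(1)[OF i]] by auto
      have p0: "0 \<in> part F i" using pF(1)[OF i] by (rule coord.subspace_0)
      show "part F i \<subseteq> {a + b | a b. a \<in> part F i \<inter> A \<and> b \<in> part F i \<inter> B}"
      proof
        fix x assume x: "x \<in> part F i"
        have "x = x + 0" "x = 0 + x" by simp_all
        then show "x \<in> {a + b | a b. a \<in> part F i \<inter> A \<and> b \<in> part F i \<inter> B}"
          using assms(6)[OF i] x p0 A0 B0 by blast
      qed
    qed
    moreover have "?g ` part (D \<oplus>\<^sub>F D') i = {a + b | a b. a \<in> part F i \<inter> A \<and> b \<in> part F i \<inter> B}"
      by (simp only: img flag_plus_def D_def D'_def flag.sel)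
    ultimately show "?g ` part (D \<oplus>\<^sub>F D') i = part F i" by simp
  qed
  then have "flag_iso m F (D \<oplus>\<^sub>F D')"
  proof (rule flag_iso_sym)
    show "coord.subspace (whole (D \<oplus>\<^sub>F D'))"
      by (simp add: flag_plus_def D_def D'_def subspace_dsum assms(2,3))
    show "part (D \<oplus>\<^sub>F D') i \<subseteq> whole (D \<oplus>\<^sub>F D')" for i
      by (simp add: flag_plus_def D_def D'_def dsum_mono)
  qed
  then show False using assms(1) D n unfolding indecomposable_def by blast
qed

text \<open>The converse passage: the images \<open>p\<close> and \<open>q\<close> of the two
  external halves split the whole space internally. A part may now be spread over both sides, so the
  splitting hypothesis only says that each of its vectors is a sum of two vectors of the same part,
  one on either side.\<close>

lemma indecomposableI:
  fixes F :: "(nat, 'k::field) flag"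
  assumes F: "is_flag m F"
    and split: "\<And>A B. coord.subspace A \<Longrightarrow> coord.subspace B \<Longrightarrow> A \<inter> B = {0} \<Longrightarrow>
      whole F = {a + b | a b. a \<in> A \<and> b \<in> B} \<Longrightarrow>
      (\<And>i x. i \<in> {1..m} \<Longrightarrow> x \<in> part F i \<Longrightarrow> \<exists>a\<in>part F i \<inter> A. \<exists>b\<in>part F i \<inter> B. x = a + b) \<Longrightarrow>
      A = {0} \<or> B = {0}"
  shows "indecomposable m F"
  unfolding indecomposable_def
proof (intro conjI notI; (elim exE conjE)?)
  show "is_flag m F" by fact
  fix D D' :: "(nat, 'k) flag"
  assume D: "is_flag m D" "is_flag m D'" and n: "\<not> has_dim m D (0, \<lambda>_. 0)" "\<not> has_dim m D' (0, \<lambda>_. 0)"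
    and iso: "flag_iso m F (D \<oplus>\<^sub>F D')"
  have sF: "coord.subspace (whole F)" "\<And>i. i \<in> {1..m} \<Longrightarrow> part F i \<subseteq> whole F"
    using F unfolding is_flag_def fd_subspace_def by auto
  have sD: "coord.subspace (whole D)" "coord.subspace (whole D')"
    using D unfolding is_flag_def fd_subspace_def by auto
  have pD: "coord.subspace (part D i)" "part D i \<subseteq> whole D"
    "coord.subspace (part D' i)" "part D' i \<subseteq> whole D'" if "i \<in> {1..m}" for i
    using D that unfolding is_flag_def by auto
  have "flag_iso m (D \<oplus>\<^sub>F D') F" by (rule flag_iso_sym[OF iso sF])
  moreover have "coord.subspace (whole (D \<oplus>\<^sub>F D'))"
    "\<And>i. i \<in> {1..m} \<Longrightarrow> part (D \<oplus>\<^sub>F D') i \<subseteq> whole (D \<oplus>\<^sub>F D')"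
    using sD pD by (simp_all add: flag_plus_def subspace_dsum dsum_mono)
  ultimately obtain h where h: "lin h" "inj_on h (whole (D \<oplus>\<^sub>F D'))" "h ` whole (D \<oplus>\<^sub>F D') = whole F"
    "\<And>i. i \<in> {1..m} \<Longrightarrow> h ` part (D \<oplus>\<^sub>F D') i = part F i"
    using flag_isoE by metis
  define p where "p v = h (case_sum v 0)" for v
  define q where "q w = h (case_sum 0 w)" for w
  have hpq: "h (case_sum v w) = p v + q w" for v w
    unfolding p_def q_def coord2.linear_add[OF h(1), symmetric] case_sum_add by simp
  have p: "lin p" and q: "lin q"
    unfolding p_def q_def
    by (rule linI; simp only: coord2.linear_add[OF h(1), symmetric] coord2.linear_scale[OF h(1), symmetric]
        case_sum_add case_sum_cscale coord.scale_zero_right add_0_right)+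
  have dir: "v = v' \<and> w = w'"
    if "v \<in> whole D" "v' \<in> whole D" "w \<in> whole D'" "w' \<in> whole D'" "p v + q w = p v' + q w'" for v v' w w'
  proof -
    have "h (case_sum v w) = h (case_sum v' w')" using that(5) unfolding hpq .
    moreover have "case_sum v w \<in> whole (D \<oplus>\<^sub>F D')" "case_sum v' w' \<in> whole (D \<oplus>\<^sub>F D')"
      using that by (auto simp: flag_plus_def dsum_def)
    ultimately have "case_sum v w = case_sum v' w'" by (rule inj_onD[OF h(2)])
    then show ?thesis by (simp only: case_sum_fun_inject)
  qed
  have z: "0 \<in> whole D" "0 \<in> whole D'" using sD by (auto intro: coord.subspace_0)
  have pq0: "p 0 = 0" "q 0 = 0" using p q by (auto intro: coord2.linear_0)
  let ?A = "p ` whole D" and ?B = "q ` whole D'"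
  have "?A = {0} \<or> ?B = {0}"
  proof (rule split)
    show "coord.subspace ?A" by (rule coord2.linear_subspace_image[OF p sD(1)])
    show "coord.subspace ?B" by (rule coord2.linear_subspace_image[OF q sD(2)])
    show "?A \<inter> ?B = {0}"
    proof
      show "?A \<inter> ?B \<subseteq> {0}"
      proof
        fix x assume x: "x \<in> ?A \<inter> ?B"
        then obtain v where v: "x = p v" "v \<in> whole D" by auto
        obtain w where w: "x = q w" "w \<in> whole D'" using x by auto
        have "p v + q 0 = p 0 + q w" using pq0 v(1) w(1) by simp
        then have "v = 0" using dir[OF v(2) z(1) z(2) w(2)] by simp
        then show "x \<in> {0}" using v(1) pq0 by simp
      qed
      have "0 \<in> ?A" by (rule image_eqI[of _ _ 0]) (simp_all add: pq0 z)
      moreover have "0 \<in> ?B" by (rule image_eqI[of _ _ 0]) (simp_all add: pq0 z)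
      ultimately show "{0} \<subseteq> ?A \<inter> ?B" by simp
    qed
    have "whole F = {h (case_sum v w) |v w. v \<in> whole D \<and> w \<in> whole D'}"
      unfolding h(3)[symmetric] by (auto simp: flag_plus_def dsum_def)
    also have "\<dots> = {a + b |a b. a \<in> ?A \<and> b \<in> ?B}" unfolding hpq by auto
    finally show "whole F = {a + b |a b. a \<in> ?A \<and> b \<in> ?B}" .
    fix i x assume i: "i \<in> {1..m}" and x: "x \<in> part F i"
    have mem: "p v + q w \<in> part F i" if "v \<in> part D i" "w \<in> part D' i" for v w
      unfolding h(4)[OF i, symmetric] hpq[symmetric] using that
      by (auto simp: flag_plus_def dsum_def)
    obtain v w where vw: "x = p v + q w" "v \<in> part D i" "w \<in> part D' i"
      using x unfolding h(4)[OF i, symmetric] by (auto simp: flag_plus_def dsum_def hpq)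
    have "p v \<in> part F i" "q w \<in> part F i"
      using mem[OF vw(2) coord.subspace_0[OF pD(3)[OF i]]] mem[OF coord.subspace_0[OF pD(1)[OF i]] vw(3)]
        pq0 by simp_all
    then show "\<exists>a\<in>part F i \<inter> ?A. \<exists>b\<in>part F i \<inter> ?B. x = a + b"
      using vw pD(2,4)[OF i] by blast
  qed
  then show False
  proof
    assume A: "?A = {0}"
    have "v = 0" if "v \<in> whole D" for v
    proof -
      have "p v = 0" using A that by blast
      then have "p v + q 0 = p 0 + q 0" using pq0 by simp
      then show ?thesis using dir[OF that z(1) z(2) z(2)] by blast
    qed
    then have "whole D = {0}" using z(1) by blast
    then show False using n(1) has_dim_0_iff[OF D(1)] by simp
  next
    assume B: "?B = {0}"
    have "w = 0" if "w \<in> whole D'" for w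
    proof -
      have "q w = 0" using B that by blast
      then have "p 0 + q w = p 0 + q 0" using pq0 by simp
      then show ?thesis using dir[OF z(1) z(1) that z(2)] by blast
    qed
    then have "whole D' = {0}" using z(2) by blast
    then show False using n(2) has_dim_0_iff[OF D(2)] by simp
  qed
qed

text \<open>Serves for the summands with empty block, which contain no vector of the
  configuration.\<close>

lemma indecomposable_line:
  fixes F :: "(nat, 'k::field) flag"
  assumes "is_flag m F" "whole F = coord.span {u}"
  shows "indecomposable m F"
proof (rule indecomposableI[OF assms(1)])
  fix A B :: "(nat \<Rightarrow> 'k) set"
  assume A: "coord.subspace A" and B: "coord.subspace B" and AB: "A \<inter> B = {0}"
    and W: "whole F = {a + b | a b. a \<in> A \<and> b \<in> B}"
  show "A = {0} \<or> B = {0}"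
  proof (rule ccontr)
    assume ne: "\<not> ?thesis"
    obtain a where a: "a \<in> A" "a \<noteq> 0" using ne coord.subspace_0[OF A] by blast
    have "a \<in> coord.span {u}" using subset_sum_left(1)[OF W A B] a(1) assms(2) by blast
    then have "coord.span {a} = whole F" using in_span_singleton_nonzero a(2) assms(2) by simp
    then have "B \<subseteq> coord.span {a}" using subset_sum_left(2)[OF W A B] by simp
    also have "\<dots> \<subseteq> A" using a(1) A by (simp add: coord.span_minimal)
    finally have "B = {0}" using AB coord.subspace_0[OF B] by blast
    then show False using ne by simp
  qed
qed

text \<open>A line that splits along \<open>A\<close> and \<open>B\<close> lies in one of them.
  Sorting the indices by side is a direct splitting of the configuration, so by connectivity all
  vectors lie on one side, and the other side is zero.\<close>

lemma indecomposable_conn: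
  fixes v :: "nat \<Rightarrow> nat \<Rightarrow> 'k::field"
  assumes "conn v K" "K \<subseteq> {1..m}" "is_flag m F" "whole F = coord.span (v ` K)"
    "\<And>i. i \<in> K \<Longrightarrow> part F i = coord.span {v i}"
  shows "indecomposable m F"
proof (rule indecomposableI[OF assms(3)])
  fix A B :: "(nat \<Rightarrow> 'k) set"
  assume A: "coord.subspace A" and B: "coord.subspace B" and AB: "A \<inter> B = {0}"
    and W: "whole F = {a + b | a b. a \<in> A \<and> b \<in> B}"
    and parts: "\<And>i x. i \<in> {1..m} \<Longrightarrow> x \<in> part F i \<Longrightarrow> \<exists>a\<in>part F i \<inter> A. \<exists>b\<in>part F i \<inter> B. x = a + b"
  have AorB: "v i \<in> A \<or> v i \<in> B" if i: "i \<in> K" for i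
  proof -
    have "v i \<in> part F i" using assms(5)[OF i] by (simp add: coord.span_base)
    then obtain a b where ab: "a \<in> part F i" "a \<in> A" "b \<in> B" "v i = a + b"
      using parts[of i] i assms(2) by blast
    show ?thesis
    proof (cases "a = 0")
      case True
      then show ?thesis using ab by simp
    next
      case False
      have "v i \<in> coord.span {a}"
        using in_span_singleton_nonzero[of a "v i"] ab(1) assms(5)[OF i] False by (simp add: coord.span_base)
      also have "\<dots> \<subseteq> A" using ab(2) A by (simp add: coord.span_minimal)
      finally show ?thesis by simp
    qed
  qed
  \<comment> \<open>No nonemptiness of \<open>T\<close> is assumed: either extreme case puts the
    whole space on one side.\<close>
  define T where "T = {i \<in> K. v i \<in> A}"
  have TA: "coord.span (v ` T) \<subseteq> A" by (rule coord.span_minimal) (auto simp: T_def A)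
  have TB: "coord.span (v ` (K - T)) \<subseteq> B" by (rule coord.span_minimal) (use AorB B in \<open>auto simp: T_def\<close>)
  have "coord.span (v ` T) \<inter> coord.span (v ` (K - T)) = {0}"
    using TA TB AB coord.span_zero[of "v ` T"] coord.span_zero[of "v ` (K - T)"] by blast
  moreover have "T \<subseteq> K" by (auto simp: T_def)
  ultimately have "T = {} \<or> T = K" using connD[OF assms(1), of T] by argo
  then consider "T = {}" | "T = K" by argo
  then show "A = {0} \<or> B = {0}"
  proof cases
    case 1
    then have "A \<subseteq> B" using TB subset_sum_left(1)[OF W A B] assms(4) by simp
    then show ?thesis using AB by blast
  next
    case 2
    then have "B \<subseteq> A" using TA subset_sum_left(2)[OF W A B] assms(4) by simp
    then show ?thesis using AB by blast
  qed
qed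

subsection \<open>Amalgamating the four families of summands\<close>

text \<open>A single index set for the four families in \<open>constructible\<close>, so that one
  \<open>flag_Sum\<close> can be analysed summand by summand instead of a nested sum.\<close>

definition summands :: "nat \<Rightarrow> param \<Rightarrow> (nat + nat set + nat set + nat set \<times> nat) set" where
  "summands n p = {1..n - rk p} <+> fst p <+> fst (snd p) <+> snd (snd p)"

definition sblock :: "nat + nat set + nat set + nat set \<times> nat \<Rightarrow> nat set" where
  "sblock = case_sum (\<lambda>_. {}) block"

definition srank :: "nat + nat set + nat set + nat set \<times> nat \<Rightarrow> nat" where
  "srank = case_sum (\<lambda>_. 1) (case_sum (\<lambda>_. 1) (case_sum (\<lambda>J. card J - 1) snd))"

text \<open>The right operand \<open>H\<close> is only assumed isomorphic to a sum over
  \<open>T\<close>; this lets the lemma be applied repeatedly, from the innermost sum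
  outwards.\<close>

lemma flag_plus_Sum:
  fixes F :: "'s \<Rightarrow> ('i, 'k::field) flag" and G :: "'t \<Rightarrow> ('i, 'k) flag" and H :: "('j, 'k) flag"
  assumes "flag_iso m H (flag_Sum T G)" "coord.subspace (whole H)"
    "\<And>i. i \<in> {1..m} \<Longrightarrow> part H i \<subseteq> whole H"
  shows "flag_iso m (flag_Sum S F \<oplus>\<^sub>F H) (flag_Sum (S <+> T) (case_sum F G))"
proof -
  obtain h where h: "lin h" "inj_on h (whole H)" "h ` whole H = whole (flag_Sum T G)"
    "\<And>i. i \<in> {1..m} \<Longrightarrow> h ` part H i = part (flag_Sum T G) i"
    using flag_isoE[OF assms] by metis
  \<comment> \<open>Coordinates of the left half are merely relabelled; the right half passes
    through \<open>h\<close>.\<close>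
  define f :: "('s \<times> 'i + 'j \<Rightarrow> 'k) \<Rightarrow> ('s + 't) \<times> 'i \<Rightarrow> 'k" where
    "f z = (\<lambda>u. case fst u of Inl a \<Rightarrow> z (Inl (a, snd u)) | Inr b \<Rightarrow> h (\<lambda>j. z (Inr j)) (b, snd u))" for z
  have f_Inl: "f z (Inl a, i) = z (Inl (a, i))" and f_Inr: "f z (Inr b, i) = h (\<lambda>j. z (Inr j)) (b, i)"
    for z a b i by (simp_all add: f_def)
  have ext: "x = y" if "\<And>a i. x (Inl a, i) = y (Inl a, i)" "\<And>b i. x (Inr b, i) = y (Inr b, i)"
    for x y :: "('s + 't) \<times> 'i \<Rightarrow> 'k"
  proof
    fix u show "x u = y u" using that by (cases u; cases "fst u") auto
  qed
  have "lin f"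
  proof (rule linI)
    fix x y :: "'s \<times> 'i + 'j \<Rightarrow> 'k" and c
    have "(\<lambda>j. (x + y) (Inr j)) = (\<lambda>j. x (Inr j)) + (\<lambda>j. y (Inr j))" by (simp add: fun_eq_iff)
    then show "f (x + y) = f x + f y"
      by (intro ext) (simp_all add: f_Inl f_Inr coord2.linear_add[OF h(1)])
    have e: "(\<lambda>j. cscale c x (Inr j)) = cscale c (\<lambda>j. x (Inr j))" by (simp add: fun_eq_iff cscale_def)
    show "f (cscale c x) = cscale c (f x)"
    proof (rule ext)
      show "f (cscale c x) (Inr b, i) = cscale c (f x) (Inr b, i)" for b i
        unfolding f_Inr e coord2.linear_scale[OF h(1)] by (simp only: cscale_def f_Inr)
    qed (simp add: f_Inl cscale_def)
  qed
  have img: "f ` dsum (dSum S V) W = dSum (S <+> T) (case_sum V U)" if W: "h ` W = dSum T U" for V W U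
  proof
    show "f ` dsum (dSum S V) W \<subseteq> dSum (S <+> T) (case_sum V U)"
    proof (rule image_subsetI)
      fix z assume "z \<in> dsum (dSum S V) W"
      then obtain x y where z: "z = case_sum x y" "x \<in> dSum S V" "y \<in> W" by (rule dsumE)
      have y: "h y \<in> dSum T U" using z(3) W by blast
      have fz: "f z (Inl a, i) = x (a, i)" "f z (Inr b, i) = h y (b, i)" for a b i
        by (simp_all add: f_Inl f_Inr z(1))
      show "f z \<in> dSum (S <+> T) (case_sum V U)"
      proof (rule dSumI)
        show "(\<lambda>i. f z (s, i)) \<in> case_sum V U s" if "s \<in> S <+> T" for s
          using that dSumD(1)[OF z(2)] dSumD(1)[OF y] by (auto simp: fz)
        show "f z (s, i) = 0" if "s \<notin> S <+> T" for s i
          using that dSumD(2)[OF z(2)] dSumD(2)[OF y] by (cases s) (auto simp: fz)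
      qed
    qed
    show "dSum (S <+> T) (case_sum V U) \<subseteq> f ` dsum (dSum S V) W"
    proof
      fix z assume z: "z \<in> dSum (S <+> T) (case_sum V U)"
      define x where "x = (\<lambda>u. z (Inl (fst u), snd u))"
      define y' where "y' = (\<lambda>u. z (Inr (fst u), snd u))"
      have x: "x \<in> dSum S V"
        by (rule dSumI) (use dSumD(1)[OF z, of "Inl _"] dSumD(2)[OF z, of "Inl _"] in \<open>auto simp: x_def\<close>)
      have "y' \<in> dSum T U"
        by (rule dSumI) (use dSumD(1)[OF z, of "Inr _"] dSumD(2)[OF z, of "Inr _"] in \<open>auto simp: y'_def\<close>)
      then obtain y where y: "y \<in> W" "y' = h y" using W by blast
      have "z = f (case_sum x y)"
        by (rule ext) (simp_all add: f_Inl f_Inr y(2)[symmetric] x_def y'_def)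
      then show "z \<in> f ` dsum (dSum S V) W" using dsumI[OF x y(1)] by blast
    qed
  qed
  show ?thesis
  proof (rule flag_isoI[OF \<open>lin f\<close>])
    show "inj_on f (whole (flag_Sum S F \<oplus>\<^sub>F H))"
    proof (rule inj_onI)
      fix z z' assume "z \<in> whole (flag_Sum S F \<oplus>\<^sub>F H)" "z' \<in> whole (flag_Sum S F \<oplus>\<^sub>F H)"
        and eq: "f z = f z'"
      then obtain x y x' y' where z: "z = case_sum x y" "y \<in> whole H" "z' = case_sum x' y'" "y' \<in> whole H"
        by (auto simp: flag_plus_def elim!: dsumE)
      have "x u = x' u" for u
        using fun_cong[OF eq, of "(Inl (fst u), snd u)"] by (simp add: f_Inl z(1,3))
      then have x: "x = x'" by (rule HOL.ext)
      have "h y u = h y' u" for u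
        using fun_cong[OF eq, of "(Inr (fst u), snd u)"] by (simp add: f_Inr z(1,3))
      then have "h y = h y'" by (rule HOL.ext)
      then have "y = y'" by (rule inj_onD[OF h(2) _ z(2,4)])
      then show "z = z'" unfolding z(1,3) x by simp
    qed
    have e: "(\<lambda>s. w (case_sum F G s)) = case_sum (\<lambda>s. w (F s)) (\<lambda>s. w (G s))"
      for w :: "('i, 'k) flag \<Rightarrow> ('i \<Rightarrow> 'k) set"
      by (rule HOL.ext) (simp split: sum.split)
    show "f ` whole (flag_Sum S F \<oplus>\<^sub>F H) = whole (flag_Sum (S <+> T) (case_sum F G))"
      using img[of "whole H" "\<lambda>s. whole (G s)"] h(3) by (simp add: flag_plus_def flag_Sum_def e)
    show "f ` part (flag_Sum S F \<oplus>\<^sub>F H) i = part (flag_Sum (S <+> T) (case_sum F G)) i"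
      if "i \<in> {1..m}" for i
      using img[of "part H i" "\<lambda>s. part (G s) i"] h(4)[OF that]
      by (simp add: flag_plus_def flag_Sum_def e[of "\<lambda>F. part F i"])
  qed
qed

lemma subspace_whole_Sum:
  "(\<And>s. s \<in> S \<Longrightarrow> is_flag m (F s)) \<Longrightarrow> coord.subspace (whole (flag_Sum S F))"
  unfolding flag_Sum_def flag.sel by (rule subspace_dSum) (simp add: is_flag_def fd_subspace_def)

lemma part_Sum_subset:
  "(\<And>s. s \<in> S \<Longrightarrow> is_flag m (F s)) \<Longrightarrow> i \<in> {1..m} \<Longrightarrow> part (flag_Sum S F) i \<subseteq> whole (flag_Sum S F)"
  unfolding flag_Sum_def flag.sel by (rule dSum_mono) (simp add: is_flag_def)

lemma subspace_whole_plus: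
  "coord.subspace (whole F) \<Longrightarrow> coord.subspace (whole G) \<Longrightarrow> coord.subspace (whole (F \<oplus>\<^sub>F G))"
  by (simp add: flag_plus_def subspace_dsum)

lemma part_plus_subset:
  "part F i \<subseteq> whole F \<Longrightarrow> part G i \<subseteq> whole G \<Longrightarrow> part (F \<oplus>\<^sub>F G) i \<subseteq> whole (F \<oplus>\<^sub>F G)"
  by (simp add: flag_plus_def dsum_mono)

lemma
  fixes F0 :: "'a \<Rightarrow> ('i, 'k::field) flag" and FI :: "'b \<Rightarrow> ('i, 'k) flag"
    and DJ :: "'c \<Rightarrow> ('i, 'k) flag" and EK :: "'d \<Rightarrow> ('i, 'k) flag"
  assumes "\<And>s. s \<in> A \<Longrightarrow> is_flag m (F0 s)" "\<And>s. s \<in> B \<Longrightarrow> is_flag m (FI s)"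
    "\<And>s. s \<in> C \<Longrightarrow> is_flag m (DJ s)" "\<And>s. s \<in> D \<Longrightarrow> is_flag m (EK s)"
  defines "L \<equiv> flag_Sum A F0 \<oplus>\<^sub>F flag_Sum B FI \<oplus>\<^sub>F flag_Sum C DJ \<oplus>\<^sub>F flag_Sum D EK"
    and "R \<equiv> flag_Sum (A <+> B <+> C <+> D) (case_sum F0 (case_sum FI (case_sum DJ EK)))"
  shows four_sums_iso: "flag_iso m L R" and four_sums_iso': "flag_iso m R L"
proof -
  note s = subspace_whole_Sum[of A m F0, OF assms(1)] subspace_whole_Sum[of B m FI, OF assms(2)]
    subspace_whole_Sum[of C m DJ, OF assms(3)] subspace_whole_Sum[of D m EK, OF assms(4)]
  note p = part_Sum_subset[of A m F0, OF assms(1)] part_Sum_subset[of B m FI, OF assms(2)]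
    part_Sum_subset[of C m DJ, OF assms(3)] part_Sum_subset[of D m EK, OF assms(4)]
  show "flag_iso m L R"
    unfolding L_def R_def by (intro flag_plus_Sum flag_iso_refl subspace_whole_plus part_plus_subset s p)
  then show "flag_iso m R L"
    unfolding L_def by (rule flag_iso_sym) (intro subspace_whole_plus part_plus_subset s p; assumption)+
qed

lemma constructible_iff:
  fixes F :: "('i, 'k::field) flag"
  shows "constructible n m p F \<longleftrightarrow> is_flag m F \<and>
    (\<exists>G :: _ \<Rightarrow> (nat, 'k) flag.
      (\<forall>s\<in>summands n p. indecomposable m (G s) \<and> has_dim m (G s) (dvec (sblock s) (srank s))) \<and>
      flag_iso m F (flag_Sum (summands n p) G))"
    (is "?L \<longleftrightarrow> ?R")
proof -
  obtain Is Js Ks where p: "p = (Is, Js, Ks)" by (metis prod_cases3)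
  let ?k = "n - rk (Is, Js, Ks)"
  have S: "summands n p = {1..?k} <+> Is <+> Js <+> Ks" by (simp add: summands_def p)
  have ind: "is_flag m H" if "indecomposable m H" for H :: "(nat, 'k) flag"
    using that by (simp add: indecomposable_def)
  show ?thesis
  proof
    assume ?L
    then obtain F0 FI DJ EK where F: "is_flag m F"
      and F0: "\<forall>k\<in>{1..?k}. indecomposable m (F0 k) \<and> has_dim m (F0 k) (dvec {} 1)"
      and FI: "\<forall>I\<in>Is. indecomposable m (FI I) \<and> has_dim m (FI I) (dvec I 1)"
      and DJ: "\<forall>J\<in>Js. indecomposable m (DJ J) \<and> has_dim m (DJ J) (dvec J (card J - 1))"
      and EK': "\<forall>(K, r)\<in>Ks. indecomposable m (EK (K, r)) \<and> has_dim m (EK (K, r)) (dvec K r)"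
      and iso: "flag_iso m F (flag_Sum {1..?k} (F0 :: nat \<Rightarrow> (nat, 'k) flag) \<oplus>\<^sub>F
         flag_Sum Is (FI :: nat set \<Rightarrow> (nat, 'k) flag) \<oplus>\<^sub>F
         flag_Sum Js (DJ :: nat set \<Rightarrow> (nat, 'k) flag) \<oplus>\<^sub>F
         flag_Sum Ks (EK :: nat set \<times> nat \<Rightarrow> (nat, 'k) flag))"
      unfolding p constructible.simps by (elim conjE exE) (rule that)
    have EK: "\<forall>K\<in>Ks. indecomposable m (EK K) \<and> has_dim m (EK K) (dvec (fst K) (snd K))"
      using EK' by (simp add: case_prod_unfold)
    let ?G = "case_sum F0 (case_sum FI (case_sum DJ EK))"
    have "flag_iso m F (flag_Sum (summands n p) ?G)"
      unfolding S by (rule flag_iso_trans[OF iso four_sums_iso]) (simp_all add: ind F0 FI DJ EK)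
    moreover have "indecomposable m (?G s) \<and> has_dim m (?G s) (dvec (sblock s) (srank s))"
      if "s \<in> summands n p" for s
      using that F0 FI DJ EK unfolding S by (auto simp: sblock_def srank_def block_def)
    ultimately show ?R using F by blast
  next
    assume ?R
    then obtain G :: "_ \<Rightarrow> (nat, 'k) flag" where F: "is_flag m F"
      and G: "\<And>s. s \<in> summands n p \<Longrightarrow> indecomposable m (G s)"
        "\<And>s. s \<in> summands n p \<Longrightarrow> has_dim m (G s) (dvec (sblock s) (srank s))"
      and iso: "flag_iso m F (flag_Sum (summands n p) G)"
      by blast
    define F0 FI DJ EK where d: "F0 = (\<lambda>k. G (Inl k))" "FI = (\<lambda>I. G (Inr (Inl I)))"
      "DJ = (\<lambda>J. G (Inr (Inr (Inl J))))" "EK = (\<lambda>K. G (Inr (Inr (Inr K))))"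
    have mem: "k \<in> {1..?k} \<Longrightarrow> Inl k \<in> summands n p" "I \<in> Is \<Longrightarrow> Inr (Inl I) \<in> summands n p"
      "J \<in> Js \<Longrightarrow> Inr (Inr (Inl J)) \<in> summands n p" "K \<in> Ks \<Longrightarrow> Inr (Inr (Inr K)) \<in> summands n p"
      for k I J K unfolding S by blast+
    have F0: "indecomposable m (F0 k) \<and> has_dim m (F0 k) (dvec {} 1)" if "k \<in> {1..?k}" for k
      using G[OF mem(1)[OF that]] by (simp add: d sblock_def srank_def)
    have FI: "indecomposable m (FI I) \<and> has_dim m (FI I) (dvec I 1)" if "I \<in> Is" for I
      using G[OF mem(2)[OF that]] by (simp add: d sblock_def srank_def block_def)
    have DJ: "indecomposable m (DJ J) \<and> has_dim m (DJ J) (dvec J (card J - 1))" if "J \<in> Js" for J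
      using G[OF mem(3)[OF that]] by (simp add: d sblock_def srank_def block_def)
    have EK: "indecomposable m (EK K) \<and> has_dim m (EK K) (dvec (fst K) (snd K))" if "K \<in> Ks" for K
      using G[OF mem(4)[OF that]] by (simp add: d sblock_def srank_def block_def)
    have Geq: "G = case_sum F0 (case_sum FI (case_sum DJ EK))"
      by (rule ext) (simp add: d split: sum.split)
    have "flag_iso m (flag_Sum (summands n p) G)
      (flag_Sum {1..?k} F0 \<oplus>\<^sub>F flag_Sum Is FI \<oplus>\<^sub>F flag_Sum Js DJ \<oplus>\<^sub>F flag_Sum Ks EK)"
      unfolding S Geq by (rule four_sums_iso') (simp_all only: ind F0 FI DJ EK)
    then have "flag_iso m F (flag_Sum {1..?k} F0 \<oplus>\<^sub>F flag_Sum Is FI \<oplus>\<^sub>F flag_Sum Js DJ \<oplus>\<^sub>F flag_Sum Ks EK)"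
      by (rule flag_iso_trans[OF iso])
    moreover have "\<forall>(K, r)\<in>Ks. indecomposable m (EK (K, r)) \<and> has_dim m (EK (K, r)) (dvec K r)"
      using EK by auto
    ultimately show ?L
      unfolding p constructible.simps using F F0 FI DJ by blast
  qed
qed

lemma constructible_iso:
  assumes "constructible n m p F'" "flag_iso m F F'" "is_flag m F"
  shows "constructible n m p F"
  using assms flag_iso_trans unfolding constructible_iff by blast

section \<open>Constructible flags and connected components\<close>

text \<open>The vectors are determined by the lines up to nonzero scalars, one for each index.
  Properties of \<open>v\<close> that survive rescaling, such as spans and independence, are
  properties of \<open>X\<close>.\<close>

definition represents :: "nat \<Rightarrow> nat \<Rightarrow> (nat \<Rightarrow> nat \<Rightarrow> 'k::field) \<Rightarrow> 'k flag_point \<Rightarrow> bool" where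
  "represents n m v X \<longleftrightarrow> (\<forall>i\<in>{1..m}. v i \<in> Kn n \<and> v i \<noteq> 0 \<and> X i = coord.span {v i})"

lemma representsD:
  assumes "represents n m v X" "i \<in> {1..m}"
  shows "v i \<in> Kn n" "v i \<noteq> 0" "X i = coord.span {v i}"
  using assms unfolding represents_def by auto

lemma is_flag_represents:
  assumes "represents n m v X"
  shows "is_flag m (Flag (Kn n) X)"
  unfolding is_flag_def flag.sel
proof (intro conjI ballI)
  fix i assume "i \<in> {1..m}"
  note r = representsD[OF assms this]
  show "coord.subspace (X i)" "X i \<subseteq> Kn n"
    unfolding r(3) using r(1) by (simp_all add: coord.span_minimal)
qed simp

lemma part_0_dim:
  assumes "has_dim m F (dvec K r)" "i \<in> {1..m}" "i \<notin> K"
  shows "part F i = {0}"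
proof -
  have F: "fd_subspace (whole F)" "coord.subspace (part F i)" "part F i \<subseteq> whole F"
    "coord.dim (part F i) = 0"
    using assms unfolding has_dim_def is_flag_def dvec_def by auto
  show ?thesis using dim_eq_0_fd[OF fd_subspace_sub[OF F(1-3)]] F(4) by simp
qed

lemma part_line_dim:
  assumes "has_dim m F (dvec K r)" "i \<in> {1..m}" "i \<in> K" "x \<in> part F i" "x \<noteq> 0"
  shows "part F i = coord.span {x}"
proof -
  have F: "coord.subspace (part F i)" "coord.dim (part F i) = 1"
    using assms unfolding has_dim_def is_flag_def dvec_def by auto
  then obtain w where w: "part F i = coord.span {w}" using dim_eq_1_iff by metis
  then show ?thesis using in_span_singleton_nonzero[of x w] assms(4,5) by simp
qed

text \<open>Let \<open>c s\<close> be the component of the isomorphism at \<open>s\<close>. It kills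
  the vectors outside \<open>b s\<close>, whose parts in \<open>G s\<close> are zero, and the other
  components kill the vectors inside. So \<open>c s\<close> is injective on the span of the block
  and zero on the span of the rest, which makes their sum direct. Inside \<open>G s\<close> the
  images of the vectors must fill the whole space and be connected, as otherwise \<open>G s\<close>
  would split.\<close>

lemma summand_component:
  fixes v :: "nat \<Rightarrow> nat \<Rightarrow> 'k::field" and G :: "'s \<Rightarrow> (nat, 'k) flag"
  assumes rep: "represents n m v X"
    and ind: "\<And>s. s \<in> S \<Longrightarrow> indecomposable m (G s)"
    and dim: "\<And>s. s \<in> S \<Longrightarrow> has_dim m (G s) (dvec (b s) (r s))"
    and iso: "flag_iso m (Flag (Kn n) X) (flag_Sum S G)"
    and dis: "disjoint_family_on b S" and sub: "\<And>s. s \<in> S \<Longrightarrow> b s \<subseteq> {1..m}"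
    and s: "s \<in> S" "b s \<noteq> {}"
  shows "conn v (b s)" "coord.span (v ` b s) \<inter> coord.span (v ` ({1..m} - b s)) = {0}"
    "r s = coord.dim (v ` b s)"
proof -
  have "is_flag m (Flag (Kn n) X)" by (rule is_flag_represents[OF rep])
  then have X: "\<And>i. i \<in> {1..m} \<Longrightarrow> part (Flag (Kn n) X) i \<subseteq> whole (Flag (Kn n) X)"
    unfolding is_flag_def by simp
  have K: "coord.subspace (whole (Flag (Kn n :: (nat \<Rightarrow> 'k) set) X))" by simp
  obtain g where g: "lin g" "inj_on g (Kn n)" "g ` Kn n = dSum S (\<lambda>s. whole (G s))"
    "\<And>i. i \<in> {1..m} \<Longrightarrow> g ` X i = dSum S (\<lambda>s. part (G s) i)"
    using flag_isoE[OF iso K X] unfolding flag.sel flag_Sum_def by metis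
  define c where "c t x = (\<lambda>i. g x (t, i))" for t x
  have lc: "lin (c t)" for t
    unfolding c_def
    by (rule linI; unfold coord2.linear_add[OF g(1)] coord2.linear_scale[OF g(1)]; rule ext)
      (simp_all add: cscale_def)
  have cpart: "c t (v i) \<in> part (G t) i" if "t \<in> S" "i \<in> {1..m}" for t i
  proof -
    have "v i \<in> X i" using representsD(3)[OF rep that(2)] by (simp add: coord.span_base)
    then have "g (v i) \<in> dSum S (\<lambda>s. part (G s) i)" using g(4)[OF that(2)] by blast
    from dSumD(1)[OF this that(1)] show ?thesis unfolding c_def .
  qed
  have c0: "c t (v i) = 0" if "t \<in> S" "i \<in> {1..m}" "i \<notin> b t" for t i
    using cpart[OF that(1,2)] part_0_dim[OF dim[OF that(1)] that(2,3)] by simp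
  have c0_span: "c t x = 0" if "t \<in> S" "T \<subseteq> {1..m}" "T \<inter> b t = {}" "x \<in> coord.span (v ` T)" for t T x
  proof (rule coord2.linear_eq_0_on_span[OF lc _ that(4)])
    fix y assume "y \<in> v ` T"
    then obtain i where i: "i \<in> T" "y = v i" by blast
    then have "i \<in> {1..m}" "i \<notin> b t" using that(2,3) by blast+
    then show "c t y = 0" unfolding i(2) by (rule c0[OF that(1)])
  qed
  \<comment> \<open>The isomorphism is injective, and an element of the sum with all components zero
    is zero.\<close>
  have zero: "x = 0" if "x \<in> Kn n" "\<And>t. t \<in> S \<Longrightarrow> c t x = 0" for x
  proof -
    have gx: "g x \<in> dSum S (\<lambda>s. whole (G s))" using g(3) that(1) by blast
    have "g x (t, i) = 0" for t i
    proof (cases "t \<in> S")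
      case True
      then show ?thesis using fun_cong[OF that(2)[OF True], of i] by (simp add: c_def)
    next
      case False
      then show ?thesis by (rule dSumD(2)[OF gx])
    qed
    then have "g x = g 0" unfolding coord2.linear_0[OF g(1)] by (intro ext) (metis surj_pair zero_fun_apply)
    then show "x = 0" by (rule inj_onD[OF g(2)]) (use that(1) coord.subspace_0[OF subspace_Kn] in auto)
  qed
  have spanKn: "coord.span (v ` T) \<subseteq> Kn n" if "T \<subseteq> {1..m}" for T
    by (rule span_image_Kn) (use representsD(1)[OF rep] that in auto)
  have other: "c t x = 0" if "t \<in> S" "t \<noteq> s" "x \<in> coord.span (v ` b s)" for t x
    by (rule c0_span[OF that(1) sub[OF s(1)] _ that(3)])
      (use dis that(1,2) s(1) in \<open>simp add: disjoint_family_on_def\<close>)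
  have inj0: "x = 0" if "x \<in> coord.span (v ` b s)" "c s x = 0" for x
  proof (rule zero)
    show "x \<in> Kn n" using spanKn[OF sub[OF s(1)]] that(1) by blast
    show "c t x = 0" if "t \<in> S" for t using other[OF that] \<open>c s x = 0\<close> \<open>x \<in> coord.span _\<close> by metis
  qed
  have inj: "inj_on (c s) (coord.span (v ` b s))"
    using coord2.linear_inj_on_iff_eq_0[OF lc coord.subspace_span] inj0 by blast
  show "coord.span (v ` b s) \<inter> coord.span (v ` ({1..m} - b s)) = {0}"
  proof
    show "coord.span (v ` b s) \<inter> coord.span (v ` ({1..m} - b s)) \<subseteq> {0}"
    proof
      fix x assume x: "x \<in> coord.span (v ` b s) \<inter> coord.span (v ` ({1..m} - b s))"
      then have "c s x = 0" by (intro c0_span[OF s(1), of "{1..m} - b s"]) auto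
      then show "x \<in> {0}" using inj0 x by simp
    qed
  qed (simp add: coord.span_zero)
  \<comment> \<open>The block transported into its summand: its lines are the nonzero parts of
    \<open>G s\<close>.\<close>
  define w where "w = c s \<circ> v"
  have lines: "part (G s) i = coord.span {w i}" if i: "i \<in> b s" for i
  proof (rule part_line_dim[OF dim[OF s(1)] _ i])
    show im: "i \<in> {1..m}" using sub[OF s(1)] i by blast
    show "w i \<in> part (G s) i" using cpart[OF s(1) im] by (simp add: w_def)
    show "w i \<noteq> 0"
      using inj0[of "v i"] representsD(2)[OF rep im] i by (auto simp: w_def intro: coord.span_base)
  qed
  have flagG: "is_flag m (G s)" using ind[OF s(1)] by (simp add: indecomposable_def)
  have wT: "w ` T = c s ` (v ` T)" for T by (simp add: w_def image_comp)
  have spanw: "coord.span (w ` T) = c s ` coord.span (v ` T)" for T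
    unfolding wT by (rule lin_span[OF lc, symmetric])
  have sub_w: "coord.span (w ` b s) \<subseteq> whole (G s)"
  proof (rule coord.span_minimal)
    show "w ` b s \<subseteq> whole (G s)"
    proof (rule image_subsetI)
      fix i assume i: "i \<in> b s"
      then have "i \<in> {1..m}" using sub[OF s(1)] by blast
      then have "part (G s) i \<subseteq> whole (G s)" using flagG by (simp add: is_flag_def)
      then show "w i \<in> whole (G s)" unfolding lines[OF i] using coord.span_base[of "w i" "{w i}"] by blast
    qed
    show "coord.subspace (whole (G s))" using flagG by (simp add: is_flag_def fd_subspace_def)
  qed
  have parts: "part (G s) i \<subseteq> A" if "i \<in> {1..m}" "coord.subspace A" "i \<in> b s \<Longrightarrow> w i \<in> A" for i A
  proof (cases "i \<in> b s")
    case True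
    show ?thesis
      unfolding lines[OF True] by (rule coord.span_minimal) (use that(2,3) True in simp_all)
  next
    case False
    show ?thesis
      using part_0_dim[OF dim[OF s(1)] that(1) False] coord.subspace_0[OF that(2)] by simp
  qed
  have nz: "coord.span (w ` T) \<noteq> {0}" if T: "T \<subseteq> b s" "T \<noteq> {}" for T
  proof -
    obtain i where i: "i \<in> T" using T(2) by blast
    have bi: "i \<in> b s" using i T(1) by blast
    have im: "i \<in> {1..m}" using sub[OF s(1)] bi by blast
    have "w i \<noteq> 0"
      using inj0[of "v i"] representsD(2)[OF rep im] bi by (auto simp: w_def intro: coord.span_base)
    moreover have "w i \<in> coord.span (w ` T)" using i by (simp add: coord.span_base)
    ultimately show ?thesis by blast
  qed
  have whole: "whole (G s) = coord.span (w ` b s)"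
  proof -
    have fd: "fd_subspace (whole (G s))" using flagG by (simp add: is_flag_def)
    \<comment> \<open>All parts of \<open>G s\<close> lie in the span of the block, so a nonzero
      complement would split off a summand with zero parts. The span of the block is itself nonzero
      because the block is nonempty.\<close>
    obtain C where C: "C \<subseteq> whole (G s)" "coord.span (w ` b s) \<inter> coord.span C = {0}"
      "\<And>x. x \<in> whole (G s) \<Longrightarrow> \<exists>a\<in>coord.span (w ` b s). \<exists>c\<in>coord.span C. x = a + c"
      using fd_complement[OF fd coord.subspace_span sub_w] by metis
    have sC: "coord.span C \<subseteq> whole (G s)"
      using C(1) fd by (simp add: coord.span_minimal fd_subspace_def)
    have sw: "coord.subspace (whole (G s))" using fd by (simp add: fd_subspace_def)
    have "whole (G s) = {x + y |x y. x \<in> coord.span (w ` b s) \<and> y \<in> coord.span C}"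
    proof
      show "whole (G s) \<subseteq> {x + y |x y. x \<in> coord.span (w ` b s) \<and> y \<in> coord.span C}"
        using C(3) by blast
      show "{x + y |x y. x \<in> coord.span (w ` b s) \<and> y \<in> coord.span C} \<subseteq> whole (G s)"
        using sub_w sC coord.subspace_add[OF sw] by auto
    qed
    then have "coord.span (w ` b s) = {0} \<or> coord.span C = {0}"
    proof (rule indecomposable_splitD[OF ind[OF s(1)] coord.subspace_span coord.subspace_span C(2)])
      show "part (G s) i \<subseteq> coord.span (w ` b s) \<or> part (G s) i \<subseteq> coord.span C" if "i \<in> {1..m}" for i
        using parts[OF that coord.subspace_span, of "w ` b s"] by (simp add: coord.span_base)
    qed
    then have "coord.span C = {0}" using nz[OF subset_refl s(2)] by simp
    then have "whole (G s) \<subseteq> coord.span (w ` b s)" using C(3) by fastforce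
    then show ?thesis using sub_w by blast
  qed
  have "r s = coord.dim (coord.span (w ` b s))"
    using dim[OF s(1)] whole by (simp add: has_dim_def dvec_def)
  also have "\<dots> = coord.dim (v ` b s)"
    unfolding coord.dim_span wT by (rule dim_lin_image[OF lc inj])
  finally show "r s = coord.dim (v ` b s)" .
  show "conn v (b s)"
    unfolding conn_def
  proof (intro conjI allI impI notI)
    show "b s = {} \<Longrightarrow> False" using s(2) by simp
    fix T assume T: "T \<subseteq> b s" "T \<noteq> {}" "T \<noteq> b s"
      and 0: "coord.span (v ` T) \<inter> coord.span (v ` (b s - T)) = {0}"
    have mono: "coord.span (v ` T) \<subseteq> coord.span (v ` b s)"
      "coord.span (v ` (b s - T)) \<subseteq> coord.span (v ` b s)"
      using T(1) by (auto intro!: coord.span_mono)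
    have "coord.span (w ` T) \<inter> coord.span (w ` (b s - T)) =
      c s ` (coord.span (v ` T) \<inter> coord.span (v ` (b s - T)))"
      unfolding spanw by (rule inj_on_image_Int[OF inj mono, symmetric])
    also have "\<dots> = {0}" unfolding 0 by (simp add: coord2.linear_0[OF lc])
    finally have d: "coord.span (w ` T) \<inter> coord.span (w ` (b s - T)) = {0}" .
    have u: "w ` b s = w ` T \<union> w ` (b s - T)" using T(1) by blast
    have "coord.span (w ` T) = {0} \<or> coord.span (w ` (b s - T)) = {0}"
    proof (rule indecomposable_splitD[OF ind[OF s(1)] coord.subspace_span coord.subspace_span d])
      show "whole (G s) = {a + c |a c. a \<in> coord.span (w ` T) \<and> c \<in> coord.span (w ` (b s - T))}"
        unfolding whole u by (rule coord.span_Un)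
      show "part (G s) i \<subseteq> coord.span (w ` T) \<or> part (G s) i \<subseteq> coord.span (w ` (b s - T))"
        if "i \<in> {1..m}" for i
      proof (cases "i \<in> T")
        case True
        then show ?thesis using parts[OF that coord.subspace_span, of "w ` T"] by (simp add: coord.span_base)
      next
        case False
        then show ?thesis
          using parts[OF that coord.subspace_span, of "w ` (b s - T)"] by (simp add: coord.span_base)
      qed
    qed
    moreover have "coord.span (w ` T) \<noteq> {0}" by (rule nz[OF T(1,2)])
    moreover have "coord.span (w ` (b s - T)) \<noteq> {0}" by (rule nz) (use T in auto)
    ultimately show False by simp
  qed
qed

text \<open>Nonempty disjoint blocks are distinct subsets of \<open>{1..m}\<close>.\<close>

lemma finite_summands:
  assumes "p \<in> Params n m"
  shows "finite (summands n p)"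
proof -
  obtain Is Js Ks where p: "p = (Is, Js, Ks)" by (metis prod_cases3)
  let ?T = "Is <+> Js <+> Ks"
  have P: "disjoint_family_on block ?T" "(\<Union>s\<in>?T. block s) = {1..m}"
    "\<forall>I\<in>Is. card I \<ge> 1" "\<forall>J\<in>Js. card J \<ge> 3" "\<forall>(K, r)\<in>Ks. 4 \<le> r + 2 \<and> r + 2 \<le> card K"
    using assms unfolding p Params_def by auto
  have ne: "block s \<noteq> {}" if "s \<in> ?T" for s
    using that P(3-5) by (auto simp: block_def)
  have "inj_on block ?T"
  proof (rule inj_onI, rule ccontr)
    fix s t assume st: "s \<in> ?T" "t \<in> ?T" "block s = block t" "s \<noteq> t"
    then have "block s \<inter> block t = {}" using P(1) unfolding disjoint_family_on_def by metis
    then show False using ne[OF st(1)] unfolding st(3) by simp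
  qed
  moreover have "finite (block ` ?T)"
    by (rule finite_subset[of _ "Pow {1..m}"]) (use P(2) in auto)
  ultimately have "finite ?T" using finite_imageD by blast
  then show ?thesis unfolding summands_def p by simp
qed

text \<open>By \<open>summand_component\<close> the blocks listed in \<open>p\<close> are connected
  and direct against the rest, hence they are the connected components, and the rank assigned to
  each is the dimension of its span. Rank and size decide the family, so \<open>p\<close> can be
  read back from \<open>v\<close>.\<close>

lemma constructible_imp_decomp:
  fixes v :: "nat \<Rightarrow> nat \<Rightarrow> 'k::field"
  assumes p: "p \<in> Params n m" and rep: "represents n m v X"
    and con: "constructible n m p (Flag (Kn n) X)"
  shows "\<exists>P. decomp v {1..m} P \<and> p = param_of v P"
proof -
  obtain Is Js Ks where pp: "p = (Is, Js, Ks)" by (metis prod_cases3)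
  let ?T = "Is <+> Js <+> Ks" and ?S = "summands n p"
  have P: "disjoint_family_on block ?T" "(\<Union>s\<in>?T. block s) = {1..m}"
    "\<forall>I\<in>Is. card I \<ge> 1" "\<forall>J\<in>Js. card J \<ge> 3" "\<forall>(K, r)\<in>Ks. 4 \<le> r + 2 \<and> r + 2 \<le> card K"
    using p unfolding pp Params_def by auto
  have S: "?S = {1..n - rk p} <+> ?T" by (simp add: summands_def pp del: rk.simps)
  obtain G :: "_ \<Rightarrow> (nat, 'k) flag" where
    G: "\<And>s. s \<in> ?S \<Longrightarrow> indecomposable m (G s)"
      "\<And>s. s \<in> ?S \<Longrightarrow> has_dim m (G s) (dvec (sblock s) (srank s))"
      "flag_iso m (Flag (Kn n) X) (flag_Sum ?S G)"
    using con unfolding constructible_iff by blast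
  have dis: "disjoint_family_on sblock ?S"
    unfolding disjoint_family_on_def S
  proof (intro ballI impI)
    fix s t assume st: "s \<in> {1..n - rk p} <+> ?T" "t \<in> {1..n - rk p} <+> ?T" "s \<noteq> t"
    show "sblock s \<inter> sblock t = {}"
    proof (cases "(\<exists>a. s = Inl a) \<or> (\<exists>a. t = Inl a)")
      case True
      then show ?thesis by (auto simp: sblock_def)
    next
      case False
      then obtain a b where "s = Inr a" "t = Inr b" by (metis sum.exhaust)
      moreover from this st have "a \<in> ?T" "b \<in> ?T" "a \<noteq> b" by auto
      then have "block a \<inter> block b = {}" using P(1) unfolding disjoint_family_on_def by metis
      ultimately show ?thesis by (simp add: sblock_def)
    qed
  qed
  have bsub: "block t \<subseteq> {1..m}" if "t \<in> ?T" for t using P(2) that by blast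
  have sub: "sblock s \<subseteq> {1..m}" if "s \<in> ?S" for s
  proof (cases s)
    case (Inr t)
    then have "t \<in> ?T" using that unfolding S by auto
    then show ?thesis using bsub unfolding Inr sblock_def by simp
  qed (simp add: sblock_def)
  have ne: "block s \<noteq> {}" if "s \<in> ?T" for s
    using that P(3-5) by (auto simp: block_def)
  have T: "conn v (block t)" "coord.span (v ` block t) \<inter> coord.span (v ` ({1..m} - block t)) = {0}"
    "srank (Inr t) = coord.dim (v ` block t)" if t: "t \<in> ?T" for t
  proof -
    have i: "Inr t \<in> ?S" unfolding S using t by blast
    have b: "sblock (Inr t) = block t" by (simp add: sblock_def)
    have nb: "sblock (Inr t) \<noteq> {}" using ne[OF t] by (simp add: b)
    note f = summand_component[OF rep G dis sub i nb, unfolded b]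
    show "conn v (block t)" by (rule f(1))
    show "coord.span (v ` block t) \<inter> coord.span (v ` ({1..m} - block t)) = {0}" by (rule f(2))
    show "srank (Inr t) = coord.dim (v ` block t)" by (rule f(3))
  qed
  define Q where "Q = block ` ?T"
  have "partition_on {1..m} Q"
    unfolding partition_on_def
  proof (intro conjI)
    show "\<Union>Q = {1..m}" using P(2) by (simp add: Q_def)
    show "disjoint Q"
      unfolding disjoint_def Q_def
    proof (intro ballI impI)
      fix A B assume A: "A \<in> block ` ?T" and B: "B \<in> block ` ?T" and AB: "A \<noteq> B"
      obtain s where s: "A = block s" "s \<in> ?T" using A by (rule imageE)
      obtain t where t: "B = block t" "t \<in> ?T" using B by (rule imageE)
      have "s \<noteq> t" using s(1) t(1) AB by blast
      then show "A \<inter> B = {}"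
        using P(1) s(2) t(2) unfolding s(1) t(1) disjoint_family_on_def by metis
    qed
    show "{} \<notin> Q" using ne unfolding Q_def by auto
  qed
  moreover have "conn v K \<and> coord.span (v ` K) \<inter> coord.span (v ` ({1..m} - K)) = {0}" if K: "K \<in> Q" for K
  proof -
    obtain t where "K = block t" "t \<in> ?T" using K unfolding Q_def by (rule imageE)
    then show ?thesis using T(1,2) by simp
  qed
  ultimately have "decomp v {1..m} Q" unfolding decomp_def by simp
  moreover have "p = param_of v Q"
  proof -
    have I: "coord.dim (v ` I) = 1" if "I \<in> Is" for I
      using T(3)[OF InlI[OF that]] by (simp add: srank_def block_def)
    have J: "coord.dim (v ` J) = card J - 1 \<and> card J \<ge> 3" if "J \<in> Js" for J
      using T(3)[OF InrI[OF InlI[OF that]]] P(4) that by (simp add: srank_def block_def)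
    have K: "coord.dim (v ` fst k) = snd k \<and> 4 \<le> snd k + 2 \<and> snd k + 2 \<le> card (fst k)" if "k \<in> Ks" for k
      using T(3)[OF InrI[OF InrI[OF that]]] P(5) that by (auto simp: srank_def block_def)
    have QI: "K \<in> Q" if "K \<in> Is \<or> K \<in> Js \<or> (\<exists>r. (K, r) \<in> Ks)" for K
      using that
    proof (elim disjE exE)
      assume "K \<in> Is"
      then show "K \<in> Q" unfolding Q_def by (intro image_eqI[OF _ InlI]) (simp_all add: block_def)
    next
      assume "K \<in> Js"
      then show "K \<in> Q" unfolding Q_def by (intro image_eqI[OF _ InrI[OF InlI]]) (simp_all add: block_def)
    next
      fix r assume "(K, r) \<in> Ks"
      then show "K \<in> Q" unfolding Q_def by (intro image_eqI[OF _ InrI[OF InrI]]) (simp_all add: block_def)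
    qed
    have QE: "K \<in> Is \<or> K \<in> Js \<or> (K, coord.dim (v ` K)) \<in> Ks" if KQ: "K \<in> Q" for K
    proof -
      obtain t where t: "K = block t" "t \<in> ?T" using KQ unfolding Q_def by (rule imageE)
      show ?thesis
      proof (cases t)
        case (Inl I)
        then show ?thesis using t by (auto simp: block_def)
      next
        case (Inr t')
        show ?thesis
        proof (cases t')
          case (Inl J)
          then show ?thesis using t \<open>t = Inr t'\<close> by (auto simp: block_def)
        next
          case (Inr k)
          then have k: "k \<in> Ks" "K = fst k" using t \<open>t = Inr t'\<close> by (auto simp: block_def)
          then show ?thesis using K[OF k(1)] by simp
        qed
      qed
    qed
    \<comment> \<open>In this and the next two claims a block found in the wrong family is excluded
      by its rank and size.\<close>
    have "{K \<in> Q. coord.dim (v ` K) = 1} = Is"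
    proof (intro equalityI subsetI)
      fix L assume L: "L \<in> {K \<in> Q. coord.dim (v ` K) = 1}"
      then have "L \<in> Is \<or> L \<in> Js \<or> (L, 1) \<in> Ks" using QE[of L] by simp
      then show "L \<in> Is" using J[of L] K[of "(L, 1)"] L by auto
    qed (use QI I in simp)
    moreover have "{K \<in> Q. card K \<ge> 3 \<and> coord.dim (v ` K) = card K - 1} = Js"
    proof (intro equalityI subsetI)
      fix L assume L: "L \<in> {K \<in> Q. card K \<ge> 3 \<and> coord.dim (v ` K) = card K - 1}"
      then have "L \<in> Is \<or> L \<in> Js \<or> (L, card L - 1) \<in> Ks" using QE[of L] by simp
      then show "L \<in> Js" using I[of L] K[of "(L, card L - 1)"] L by auto
    qed (use QI J in simp)
    moreover have "(\<lambda>K. (K, coord.dim (v ` K))) `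
      {K \<in> Q. 4 \<le> coord.dim (v ` K) + 2 \<and> coord.dim (v ` K) + 2 \<le> card K} = Ks"
    proof (rule equalityI, rule image_subsetI, rule_tac [2] subsetI)
      fix L assume L: "L \<in> {K \<in> Q. 4 \<le> coord.dim (v ` K) + 2 \<and> coord.dim (v ` K) + 2 \<le> card K}"
      then have "L \<in> Is \<or> L \<in> Js \<or> (L, coord.dim (v ` L)) \<in> Ks" using QE[of L] by simp
      then show "(L, coord.dim (v ` L)) \<in> Ks" using I[of L] J[of L] L by auto
    next
      fix k assume k: "k \<in> Ks"
      obtain L r where Lr: "k = (L, r)" by (cases k)
      have "L \<in> Q" using QI[of L] k Lr by blast
      moreover have "r = coord.dim (v ` L)" "4 \<le> r + 2" "r + 2 \<le> card L" using K[OF k] Lr by auto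
      ultimately show "k \<in> (\<lambda>K. (K, coord.dim (v ` K))) `
        {K \<in> Q. 4 \<le> coord.dim (v ` K) + 2 \<and> coord.dim (v ` K) + 2 \<le> card K}"
        unfolding Lr by (intro image_eqI[of _ _ L]) simp_all
    qed
    ultimately show ?thesis unfolding pp param_of_def by simp
  qed
  ultimately show ?thesis by blast
qed

section \<open>Constructing a flag from its components\<close>

text \<open>Summing the components is the isomorphism. At each index a single summand
  \<open>s\<close> carries the part, so the sum of components reduces there to the component at
  \<open>s\<close> and hits exactly \<open>X i\<close>.\<close>

lemma internal_direct_sum_iso:
  fixes G :: "'s \<Rightarrow> ('i, 'k::field) flag" and V :: "('i \<Rightarrow> 'k) set"
  assumes fin: "finite S" and sub: "\<And>s. s \<in> S \<Longrightarrow> coord.subspace (whole (G s))"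
    and indep: "\<And>y. (\<And>s. s \<in> S \<Longrightarrow> y s \<in> whole (G s)) \<Longrightarrow> (\<Sum>s\<in>S. y s) = 0 \<Longrightarrow> (\<And>s. s \<in> S \<Longrightarrow> y s = 0)"
    and V: "coord.subspace V" "\<And>s. s \<in> S \<Longrightarrow> whole (G s) \<subseteq> V" "V \<subseteq> coord.span (\<Union>s\<in>S. whole (G s))"
    and parts: "\<And>i. i \<in> {1..m} \<Longrightarrow> \<exists>s\<in>S. part (G s) i = X i \<and> 0 \<in> X i \<and> (\<forall>t\<in>S - {s}. part (G t) i = {0})"
  shows "flag_iso m (flag_Sum S G) (Flag V X)"
proof -
  define g :: "('s \<times> 'i \<Rightarrow> 'k) \<Rightarrow> 'i \<Rightarrow> 'k" where "g z = (\<lambda>i. \<Sum>s\<in>S. z (s, i))" for z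
  have g: "lin g"
    unfolding g_def by (rule linI) (simp_all add: fun_eq_iff cscale_def sum.distrib sum_distrib_left)
  have g_sum: "g z = (\<Sum>s\<in>S. (\<lambda>i. z (s, i)))" for z
    unfolding g_def by (rule ext) (simp add: sum_fun_apply)
  have sD: "coord.subspace (dSum S (\<lambda>s. whole (G s)))" by (rule subspace_dSum) (rule sub)
  \<comment> \<open>A vector of one summand is the image of the family supported at that
    summand.\<close>
  have single: "w \<in> g ` dSum S U" if s: "s \<in> S" and w: "w \<in> U s" and U: "\<And>t. t \<in> S \<Longrightarrow> 0 \<in> U t"
    for s w and U :: "'s \<Rightarrow> ('i \<Rightarrow> 'k) set"
  proof (rule image_eqI)
    let ?z = "\<lambda>u. if fst u = s then w (snd u) else 0"
    show "?z \<in> dSum S U"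
    proof (rule dSumI)
      fix t assume t: "t \<in> S"
      show "(\<lambda>i. ?z (t, i)) \<in> U t"
      proof (cases "t = s")
        case True
        then show ?thesis using w by simp
      next
        case False
        have "(\<lambda>i. ?z (t, i)) = 0" using False by (simp add: fun_eq_iff)
        then show ?thesis using U[OF t] by (simp only:)
      qed
    qed (use s in auto)
    show "w = g ?z" unfolding g_def using fin s by (simp add: fun_eq_iff)
  qed
  show ?thesis
  proof (rule flag_isoI[OF g])
    have "x = 0" if x: "x \<in> dSum S (\<lambda>s. whole (G s))" and gx: "g x = 0" for x
    proof (rule ext)
      fix u :: "'s \<times> 'i"
      obtain s i where u: "u = (s, i)" by (cases u)
      show "x u = 0 u"
      proof (cases "s \<in> S")
        case True
        have "(\<lambda>i. x (s, i)) = 0"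
          by (rule indep[of "\<lambda>s i. x (s, i)"]) (use dSumD(1)[OF x] gx True in \<open>simp_all add: g_sum\<close>)
        then have "x (s, i) = 0" by (metis zero_fun_apply)
        then show ?thesis by (simp add: u)
      next
        case False
        then show ?thesis using dSumD(2)[OF x] by (simp add: u)
      qed
    qed
    then show "inj_on g (whole (flag_Sum S G))"
      unfolding flag_Sum_def flag.sel coord2.linear_inj_on_iff_eq_0[OF g sD] by blast
    have "g ` dSum S (\<lambda>s. whole (G s)) = V"
    proof
      show "g ` dSum S (\<lambda>s. whole (G s)) \<subseteq> V"
      proof (rule image_subsetI)
        fix z assume z: "z \<in> dSum S (\<lambda>s. whole (G s))"
        show "g z \<in> V"
          unfolding g_sum by (rule coord.subspace_sum[OF V(1)]) (use dSumD(1)[OF z] V(2) in blast)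
      qed
      have "coord.subspace (g ` dSum S (\<lambda>s. whole (G s)))" by (rule coord2.linear_subspace_image[OF g sD])
      moreover have "(\<Union>s\<in>S. whole (G s)) \<subseteq> g ` dSum S (\<lambda>s. whole (G s))"
      proof (rule UN_least, rule subsetI)
        fix s w assume "s \<in> S" "w \<in> whole (G s)"
        then show "w \<in> g ` dSum S (\<lambda>s. whole (G s))"
          by (rule single[of s w "\<lambda>s. whole (G s)"]) (rule coord.subspace_0[OF sub])
      qed
      ultimately show "V \<subseteq> g ` dSum S (\<lambda>s. whole (G s))" using V(3) coord.span_minimal by blast
    qed
    then show "g ` whole (flag_Sum S G) = whole (Flag V X)" by (simp add: flag_Sum_def)
    fix i assume "i \<in> {1..m}"
    then obtain s where s: "s \<in> S" "part (G s) i = X i" "0 \<in> X i" and "\<forall>t\<in>S - {s}. part (G t) i = {0}"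
      using parts by (metis (no_types))
    then have s4: "part (G t) i = {0}" if "t \<in> S" "t \<noteq> s" for t using that by simp
    have "g ` dSum S (\<lambda>s. part (G s) i) = X i"
    proof
      show "g ` dSum S (\<lambda>s. part (G s) i) \<subseteq> X i"
      proof (rule image_subsetI)
        fix z assume z: "z \<in> dSum S (\<lambda>s. part (G s) i)"
        have "g z = (\<lambda>i. z (s, i)) + (\<Sum>t\<in>S - {s}. (\<lambda>i. z (t, i)))"
          unfolding g_sum by (rule sum.remove[OF fin s(1)])
        also have "(\<Sum>t\<in>S - {s}. (\<lambda>i. z (t, i))) = 0"
          by (rule sum.neutral) (use dSumD(1)[OF z] s4 in auto)
        finally have "g z = (\<lambda>i. z (s, i))" by (simp only: add_0_right)
        then show "g z \<in> X i" using dSumD(1)[OF z s(1)] s(2) by simp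
      qed
      show "X i \<subseteq> g ` dSum S (\<lambda>s. part (G s) i)"
      proof
        fix w assume "w \<in> X i"
        then have "w \<in> part (G s) i" using s(2) by simp
        then show "w \<in> g ` dSum S (\<lambda>s. part (G s) i)"
        proof (rule single[of s w "\<lambda>s. part (G s) i", OF s(1)])
          show "0 \<in> part (G t) i" if "t \<in> S" for t using s(2,3) s4[OF that] by (cases "t = s") auto
        qed
      qed
    qed
    then show "g ` part (flag_Sum S G) i = part (Flag V X) i" by (simp add: flag_Sum_def)
  qed
qed

text \<open>Each block contributes the span of its own vectors. What is missing from
  \<open>Kn n\<close> is supplied by lines through a basis of a complement of the joint span; these
  are the summands with empty block.\<close>

lemma decomp_imp_constructible:
  fixes v :: "nat \<Rightarrow> nat \<Rightarrow> 'k::field"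
  assumes rep: "represents n m v X" and P: "decomp v {1..m} P"
  shows "constructible n m (param_of v P) (Flag (Kn n) X)"
proof -
  define p where "p = param_of v P"
  define k where "k = n - rk p"
  define T where "T = fst p <+> fst (snd p) <+> snd (snd p)"
  let ?V = "coord.span (v ` {1..m})"
  have nz: "v i \<noteq> 0" and vK: "v i \<in> Kn n" if "i \<in> {1..m}" for i using representsD[OF rep that] by auto
  have pP: "p \<in> Params n m" unfolding p_def by (rule param_of_in_Params[OF P nz vK])
  have rk: "rk p = coord.dim (v ` {1..m})" unfolding p_def by (rule rk_param_of[OF P nz])
  have S: "summands n p = {1..k} <+> T" unfolding summands_def k_def T_def ..
  have finT: "finite T" using finite_summands[OF pP] unfolding S by simp
  have VK: "?V \<subseteq> Kn n" by (rule span_image_Kn) (rule vK)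
  obtain C where C: "finite C" "coord.independent C" "C \<subseteq> Kn n" "?V \<inter> coord.span C = {0}"
    "\<And>x. x \<in> Kn n \<Longrightarrow> \<exists>a\<in>?V. \<exists>c\<in>coord.span C. x = a + c" "coord.dim ?V + card C = coord.dim (Kn n :: (nat \<Rightarrow> 'k) set)"
    using fd_complement[OF fd_subspace_Kn coord.subspace_span VK] by metis
  \<comment> \<open>The rank of the parameter is the dimension of the joint span, so the complement
    has exactly the prescribed dimension \<open>n - rk p\<close>.\<close>
  have "card C = k" using C(6) rk unfolding k_def by simp
  then obtain u where u: "bij_betw u {1..k} C" using ex_bij_betw_nat_finite_1[OF C(1)] by blast
  have iu: "indep_fam u {1..k}" using u C(2) unfolding indep_fam_def bij_betw_def by simp
  have uC: "u i \<in> C" if "i \<in> {1..k}" for i using u that unfolding bij_betw_def by blast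
  have u0: "u i \<noteq> 0" if "i \<in> {1..k}" for i using uC[OF that] C(2) coord.dependent_zero by metis
  define W where "W = case_sum (\<lambda>i. coord.span {u i}) (\<lambda>t. coord.span (v ` block t))"
  define G where "G s = Flag (W s) (\<lambda>i. if i \<in> sblock s then coord.span {v i} else {0})" for s
  have whole: "whole (G s) = W s" for s by (simp add: G_def)
  have blockP: "block t \<in> P" and srank: "srank (Inr t) = coord.dim (v ` block t)" if "t \<in> T" for t
    using that unfolding T_def p_def param_of_def block_def srank_def by auto
  have bsub: "block t \<subseteq> {1..m}" if "t \<in> T" for t by (rule decompD(2)[OF P blockP[OF that]])
  have PP: "disjoint_family_on block T" "(\<Union>s\<in>T. block s) = {1..m}"
  proof -
    obtain Is Js Ks where pp: "p = (Is, Js, Ks)" by (metis prod_cases3)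
    show "disjoint_family_on block T" "(\<Union>s\<in>T. block s) = {1..m}"
      using pP unfolding T_def Params_def pp by simp_all
  qed
  have flagG: "is_flag m (G s)" if "s \<in> summands n p" for s
    unfolding is_flag_def
  proof (intro conjI ballI)
    show "fd_subspace (whole (G s))"
    proof (cases s)
      case (Inl i)
      then show ?thesis unfolding whole W_def by (simp add: fd_subspace_span)
    next
      case (Inr t)
      then have "t \<in> T" using that unfolding S by auto
      then have "finite (block t)" using bsub finite_subset by blast
      then show ?thesis unfolding whole W_def Inr by (simp add: fd_subspace_span)
    qed
    fix i assume "i \<in> {1..m}"
    show "coord.subspace (part (G s) i)" by (simp add: G_def)
    show "part (G s) i \<subseteq> whole (G s)"
    proof (cases "i \<in> sblock s")
      case True
      then obtain t where t: "s = Inr t" "i \<in> block t" by (cases s) (auto simp: sblock_def)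
      then have "coord.span {v i} \<subseteq> coord.span (v ` block t)" by (intro coord.span_mono) auto
      then show ?thesis using True t by (simp add: G_def W_def)
    next
      case False
      have "0 \<in> W s" unfolding W_def by (cases s) (auto simp: coord.span_zero)
      then show ?thesis using False by (simp add: G_def)
    qed
  qed
  have "indecomposable m (G s) \<and> has_dim m (G s) (dvec (sblock s) (srank s))" if s: "s \<in> summands n p" for s
  proof
    show "indecomposable m (G s)"
    proof (cases s)
      case (Inl i)
      show ?thesis by (rule indecomposable_line[OF flagG[OF s], of "u i"]) (simp add: whole W_def Inl)
    next
      case (Inr t)
      then have t: "t \<in> T" using s unfolding S by auto
      show ?thesis
        by (rule indecomposable_conn[OF decompD(4)[OF P blockP[OF t]] bsub[OF t] flagG[OF s]])
          (simp_all add: G_def W_def Inr sblock_def)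
    qed
    have "coord.dim (W s) = srank s"
    proof (cases s)
      case (Inl i)
      then have "i \<in> {1..k}" using s unfolding S by auto
      then show ?thesis using u0 by (simp add: W_def Inl srank_def dim_singleton)
    next
      case (Inr t)
      then have t: "t \<in> T" using s unfolding S by auto
      then show ?thesis using srank[OF t] by (simp add: W_def Inr)
    qed
    moreover have "coord.dim (part (G s) i) = (if i \<in> sblock s then 1 else 0)" if "i \<in> {1..m}" for i
      using nz[OF that] by (simp add: G_def dim_singleton)
    ultimately show "has_dim m (G s) (dvec (sblock s) (srank s))"
      unfolding has_dim_def dvec_def using flagG[OF s] by (simp add: whole)
  qed
  moreover have "flag_iso m (flag_Sum (summands n p) G) (Flag (Kn n) X)"
  proof (rule internal_direct_sum_iso)
    show "finite (summands n p)" by (rule finite_summands[OF pP])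
    show "coord.subspace (whole (G s))" if "s \<in> summands n p" for s
      using flagG[OF that] by (simp add: is_flag_def fd_subspace_def)
    show "coord.subspace (Kn n)" by simp
    show "whole (G s) \<subseteq> Kn n" if "s \<in> summands n p" for s
    proof (cases s)
      case (Inl i)
      then have "i \<in> {1..k}" using that unfolding S by auto
      then have "u i \<in> Kn n" using uC C(3) by blast
      then show ?thesis unfolding whole W_def Inl by (simp add: coord.span_minimal)
    next
      case (Inr t)
      then have t: "t \<in> T" using that unfolding S by auto
      then have "coord.span (v ` block t) \<subseteq> Kn n" using bsub vK by (intro span_image_Kn) blast
      then show ?thesis unfolding whole W_def Inr by simp
    qed
    let ?U = "\<Union>s\<in>summands n p. whole (G s)"
    show "Kn n \<subseteq> coord.span ?U"
    proof
      fix x :: "nat \<Rightarrow> 'k" assume "x \<in> Kn n"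
      then obtain a c where ac: "a \<in> ?V" "c \<in> coord.span C" "x = a + c" using C(5) by blast
      have "v ` {1..m} \<subseteq> ?U"
      proof (rule image_subsetI)
        fix i assume "i \<in> {1..m}"
        then obtain t where t: "t \<in> T" "i \<in> block t" using PP(2) by blast
        have "v i \<in> whole (G (Inr t))" unfolding whole W_def using t(2) by (simp add: coord.span_base)
        moreover have "Inr t \<in> summands n p" unfolding S using t(1) by (rule InrI)
        ultimately show "v i \<in> ?U" by blast
      qed
      then have "a \<in> coord.span ?U" using ac(1) coord.span_mono by blast
      moreover have "C \<subseteq> ?U"
      proof
        fix y assume "y \<in> C"
        then obtain i where i: "i \<in> {1..k}" "y = u i" using u unfolding bij_betw_def by blast
        have "y \<in> whole (G (Inl i))" unfolding whole W_def i(2) by (simp add: coord.span_base)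
        moreover have "Inl i \<in> summands n p" unfolding S using i(1) by (rule InlI)
        ultimately show "y \<in> ?U" by blast
      qed
      then have "c \<in> coord.span ?U" using ac(2) coord.span_mono by blast
      ultimately show "x \<in> coord.span ?U" unfolding ac(3) by (rule coord.span_add)
    qed
    show "\<exists>s\<in>summands n p. part (G s) i = X i \<and> 0 \<in> X i \<and> (\<forall>t\<in>summands n p - {s}. part (G t) i = {0})"
      if i: "i \<in> {1..m}" for i
    proof -
      obtain t where t: "t \<in> T" "i \<in> block t" using PP(2) i by blast
      have "Inr t \<in> summands n p" unfolding S using t(1) by (rule InrI)
      moreover have "part (G (Inr t)) i = X i" using t(2) representsD(3)[OF rep i] by (simp add: G_def sblock_def)
      moreover have "0 \<in> X i" using representsD(3)[OF rep i] by (simp add: coord.span_zero)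
      moreover have "part (G s) i = {0}" if s: "s \<in> summands n p" "s \<noteq> Inr t" for s
      proof -
        have "i \<notin> sblock s"
        proof (cases s)
          case (Inr t')
          then have "t' \<in> T" "t' \<noteq> t" using s unfolding S by auto
          then have "block t' \<inter> block t = {}" using PP(1) t(1) unfolding disjoint_family_on_def by metis
          then show ?thesis using t(2) unfolding Inr sblock_def by auto
        qed (simp add: sblock_def)
        then show ?thesis by (simp add: G_def)
      qed
      ultimately show ?thesis by blast
    qed
    fix y s assume y: "\<And>s. s \<in> summands n p \<Longrightarrow> y s \<in> whole (G s)"
      and 0: "(\<Sum>s\<in>summands n p. y s) = 0" and s: "s \<in> summands n p"
    have yl: "y (Inl i) \<in> coord.span {u i}" if "i \<in> {1..k}" for i
      using y[of "Inl i"] InlI[OF that, of T] unfolding S whole W_def by simp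
    have yr: "y (Inr t) \<in> coord.span (v ` block t)" if "t \<in> T" for t
      using y[of "Inr t"] InrI[OF that, of "{1..k}"] unfolding S whole W_def by simp
    define a where "a = (\<Sum>t\<in>T. y (Inr t))"
    define c where "c = (\<Sum>i\<in>{1..k}. y (Inl i))"
    \<comment> \<open>A vanishing sum is separated into its share in the complement and its share in
      the span of the vectors; both vanish because these spaces meet in 0.\<close>
    have ca: "c + a = 0" using 0 finT unfolding S a_def c_def by (simp add: sum.Plus)
    have a: "a \<in> ?V"
      unfolding a_def
    proof (rule coord.span_sum)
      fix t assume t: "t \<in> T"
      have "coord.span (v ` block t) \<subseteq> ?V" by (intro coord.span_mono image_mono bsub[OF t])
      then show "y (Inr t) \<in> ?V" using yr[OF t] by blast
    qed
    have c: "c \<in> coord.span C"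
      unfolding c_def
    proof (rule coord.span_sum)
      fix i assume i: "i \<in> {1..k}"
      have "coord.span {u i} \<subseteq> coord.span C" by (intro coord.span_mono) (use uC[OF i] in simp)
      then show "y (Inl i) \<in> coord.span C" using yl[OF i] by blast
    qed
    have "c = - a" using ca by (rule eq_neg_iff_add_eq_0[THEN iffD2])
    then have "c \<in> ?V" using coord.span_neg[OF a] by (simp only:)
    then have c0: "c = 0" using c C(4) by blast
    then have a0: "a = 0" using ca by simp
    show "y s = 0"
    proof (cases s)
      case (Inl i)
      then have i: "i \<in> {1..k}" using s unfolding S by auto
      have "\<exists>e. y (Inl i) = cscale e (u i)" if "i \<in> {1..k}" for i
        using yl[OF that] unfolding coord.span_singleton by blast
      then obtain e where e: "\<And>i. i \<in> {1..k} \<Longrightarrow> y (Inl i) = cscale (e i) (u i)" by metis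
      have "(\<Sum>i\<in>{1..k}. cscale (e i) (u i)) = c" unfolding c_def by (rule sum.cong) (simp_all add: e)
      then have "e i = 0" using indep_famD[OF iu, of e i] c0 i by simp
      then show ?thesis using e[OF i] by (simp add: Inl)
    next
      case (Inr t)
      then have t: "t \<in> T" using s unfolding S by auto
      let ?r = "\<Sum>t'\<in>T - {t}. y (Inr t')"
      have "a = y (Inr t) + ?r" unfolding a_def by (rule sum.remove[OF finT t])
      then have "y (Inr t) + ?r = 0" using a0 by (simp only:)
      \<comment> \<open>The term at \<open>t\<close> lies in the span of its block and, by this
        equation, in the span of all other vectors, so it is zero.\<close>
      then have yr': "y (Inr t) = - ?r" by (rule eq_neg_iff_add_eq_0[THEN iffD2])
      have "?r \<in> coord.span (v ` ({1..m} - block t))"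
      proof (rule coord.span_sum)
        fix t' assume t': "t' \<in> T - {t}"
        then have tT: "t' \<in> T" by simp
        have "block t' \<inter> block t = {}"
          using PP(1) t t' unfolding disjoint_family_on_def by (metis DiffE singletonI)
        then have "block t' \<subseteq> {1..m} - block t" using bsub[OF tT] by blast
        then have "coord.span (v ` block t') \<subseteq> coord.span (v ` ({1..m} - block t))"
          by (intro coord.span_mono image_mono)
        then show "y (Inr t') \<in> coord.span (v ` ({1..m} - block t))" using yr[OF tT] by blast
      qed
      then have "y (Inr t) \<in> coord.span (v ` ({1..m} - block t))"
        unfolding yr' by (rule coord.span_neg)
      then show ?thesis using yr[OF t] decompD(5)[OF P blockP[OF t]] unfolding Inr by blast
    qed
  qed
  then have "flag_iso m (Flag (Kn n) X) (flag_Sum (summands n p) G)"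
  proof (rule flag_iso_sym)
    show "coord.subspace (whole (flag_Sum (summands n p) G))" by (rule subspace_whole_Sum) (rule flagG)
    show "part (flag_Sum (summands n p) G) i \<subseteq> whole (flag_Sum (summands n p) G)" if "i \<in> {1..m}" for i
      by (rule part_Sum_subset[OF _ that]) (rule flagG)
  qed
  ultimately show ?thesis
    unfolding constructible_iff p_def[symmetric] using is_flag_represents[OF rep] by blast
qed

section \<open>Orbits and their parameters\<close>

lemma Fl_represents:
  assumes "X \<in> Fl n m"
  obtains v where "represents n m v X"
proof -
  have "\<exists>w. w \<in> Kn n \<and> w \<noteq> 0 \<and> X i = coord.span {w}" if i: "i \<in> {1..m}" for i
  proof -
    have X: "coord.subspace (X i)" "X i \<subseteq> Kn n" "coord.dim (X i) = 1"
      using assms i unfolding Fl_def Gr_def by (auto simp: PiE_iff)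
    obtain w where w: "w \<noteq> 0" "X i = coord.span {w}" using dim_eq_1_iff[OF X(1)] X(3) by blast
    then have "w \<in> Kn n" using X(2) coord.span_base[of w "{w}"] by blast
    then show ?thesis using w by blast
  qed
  then obtain v where "\<And>i. i \<in> {1..m} \<Longrightarrow> v i \<in> Kn n \<and> v i \<noteq> 0 \<and> X i = coord.span {v i}" by metis
  then show ?thesis using that[of v] unfolding represents_def by blast
qed

lemma represents_Fl:
  assumes "represents n m v X" "X \<in> extensional {1..m}"
  shows "X \<in> Fl n m"
  unfolding Fl_def
proof (rule PiE_I)
  fix i assume "i \<in> {1..m}"
  note r = representsD[OF assms(1) this]
  show "X i \<in> Gr 1 (Kn n)"
    unfolding Gr_def r(3) using r(1,2) by (simp add: coord.span_minimal dim_singleton)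
next
  show "X i = undefined" if "i \<notin> {1..m}" for i using assms(2) that by (rule extensional_arb)
qed

lemma Fl_extensional: "X \<in> Fl n m \<Longrightarrow> X \<in> extensional {1..m}"
  unfolding Fl_def PiE_def by simp

lemma diag_orbit_eq_flag_orbit: "diag_orbit n m X = flag_orbit n m (Flag (Kn n) X)"
  unfolding diag_orbit_def flag_orbit_def GL_def by simp

lemma flag_orbit_mono:
  assumes "flag_iso m F F'"
  shows "flag_orbit n m F' \<subseteq> flag_orbit n m F"
proof
  fix Y assume "Y \<in> flag_orbit n m F'"
  then obtain f where f: "lin_iso (whole F') (Kn n) f" "Y = (\<lambda>i\<in>{1..m}. f ` part F' i)"
    unfolding flag_orbit_def by blast
  obtain h where h: "lin_iso (whole F) (whole F') h" "\<forall>i\<in>{1..m}. h ` part F i = part F' i"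
    using assms unfolding flag_iso_def by blast
  have "(f \<circ> h) ` part F i = f ` part F' i" if "i \<in> {1..m}" for i
    by (simp only: image_comp[symmetric] bspec[OF h(2) that])
  then have "Y = (\<lambda>i\<in>{1..m}. (f \<circ> h) ` part F i)"
    unfolding f(2) by (intro restrict_ext) (simp only:)
  then show "Y \<in> flag_orbit n m F"
    unfolding flag_orbit_def using lin_iso_trans[OF h(1) f(1)] by blast
qed

lemma diag_orbit_self:
  assumes "X \<in> extensional {1..m}"
  shows "X \<in> diag_orbit n m X"
proof -
  have "X = (\<lambda>i\<in>{1..m}. (\<lambda>x. x) ` X i)" using assms by (simp add: extensional_restrict)
  moreover have "(\<lambda>x. x) \<in> GL n" unfolding GL_def lin_iso_def by (simp add: bij_betw_def)
  ultimately show ?thesis unfolding diag_orbit_def by blast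
qed

lemma diag_orbit_iso:
  assumes "X' \<in> diag_orbit n m X"
  shows "flag_iso m (Flag (Kn n) X) (Flag (Kn n) X')"
  using assms unfolding diag_orbit_def GL_def flag_iso_def by auto

lemma diag_orbit_eq:
  assumes "X \<in> Fl n m" "X' \<in> diag_orbit n m X"
  shows "diag_orbit n m X' = diag_orbit n m X"
proof -
  obtain v where v: "represents n m v X" using Fl_represents[OF assms(1)] .
  note iso = diag_orbit_iso[OF assms(2)]
  have F: "is_flag m (Flag (Kn n) X)" by (rule is_flag_represents[OF v])
  have iso': "flag_iso m (Flag (Kn n) X') (Flag (Kn n) X)"
    by (rule flag_iso_sym[OF iso]) (use F in \<open>auto simp: is_flag_def\<close>)
  show ?thesis
    unfolding diag_orbit_eq_flag_orbit using flag_orbit_mono[OF iso] flag_orbit_mono[OF iso'] by blast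
qed

text \<open>The witness is globally linear and therefore commutes with spans, which a member of
  \<open>GL n\<close> does inside \<open>Kn n\<close> only.\<close>

lemma diag_orbitE:
  fixes X :: "'k::field flag_point"
  assumes "Y \<in> diag_orbit n m X" "represents n m v X"
  obtains g where "lin g" "inj_on g (Kn n)" "g ` Kn n = Kn n"
    "\<And>i. i \<in> {1..m} \<Longrightarrow> Y i = coord.span {g (v i)}" "represents n m (g \<circ> v) Y"
proof -
  obtain f where f: "lin_iso (Kn n) (Kn n) f" "Y = (\<lambda>i\<in>{1..m}. f ` X i)"
    using assms(1) unfolding diag_orbit_def GL_def by blast
  obtain g where g: "lin g" "\<And>x. x \<in> Kn n \<Longrightarrow> g x = f x" "inj_on g (Kn n)" "g ` Kn n = Kn n"
    using lin_isoE[OF f(1) subspace_Kn] by blast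
  have Y: "Y i = coord.span {g (v i)}" if i: "i \<in> {1..m}" for i
  proof -
    note r = representsD[OF assms(2) i]
    have "X i \<subseteq> Kn n" unfolding r(3) using r(1) by (simp add: coord.span_minimal)
    then have "f ` X i = g ` X i" using g(2) by (intro image_cong) auto
    then show ?thesis unfolding f(2) using i lin_span[OF g(1), of "{v i}"] by (simp add: r(3))
  qed
  have "represents n m (g \<circ> v) Y"
    unfolding represents_def
  proof (intro ballI conjI)
    fix i assume i: "i \<in> {1..m}"
    note r = representsD[OF assms(2) i]
    show "(g \<circ> v) i \<in> Kn n" using g(4) r(1) by auto
    have "g (v i) \<noteq> g 0" using r(1,2) coord.subspace_0[OF subspace_Kn] inj_onD[OF g(3)] by metis
    then show "(g \<circ> v) i \<noteq> 0" using coord2.linear_0[OF g(1)] by simp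
    show "Y i = coord.span {(g \<circ> v) i}" using Y[OF i] by simp
  qed
  then show ?thesis using that g Y by blast
qed

lemma diag_orbitI:
  assumes "represents n m v X" "represents n m w Y" "Y \<in> extensional {1..m}"
    and "lin g" "lin_iso (Kn n) (Kn n) g" "\<And>i. i \<in> {1..m} \<Longrightarrow> coord.span {g (v i)} = coord.span {w i}"
  shows "Y \<in> diag_orbit n m X"
proof -
  have "Y = (\<lambda>i\<in>{1..m}. g ` X i)"
  proof (rule extensionalityI[OF assms(3)])
    fix i assume i: "i \<in> {1..m}"
    have "g ` X i = coord.span {g (v i)}"
      using representsD(3)[OF assms(1) i] lin_span[OF assms(4), of "{v i}"] by simp
    then show "Y i = (\<lambda>i\<in>{1..m}. g ` X i) i"
      using assms(6)[OF i] representsD(3)[OF assms(2) i] i by simp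
  qed simp
  then show ?thesis unfolding diag_orbit_def GL_def using assms(5) by blast
qed

text \<open>The description admits any point of the orbit as a witness. A parameter found at another
  point is carried back to \<open>X\<close> by isomorphism, and there \<open>decomp_unique\<close>
  leaves only one candidate.\<close>

lemma orbit_param_eq:
  fixes X :: "'k::field flag_point"
  assumes X: "X \<in> Fl n m" and rep: "represents n m v X" and P: "decomp v {1..m} P"
  shows "orbit_param n m (diag_orbit n m X) = param_of v P"
  unfolding orbit_param_def
proof (rule the_equality)
  have "param_of v P \<in> Params n m" by (rule param_of_in_Params[OF P]) (use representsD[OF rep] in auto)
  moreover have "constructible n m (param_of v P) (Flag (Kn n) X)"
    by (rule decomp_imp_constructible[OF rep P])
  ultimately show "param_of v P \<in> Params n m \<and>
    (\<exists>X\<in>diag_orbit n m X. constructible n m (param_of v P) (Flag (Kn n) X))"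
    using diag_orbit_self[OF Fl_extensional[OF X]] by blast
next
  fix p assume "p \<in> Params n m \<and> (\<exists>X\<in>diag_orbit n m X. constructible n m p (Flag (Kn n) X))"
  then obtain X' where p: "p \<in> Params n m" "X' \<in> diag_orbit n m X" "constructible n m p (Flag (Kn n) X')"
    by blast
  have "constructible n m p (Flag (Kn n) X)"
    by (rule constructible_iso[OF p(3) diag_orbit_iso[OF p(2)] is_flag_represents[OF rep]])
  then obtain Q where Q: "decomp v {1..m} Q" "p = param_of v Q"
    using constructible_imp_decomp[OF p(1) rep] by blast
  then show "p = param_of v P" using decomp_unique[OF P Q(1)] by simp
qed

text \<open>Reduces a fibre to vector configurations: it remains to show that a configuration whose
  components have the parameter \<open>p\<close> lies in the orbit of \<open>X0\<close>.\<close>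

lemma orbit_fibre_eq:
  fixes X0 :: "'k::field flag_point"
  assumes X0: "X0 \<in> Fl n m" "orbit_param n m (diag_orbit n m X0) = p"
    and uni: "\<And>X v P. X \<in> Fl n m \<Longrightarrow> represents n m v X \<Longrightarrow> decomp v {1..m} P \<Longrightarrow> param_of v P = p \<Longrightarrow>
      X \<in> diag_orbit n m X0"
  shows "orbit_fibre n m p = {diag_orbit n m X0}"
proof
  show "{diag_orbit n m X0} \<subseteq> orbit_fibre n m p"
    unfolding orbit_fibre_def diag_orbits_def using X0 by simp
  show "orbit_fibre n m p \<subseteq> {diag_orbit n m X0}"
  proof
    fix \<Omega> :: "'k flag_point set" assume "\<Omega> \<in> orbit_fibre n m p"
    then obtain X where X: "X \<in> Fl n m" "\<Omega> = diag_orbit n m X" "orbit_param n m \<Omega> = p"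
      unfolding orbit_fibre_def diag_orbits_def by blast
    obtain v where v: "represents n m v X" using Fl_represents[OF X(1)] .
    obtain P where P: "decomp v {1..m} P" using decomp_exists[of "{1..m}" v] by auto
    have "param_of v P = p" using orbit_param_eq[OF X(1) v P] X(2,3) by simp
    then have "X \<in> diag_orbit n m X0" by (rule uni[OF X(1) v P])
    then show "\<Omega> \<in> {diag_orbit n m X0}" using diag_orbit_eq[OF X0(1)] X(2) by simp
  qed
qed

lemma represents_span:
  assumes "represents n m v X" "T \<subseteq> {1..m}"
  shows "coord.span (v ` T) = coord.span (\<Union>i\<in>T. X i)"
proof (rule antisym)
  have X: "X i = coord.span {v i}" if "i \<in> T" for i
    by (rule representsD(3)[OF assms(1)]) (use that assms(2) in blast)
  show "coord.span (v ` T) \<subseteq> coord.span (\<Union>i\<in>T. X i)"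
  proof (rule coord.span_mono, rule image_subsetI)
    fix i assume i: "i \<in> T"
    have "v i \<in> X i" unfolding X[OF i] by (simp add: coord.span_base)
    then show "v i \<in> (\<Union>i\<in>T. X i)" using i by blast
  qed
  have "X i \<subseteq> coord.span (v ` T)" if "i \<in> T" for i
    unfolding X[OF that] by (rule coord.span_mono) (use that in simp)
  then show "coord.span (\<Union>i\<in>T. X i) \<subseteq> coord.span (v ` T)"
    by (intro coord.span_minimal UN_least) simp_all
qed

text \<open>The span of the chosen vectors is the span of the lines, so the rank does not depend on
  the choice.\<close>

lemma indep_fam_represents:
  assumes "represents n m v X" "represents n m w X" "S \<subseteq> {1..m}" "indep_fam v S"
  shows "indep_fam w S"
proof -
  have fin: "finite S" using assms(3) finite_subset by blast
  have "coord.dim (w ` S) = coord.dim (v ` S)"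
    using represents_span[OF assms(1,3)] represents_span[OF assms(2,3)] by (metis coord.dim_span)
  then show ?thesis using assms(4) unfolding indep_fam_iff_dim[OF fin] by simp
qed

lemma indep_fam_lin:
  assumes "lin g" "inj_on g V" "coord.subspace V" "v ` S \<subseteq> V" "indep_fam v S"
  shows "indep_fam (g \<circ> v) S"
proof -
  have "coord.span (v ` S) \<subseteq> V" using assms(3,4) by (simp add: coord.span_minimal)
  then have "inj_on g (coord.span (v ` S))" using assms(2) inj_on_subset by blast
  then have "coord.independent (g ` v ` S)"
    using coord2.linear_independent_injective_image[OF assms(1)] assms(5) unfolding indep_fam_def by blast
  moreover have "inj_on (g \<circ> v) S"
    using assms(2,4,5) inj_on_subset unfolding indep_fam_def by (blast intro: comp_inj_on)
  ultimately show ?thesis unfolding indep_fam_def by (simp add: image_comp)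
qed

lemma extend_indep_fam:
  fixes v :: "nat \<Rightarrow> nat \<Rightarrow> 'k::field"
  assumes "indep_fam v {1..m}" "\<And>i. i \<in> {1..m} \<Longrightarrow> v i \<in> Kn n"
  obtains w where "indep_fam w {1..n}" "\<And>i. i \<in> {1..m} \<Longrightarrow> w i = v i" "\<And>i. i \<in> {1..n} \<Longrightarrow> w i \<in> Kn n"
proof -
  have le: "m \<le> n" using indep_fam_card_le[OF assms(1) _ assms(2)] by simp
  have ind: "coord.independent (v ` {1..m})" and inj: "inj_on v {1..m}"
    using assms(1) by (simp_all add: indep_fam_def)
  have VK: "coord.span (v ` {1..m}) \<subseteq> Kn n" by (rule span_image_Kn) (rule assms(2))
  obtain C where C: "finite C" "coord.independent C" "C \<subseteq> Kn n" "coord.span (v ` {1..m}) \<inter> coord.span C = {0}"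
    "coord.dim (coord.span (v ` {1..m})) + card C = coord.dim (Kn n :: (nat \<Rightarrow> 'k) set)"
    using fd_complement[OF fd_subspace_Kn coord.subspace_span VK] by metis
  have "coord.dim (v ` {1..m}) = m" using assms(1) by (simp add: indep_fam_iff_dim)
  then have "card {m+1..n} = card C" using C(5) le by simp
  then obtain u where u: "bij_betw u {m+1..n} C" using finite_same_card_bij[OF _ C(1)] by blast
  have "finite (v ` {1..m})" by simp
  note U = independent_Un_direct[OF this C(1) ind C(2,4)]
  define w where "w i = (if i \<le> m then v i else u i)" for i
  have "bij_betw w {1..m} (v ` {1..m}) \<longleftrightarrow> bij_betw v {1..m} (v ` {1..m})"
    by (rule bij_betw_cong) (simp add: w_def)
  then have b1: "bij_betw w {1..m} (v ` {1..m})" using inj_on_imp_bij_betw[OF inj] by (simp only:)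
  have "bij_betw w {m+1..n} C \<longleftrightarrow> bij_betw u {m+1..n} C"
    by (rule bij_betw_cong) (simp add: w_def)
  then have "bij_betw w {m+1..n} C" using u by (simp only:)
  from bij_betw_combine[OF b1 this U(2)]
  have b: "bij_betw w ({1..m} \<union> {m+1..n}) (v ` {1..m} \<union> C)" .
  have e: "{1..m} \<union> {m+1..n} = {1..n}" using le by auto
  have w: "inj_on w {1..n}" "w ` {1..n} = v ` {1..m} \<union> C" using b unfolding e bij_betw_def by auto
  show ?thesis
  proof (rule that)
    show "indep_fam w {1..n}" unfolding indep_fam_def using w U(1) by simp
    show "w i = v i" if "i \<in> {1..m}" for i using that by (simp add: w_def)
    show "w i \<in> Kn n" if "i \<in> {1..n}" for i
    proof -
      have "w i \<in> v ` {1..m} \<union> C" using w(2) that by blast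
      then show ?thesis using assms(2) C(3) by (elim UnE imageE) auto
    qed
  qed
qed

text \<open>One representing family is enough, since by \<open>indep_at_iff\<close> all of them
  agree.\<close>

definition indep_at :: "nat \<Rightarrow> nat \<Rightarrow> nat set \<Rightarrow> 'k::field flag_point set" where
  "indep_at n m S = {X \<in> Fl n m. \<exists>v. represents n m v X \<and> indep_fam v S}"

lemma indep_at_iff:
  assumes "X \<in> Fl n m" "represents n m v X" "S \<subseteq> {1..m}"
  shows "X \<in> indep_at n m S \<longleftrightarrow> indep_fam v S"
  using assms indep_fam_represents[OF _ assms(2,3)] unfolding indep_at_def by blast

lemma diag_orbit_Fl:
  assumes "X \<in> Fl n m" "Y \<in> diag_orbit n m X"
  shows "Y \<in> Fl n m"
proof -
  obtain v where v: "represents n m v X" using Fl_represents[OF assms(1)] .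
  obtain g where "represents n m (g \<circ> v) Y" using diag_orbitE[OF assms(2) v] by metis
  moreover have "Y \<in> extensional {1..m}" using assms(2) unfolding diag_orbit_def by auto
  ultimately show ?thesis by (rule represents_Fl)
qed

lemma indep_at_orbit:
  assumes "X \<in> indep_at n m S" "S \<subseteq> {1..m}" "Y \<in> diag_orbit n m X"
  shows "Y \<in> indep_at n m S"
proof -
  obtain v where v: "X \<in> Fl n m" "represents n m v X" "indep_fam v S" using assms(1) unfolding indep_at_def by blast
  obtain g where g: "lin g" "inj_on g (Kn n)" "represents n m (g \<circ> v) Y" using diag_orbitE[OF assms(3) v(2)] by metis
  have "indep_fam (g \<circ> v) S"
    by (rule indep_fam_lin[OF g(1,2) subspace_Kn _ v(3)]) (use representsD(1)[OF v(2)] assms(2) in blast)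
  then show ?thesis using g(3) diag_orbit_Fl[OF v(1) assms(3)] unfolding indep_at_def by blast
qed

subsection \<open>Independent lines\<close>

definition std_lines :: "nat \<Rightarrow> 'k::field flag_point" where
  "std_lines m = (\<lambda>j\<in>{1..m}. coord.span {evec j})"

lemma evec_nonzero: "evec j \<noteq> (0 :: nat \<Rightarrow> 'k::field)"
  by (metis evec_def zero_fun_apply zero_neq_one)

lemma std_lines_represents:
  assumes "m \<le> n"
  shows "represents n m evec (std_lines m)"
  unfolding represents_def std_lines_def using assms evec_nonzero by (auto intro!: evec_in_Kn)

lemma std_lines_Fl: "m \<le> n \<Longrightarrow> std_lines m \<in> Fl n m"
  by (rule represents_Fl[OF std_lines_represents]) (simp_all add: std_lines_def)

text \<open>Independent vectors extend to a basis of \<open>Kn n\<close>, and the linear map sending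
  the standard basis to it moves the standard lines to the given ones. The orbit is thereby
  described by a condition that can be shown to be open.\<close>

lemma std_lines_orbit:
  assumes "m \<le> n"
  shows "diag_orbit n m (std_lines m) = (indep_at n m {1..m} :: 'k::field flag_point set)"
proof
  have "(std_lines m :: 'k flag_point) \<in> indep_at n m {1..m}"
  proof (rule indep_at_iff[OF std_lines_Fl[OF assms] std_lines_represents[OF assms] subset_refl, THEN iffD2])
    show "indep_fam (evec :: nat \<Rightarrow> nat \<Rightarrow> 'k) {1..m}"
      by (rule indep_fam_mono[OF indep_fam_evec[of n]]) (use assms in auto)
  qed
  then show "diag_orbit n m (std_lines m) \<subseteq> (indep_at n m {1..m} :: 'k flag_point set)"
    using indep_at_orbit by blast
  show "indep_at n m {1..m} \<subseteq> diag_orbit n m (std_lines m :: 'k flag_point)"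
  proof
    fix X :: "'k flag_point" assume "X \<in> indep_at n m {1..m}"
    then obtain v where v: "X \<in> Fl n m" "represents n m v X" "indep_fam v {1..m}"
      unfolding indep_at_def by blast
    obtain w where w: "indep_fam w {1..n}" "\<And>i. i \<in> {1..m} \<Longrightarrow> w i = v i" "\<And>i. i \<in> {1..n} \<Longrightarrow> w i \<in> Kn n"
      using extend_indep_fam[OF v(3) representsD(1)[OF v(2)]] by metis
    obtain g :: "(nat \<Rightarrow> 'k) \<Rightarrow> nat \<Rightarrow> 'k" where g: "lin g" "\<And>i. i \<in> {1..n} \<Longrightarrow> g (evec i) = w i"
      using lin_extend_family[OF indep_fam_evec] by metis
    have iw: "indep_fam (g \<circ> evec) {1..n}"
    proof -
      have "(g \<circ> evec) ` T = w ` T" if "T \<subseteq> {1..n}" for T using g(2) that by force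
      then have "(g \<circ> evec) ` {1..n} = w ` {1..n}" by blast
      then show ?thesis using w(1) by (simp only: indep_fam_iff_dim finite_atLeastAtMost)
    qed
    have "lin_iso (Kn n) (Kn n) g"
      by (rule lin_iso_KnI[OF g(1) indep_fam_evec _ _ evec_in_Kn iw]) (use g(2) w(3) in auto)
    then show "X \<in> diag_orbit n m (std_lines m)"
    proof (rule diag_orbitI[OF std_lines_represents[OF assms] v(2) Fl_extensional[OF v(1)] g(1)])
      fix i assume i: "i \<in> {1..m}"
      then have "i \<in> {1..n}" using assms by simp
      then show "coord.span {g (evec i)} = coord.span {v i}" using g(2) w(2)[OF i] by simp
    qed
  qed
qed

lemma decomp_singletons:
  assumes "indep_fam v S"
  shows "decomp v S ((\<lambda>j. {j}) ` S)"
  unfolding decomp_def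
proof (intro conjI ballI)
  show "partition_on S ((\<lambda>j. {j}) ` S)" unfolding partition_on_def disjoint_def by auto
  fix K assume "K \<in> (\<lambda>j. {j}) ` S"
  then obtain j where j: "j \<in> S" "K = {j}" by blast
  show "conn v K" unfolding conn_def j(2) by auto
  have n: "v j \<notin> coord.span (v ` (S - {j}))" using assms j(1) unfolding indep_fam_iff by blast
  have "x = 0" if x: "x \<in> coord.span {v j}" "x \<in> coord.span (v ` (S - {j}))" for x
  proof (rule ccontr)
    assume "x \<noteq> 0"
    then have "v j \<in> coord.span {x}" using in_span_singleton_nonzero[OF x(1)] by (simp add: coord.span_base)
    moreover have "coord.span {x} \<subseteq> coord.span (v ` (S - {j}))" using x(2) by (simp add: coord.span_minimal)
    ultimately show False using n by blast
  qed
  then have "coord.span {v j} \<inter> coord.span (v ` (S - {j})) \<subseteq> {0}" by blast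
  then show "coord.span (v ` K) \<inter> coord.span (v ` (S - K)) = {0}"
    unfolding j(2) using coord.span_zero[of "{v j}"] coord.span_zero[of "v ` (S - {j})"] by auto
qed

lemma param_of_singletons:
  assumes "\<And>j. j \<in> S \<Longrightarrow> v j \<noteq> 0"
  shows "param_of v ((\<lambda>j. {j}) ` S) = ((\<lambda>j. {j}) ` S, {}, {})"
  unfolding param_of_def using assms by (auto simp: dim_singleton)

text \<open>Since \<open>{j}\<close> is a block, its line is direct against the rest, so the nonzero
  vector \<open>v j\<close> is not in the span of the others.\<close>

lemma indep_fam_of_param:
  assumes P: "decomp v S P" and p: "param_of v P = ((\<lambda>j. {j}) ` S, {}, {})"
    and nz: "\<And>j. j \<in> S \<Longrightarrow> v j \<noteq> 0"
  shows "indep_fam v S"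
  unfolding indep_fam_iff
proof (intro ballI notI)
  fix j assume j: "j \<in> S" and s: "v j \<in> coord.span (v ` (S - {j}))"
  have "{K \<in> P. coord.dim (v ` K) = 1} = (\<lambda>j. {j}) ` S" using p unfolding param_of_def by simp
  then have "{j} \<in> P" using j by blast
  from decompD(5)[OF P this] have "coord.span {v j} \<inter> coord.span (v ` (S - {j})) = {0}" by simp
  then show False using s nz[OF j] coord.span_base[of "v j" "{v j}"] by blast
qed

lemma std_lines_fibre:
  assumes "m \<le> n"
  defines "p \<equiv> ((\<lambda>j. {j}) ` {1..m}, {}, {})"
  shows "p \<in> Params n m"
    and "orbit_fibre n m p = {diag_orbit n m (std_lines m :: 'k::field flag_point)}"
proof -
  have le: "{1..m} \<subseteq> {1..n}" using assms(1) by auto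
  have P: "decomp (evec :: nat \<Rightarrow> nat \<Rightarrow> 'k) {1..m} ((\<lambda>j. {j}) ` {1..m})"
    by (rule decomp_singletons[OF indep_fam_mono[OF indep_fam_evec le]])
  have p: "param_of (evec :: nat \<Rightarrow> nat \<Rightarrow> 'k) ((\<lambda>j. {j}) ` {1..m}) = p"
    unfolding p_def by (rule param_of_singletons) (rule evec_nonzero)
  show "p \<in> Params n m"
    unfolding p[symmetric] by (rule param_of_in_Params[OF P evec_nonzero]) (use le evec_in_Kn in blast)
  show "orbit_fibre n m p = {diag_orbit n m (std_lines m :: 'k flag_point)}"
  proof (rule orbit_fibre_eq[OF std_lines_Fl[OF assms(1)]])
    show "orbit_param n m (diag_orbit n m (std_lines m :: 'k flag_point)) = p"
      using orbit_param_eq[OF std_lines_Fl[OF assms(1)] std_lines_represents[OF assms(1)] P] p by simp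
    fix X :: "'k flag_point" and v Q
    assume X: "X \<in> Fl n m" "represents n m v X" "decomp v {1..m} Q" "param_of v Q = p"
    have "indep_fam v {1..m}"
      by (rule indep_fam_of_param[OF X(3) X(4)[unfolded p_def] representsD(2)[OF X(2)]])
    then show "X \<in> diag_orbit n m (std_lines m)"
      unfolding std_lines_orbit[OF assms(1)] by (simp only: indep_at_iff[OF X(1,2) subset_refl])
  qed
qed

text \<open>The summand of the line \<open>j\<close> goes to coordinate \<open>j\<close>, and the
  free summand \<open>s\<close> to coordinate \<open>m + s\<close>, although the free summands come
  first in the sum. Every summand is \<open>Kn 1\<close>, whose only coordinate has index 1.\<close>

lemma F_rep_sum_orbit:
  assumes "m \<le> n"
  shows "flag_orbit n m
      (flag_Sum {1..n - m} (\<lambda>_. F_rep {}) \<oplus>\<^sub>F flag_Sum {1..m} (\<lambda>j. F_rep {j} :: (nat, 'k::field) flag)) =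
    diag_orbit n m (std_lines m)"
proof -
  let ?L = "flag_Sum {1..n - m} (\<lambda>_. F_rep {}) \<oplus>\<^sub>F flag_Sum {1..m} (\<lambda>j. F_rep {j} :: (nat, 'k) flag)"
  define f :: "(nat \<times> nat + nat \<times> nat \<Rightarrow> 'k) \<Rightarrow> nat \<Rightarrow> 'k" where
    "f z = (\<lambda>j. if j \<in> {1..m} then z (Inr (j, 1)) else if j \<in> {m+1..n} then z (Inl (j - m, 1)) else 0)" for z
  have lf: "lin f" by (rule linI) (auto simp: f_def fun_eq_iff cscale_def)
  have K1: "x \<in> Kn 1 \<longleftrightarrow> (\<forall>i. i \<noteq> 1 \<longrightarrow> x i = 0)" for x :: "nat \<Rightarrow> 'k"
    unfolding Kn_def by auto
  have K10: "{0} \<subseteq> (Kn 1 :: (nat \<Rightarrow> 'k) set)" using coord.subspace_0[OF subspace_Kn] by simp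
  have wholeL: "whole ?L = dsum (dSum {1..n - m} (\<lambda>_. Kn 1)) (dSum {1..m} (\<lambda>_. Kn 1))"
    by (simp add: flag_plus_def flag_Sum_def F_rep_def)
  have partL: "part ?L i = dsum (dSum {1..n - m} (\<lambda>_. {0})) (dSum {1..m} (\<lambda>j. if i = j then Kn 1 else {0}))" for i
    by (simp add: flag_plus_def flag_Sum_def F_rep_def)
  have zero: "z (Inl (s, i)) = 0 \<or> (s \<in> {1..n - m} \<and> i = 1)" "z (Inr (s, i)) = 0 \<or> (s \<in> {1..m} \<and> i = 1)"
    if z: "z \<in> whole ?L" for z s i
  proof -
    obtain x y where xy: "z = case_sum x y" "x \<in> dSum {1..n - m} (\<lambda>_. Kn 1)" "y \<in> dSum {1..m} (\<lambda>_. Kn 1)"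
      using z unfolding wholeL by (rule dsumE)
    show "z (Inl (s, i)) = 0 \<or> (s \<in> {1..n - m} \<and> i = 1)"
      using dSumD[OF xy(2), of s] unfolding xy(1) K1 by (auto simp del: One_nat_def)
    show "z (Inr (s, i)) = 0 \<or> (s \<in> {1..m} \<and> i = 1)"
      using dSumD[OF xy(3), of s] unfolding xy(1) K1 by (auto simp del: One_nat_def)
  qed
  have subL: "coord.subspace (whole ?L)" unfolding wholeL by (intro subspace_dsum subspace_dSum) simp_all
  have partsub: "part ?L i \<subseteq> whole ?L" for i
    unfolding wholeL partL by (intro dsum_mono dSum_mono) (use K10 in auto)
  \<comment> \<open>The inverse of \<open>f\<close>, defined on all functions; it inverts
    \<open>f\<close> on \<open>Kn n\<close>.\<close>
  define lift :: "(nat \<Rightarrow> 'k) \<Rightarrow> nat \<times> nat + nat \<times> nat \<Rightarrow> 'k" where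
    "lift y = case_sum (\<lambda>u. if fst u \<in> {1..n - m} \<and> snd u = 1 then y (fst u + m) else 0)
      (\<lambda>u. if fst u \<in> {1..m} \<and> snd u = 1 then y (fst u) else 0)" for y
  have f_lift: "f (lift y) = y" if "y \<in> Kn n" for y
  proof
    fix j show "f (lift y) j = y j"
      using that assms unfolding f_def lift_def Kn_def by auto
  qed
  have lift_mem: "lift y \<in> dsum (dSum {1..n - m} A) (dSum {1..m} B)"
    if "\<And>s. s \<in> {1..n - m} \<Longrightarrow> (\<lambda>i. if i = 1 then y (s + m) else 0) \<in> A s"
      "\<And>s. s \<in> {1..m} \<Longrightarrow> (\<lambda>i. if i = 1 then y s else 0) \<in> B s" for A B y
    unfolding lift_def by (intro dsumI dSumI) (use that in \<open>auto cong: if_cong\<close>)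
  have "flag_iso m ?L (Flag (Kn n) (std_lines m))"
  proof (rule flag_isoI[OF lf])
    have "z = 0" if z: "z \<in> whole ?L" and fz: "f z = 0" for z
    proof
      fix u
      show "z u = 0 u"
      proof (cases u)
        case (Inl a)
        then obtain s i where u: "u = Inl (s, i)" by (cases a) auto
        have "z (Inl (s, 1)) = 0" if "s \<in> {1..n - m}"
          using fun_cong[OF fz, of "s + m"] that by (simp add: f_def split: if_splits)
        then show ?thesis using zero(1)[OF z, of s i] u by auto
      next
        case (Inr a)
        then obtain s i where u: "u = Inr (s, i)" by (cases a) auto
        have "z (Inr (s, 1)) = 0" if "s \<in> {1..m}"
          using fun_cong[OF fz, of s] that by (simp add: f_def)
        then show ?thesis using zero(2)[OF z, of s i] u by auto
      qed
    qed
    then show "inj_on f (whole ?L)" unfolding coord2.linear_inj_on_iff_eq_0[OF lf subL] by blast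
    have fK: "f z \<in> Kn n" for z using assms unfolding f_def Kn_def by auto
    have "Kn n \<subseteq> f ` whole ?L"
    proof
      fix y :: "nat \<Rightarrow> 'k" assume y: "y \<in> Kn n"
      have "lift y \<in> whole ?L" unfolding wholeL by (rule lift_mem) (simp_all add: K1 del: One_nat_def)
      then show "y \<in> f ` whole ?L" by (rule image_eqI[of y f "lift y", OF f_lift[OF y, symmetric]])
    qed
    then show "f ` whole ?L = whole (Flag (Kn n) (std_lines m))" using fK by auto
    fix i assume i: "i \<in> {1..m}"
    have "f ` part ?L i = coord.span {evec i}"
    proof
      show "f ` part ?L i \<subseteq> coord.span {evec i}"
      proof (rule image_subsetI)
        fix z assume z: "z \<in> part ?L i"
        obtain x y where xy: "z = case_sum x y" "x \<in> dSum {1..n - m} (\<lambda>_. {0})"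
          "y \<in> dSum {1..m} (\<lambda>j. if i = j then Kn 1 else {0})"
          using z unfolding partL by (rule dsumE)
        have x0: "x (s, 1) = 0" for s
          using dSumD[OF xy(2), of s] by (cases "s \<in> {1..n - m}") (auto dest: fun_cong)
        have y0: "y (s, 1) = 0" if "s \<noteq> i" for s
          using dSumD[OF xy(3), of s] that by (cases "s \<in> {1..m}") (auto dest: fun_cong)
        have "f z = cscale (y (i, 1)) (evec i)"
          using i x0 y0 unfolding f_def xy(1) by (auto simp: fun_eq_iff cscale_def evec_def)
        then show "f z \<in> coord.span {evec i}" by (simp add: coord.span_base coord.span_scale)
      qed
      show "coord.span {evec i} \<subseteq> f ` part ?L i"
      proof
        fix y :: "nat \<Rightarrow> 'k" assume "y \<in> coord.span {evec i}"
        then obtain c where c: "y = cscale c (evec i)" unfolding coord.span_singleton by blast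
        have y0: "y j = 0" if "j \<noteq> i" for j using that by (simp add: c cscale_def evec_def)
        have "i \<in> {1..n}" using i assms by simp
        then have yK: "y \<in> Kn n" unfolding Kn_def using y0 by auto
        have "lift y \<in> part ?L i"
          unfolding partL
        proof (rule lift_mem)
          fix s assume "s \<in> {1..n - m}"
          then have "s + m \<noteq> i" using i by auto
          then show "(\<lambda>i. if i = 1 then y (s + m) else 0) \<in> {0}" using y0 by (simp add: fun_eq_iff)
        next
          fix s assume "s \<in> {1..m}"
          show "(\<lambda>i. if i = 1 then y s else 0) \<in> (if i = s then Kn 1 else {0})"
            using y0[of s] by (auto simp: fun_eq_iff K1 simp del: One_nat_def)
        qed
        then show "y \<in> f ` part ?L i" by (rule image_eqI[of y f "lift y", OF f_lift[OF yK, symmetric]])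
      qed
    qed
    then show "f ` part ?L i = part (Flag (Kn n) (std_lines m)) i" using i by (simp add: std_lines_def)
  qed
  moreover from this have "flag_iso m (Flag (Kn n) (std_lines m)) ?L"
    by (rule flag_iso_sym[OF _ subL partsub])
  ultimately show ?thesis
    unfolding diag_orbit_eq_flag_orbit by (intro antisym flag_orbit_mono)
qed

subsection \<open>Projective frames\<close>

text \<open>For \<open>m = n + 1\<close> and \<open>n \<ge> 1\<close> these are the projective
  frames: the vectors form a circuit of rank \<open>n\<close>.\<close>

definition general_position :: "nat \<Rightarrow> nat \<Rightarrow> 'k::field flag_point set" where
  "general_position n m = {X \<in> Fl n m. \<forall>S. S \<subseteq> {1..m} \<longrightarrow> card S = n \<longrightarrow> X \<in> indep_at n m S}"

definition frame_vec :: "nat \<Rightarrow> nat \<Rightarrow> nat \<Rightarrow> 'k::field" where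
  "frame_vec n j = (if j \<le> n then evec j else \<Sum>i=1..n. evec i)"

definition std_frame :: "nat \<Rightarrow> 'k::field flag_point" where
  "std_frame n = (\<lambda>j\<in>{1..n + 1}. coord.span {frame_vec n j})"

lemma frame_sum_apply:
  "(\<Sum>i=1..n. evec i :: nat \<Rightarrow> 'k::field) j = (if j \<in> {1..n} then 1 else 0)"
proof -
  have "(\<Sum>i=1..n. evec i :: nat \<Rightarrow> 'k) j = (\<Sum>i\<in>{1..n}. if i = j then 1 else 0)"
    unfolding sum_fun_apply by (rule sum.cong) (auto simp: evec_def)
  also have "\<dots> = (if j \<in> {1..n} then 1 else 0)" by simp
  finally show ?thesis .
qed

lemma std_frame_represents:
  assumes "n \<ge> 1"
  shows "represents n (n + 1) (frame_vec n) (std_frame n :: 'k::field flag_point)"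
  unfolding represents_def
proof (intro ballI conjI)
  fix i assume i: "i \<in> {1..n + 1}"
  show "frame_vec n i \<in> (Kn n :: (nat \<Rightarrow> 'k) set)"
  proof (cases "i \<le> n")
    case True
    then show ?thesis using i evec_in_Kn[of i n] by (simp add: frame_vec_def)
  next
    case False
    have "(\<Sum>i=1..n. evec i) \<in> (Kn n :: (nat \<Rightarrow> 'k) set)"
      by (rule coord.subspace_sum[OF subspace_Kn]) (rule evec_in_Kn)
    then show ?thesis using False by (simp add: frame_vec_def)
  qed
  show "frame_vec n i \<noteq> (0 :: nat \<Rightarrow> 'k)"
  proof (cases "i \<le> n")
    case True
    then show ?thesis using evec_nonzero by (simp add: frame_vec_def)
  next
    case False
    have "(\<Sum>i=1..n. evec i :: nat \<Rightarrow> 'k) 1 = 1" unfolding frame_sum_apply using assms by simp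
    then have "(\<Sum>i=1..n. evec i :: nat \<Rightarrow> 'k) \<noteq> 0" by (metis zero_fun_apply zero_neq_one)
    then show ?thesis using False by (simp add: frame_vec_def)
  qed
  show "std_frame n i = coord.span {frame_vec n i :: nat \<Rightarrow> 'k}" using i by (simp add: std_frame_def)
qed

lemma std_frame_Fl: "n \<ge> 1 \<Longrightarrow> std_frame n \<in> (Fl n (n + 1) :: 'k::field flag_point set)"
  by (rule represents_Fl[OF std_frame_represents]) (simp_all add: std_frame_def)

lemma card_n_subset:
  assumes "S \<subseteq> {1..n + 1}" "card S = n"
  obtains j where "j \<in> {1..n + 1}" "S = {1..n + 1} - {j}"
proof -
  have fin: "finite S" using assms(1) finite_subset by blast
  have "card ({1..n + 1} - S) = 1" using assms card_Diff_subset[OF fin assms(1)] by simp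
  then obtain j where "{1..n + 1} - S = {j}" using card_1_singletonE by blast
  then have "j \<in> {1..n + 1}" "S = {1..n + 1} - {j}" using assms(1) by blast+
  then show ?thesis using that by blast
qed

text \<open>If the sum vector is dropped, the standard basis remains. If some basis vector is
  dropped, it is recovered as the sum vector minus the other basis vectors. So any \<open>n\<close>
  of the vectors span \<open>Kn n\<close> and are independent by dimension.\<close>

lemma std_frame_general: 
  assumes "n \<ge> 1"
  shows "std_frame n \<in> (general_position n (n + 1) :: 'k::field flag_point set)"
  unfolding general_position_def
proof (intro CollectI conjI allI impI std_frame_Fl[OF assms])
  fix S assume S: "S \<subseteq> {1..n + 1}" "card S = n"
  obtain j where j: "j \<in> {1..n + 1}" "S = {1..n + 1} - {j}" using card_n_subset[OF S] .
  have fin: "finite S" using S(1) finite_subset by blast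
  have frame: "(frame_vec n i :: nat \<Rightarrow> 'k) \<in> coord.span (frame_vec n ` S)" if "i \<in> S" for i
    using that by (simp add: coord.span_base)
  have "evec i \<in> coord.span (frame_vec n ` S :: (nat \<Rightarrow> 'k) set)" if i: "i \<in> {1..n}" for i
  proof (cases "i = j")
    case False
    then have "i \<in> S" using i j by auto
    then show ?thesis using frame[of i] i by (simp add: frame_vec_def)
  next
    case True
    then have "n + 1 \<in> S" using i j by auto
    then have s: "(\<Sum>i=1..n. evec i) \<in> coord.span (frame_vec n ` S :: (nat \<Rightarrow> 'k) set)"
      using frame[of "n + 1"] by (simp add: frame_vec_def)
    have "(\<Sum>l\<in>{1..n} - {i}. evec l) \<in> coord.span (frame_vec n ` S :: (nat \<Rightarrow> 'k) set)"
    proof (rule coord.span_sum)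
      fix l assume l: "l \<in> {1..n} - {i}"
      then have "l \<in> S" using True j by auto
      then show "evec l \<in> coord.span (frame_vec n ` S :: (nat \<Rightarrow> 'k) set)"
        using frame[of l] l by (simp add: frame_vec_def)
    qed
    note d = coord.span_diff[OF s this]
    have "(\<Sum>i=1..n. evec i :: nat \<Rightarrow> 'k) = evec i + (\<Sum>l\<in>{1..n} - {i}. evec l)"
      by (rule sum.remove) (use i in simp_all)
    then show ?thesis using d by (simp only: add_diff_cancel_right')
  qed
  then have "(evec ` {1..n} :: (nat \<Rightarrow> 'k) set) \<subseteq> coord.span (frame_vec n ` S)" by blast
  then have "coord.dim (evec ` {1..n} :: (nat \<Rightarrow> 'k) set) \<le> coord.dim (frame_vec n ` S :: (nat \<Rightarrow> 'k) set)"
    using fin by (intro dim_mono_span) simp_all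
  moreover have "coord.dim (evec ` {1..n} :: (nat \<Rightarrow> 'k) set) = n"
    using indep_fam_evec[of n] by (simp only: indep_fam_iff_dim finite_atLeastAtMost card_atLeastAtMost) simp
  moreover have "coord.dim (frame_vec n ` S :: (nat \<Rightarrow> 'k) set) \<le> card S"
    by (rule dim_image_le_card[OF fin])
  ultimately have "indep_fam (frame_vec n :: nat \<Rightarrow> nat \<Rightarrow> 'k) S"
    unfolding indep_fam_iff_dim[OF fin] using S(2) by simp
  then show "std_frame n \<in> (indep_at n (n + 1) S :: 'k flag_point set)"
    by (rule indep_at_iff[OF std_frame_Fl[OF assms] std_frame_represents[OF assms] S(1), THEN iffD2])
qed

lemma general_position_indep:
  assumes "X \<in> general_position n m" "represents n m v X" "S \<subseteq> {1..m}" "card S = n"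
  shows "indep_fam v S"
  using assms(1) indep_at_iff[OF _ assms(2,3)] assms(3,4) unfolding general_position_def by blast

text \<open>The first \<open>n\<close> vectors form a basis. If the coefficient at \<open>j\<close>
  were zero, the last vector would depend on the basis without \<open>v j\<close>, contrary to the
  independence of the \<open>n\<close> vectors other than \<open>v j\<close>.\<close>

lemma general_relation:
  fixes v :: "nat \<Rightarrow> nat \<Rightarrow> 'k::field"
  assumes ind: "\<And>S. S \<subseteq> {1..n + 1} \<Longrightarrow> card S = n \<Longrightarrow> indep_fam v S"
    and vK: "\<And>i. i \<in> {1..n + 1} \<Longrightarrow> v i \<in> Kn n"
  obtains a where "v (n + 1) = (\<Sum>i\<in>{1..n}. cscale (a i) (v i))" "\<And>i. i \<in> {1..n} \<Longrightarrow> a i \<noteq> 0"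
proof -
  have i0: "indep_fam v {1..n}" by (rule ind) auto
  have "coord.span (v ` {1..n}) = Kn n" by (rule indep_fam_span_Kn[OF i0]) (use vK in auto)
  then have "v (n + 1) \<in> coord.span (v ` {1..n})" using vK[of "n + 1"] by simp
  then obtain a where a: "v (n + 1) = (\<Sum>i\<in>{1..n}. cscale (a i) (v i))"
    using in_span_image_finite[of "{1..n}"] by blast
  have "a j \<noteq> 0" if j: "j \<in> {1..n}" for j
  proof
    assume 0: "a j = 0"
    let ?S = "{1..n + 1} - {j}"
    have S: "indep_fam v ?S" by (rule ind) (use j in auto)
    have e: "?S - {n + 1} = {1..n} - {j}" using j by auto
    have "v (n + 1) = cscale (a j) (v j) + (\<Sum>i\<in>{1..n} - {j}. cscale (a i) (v i))"
      unfolding a by (rule sum.remove) (use j in simp_all)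
    also have "\<dots> = (\<Sum>i\<in>{1..n} - {j}. cscale (a i) (v i))" by (simp add: 0)
    also have "\<dots> \<in> coord.span (v ` ({1..n} - {j}))"
      by (intro coord.span_sum coord.span_scale coord.span_base imageI)
    finally have "v (n + 1) \<in> coord.span (v ` (?S - {n + 1}))" unfolding e .
    moreover have "n + 1 \<in> ?S" using j by auto
    ultimately show False using S unfolding indep_fam_iff by blast
  qed
  then show ?thesis using that a by blast
qed

lemma indep_fam_scale:
  assumes "indep_fam v S" "finite S" "\<And>i. i \<in> S \<Longrightarrow> a i \<noteq> 0"
  shows "indep_fam (\<lambda>i. cscale (a i) (v i)) S"
proof (rule indep_famI[OF assms(2)])
  fix c assume 0: "(\<Sum>i\<in>S. cscale (c i) (cscale (a i) (v i))) = 0"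
  then have "(\<Sum>i\<in>S. cscale (c i * a i) (v i)) = 0" by simp
  then have "c i * a i = 0" if "i \<in> S" for i using indep_famD[OF assms(1,2), of "\<lambda>i. c i * a i"] that by blast
  then show "\<forall>i\<in>S. c i = 0" using assms(3) by auto
qed

text \<open>Vectors on given lines may be rescaled. The scaling is chosen so that the last vector
  becomes the sum of the others; then the linear map between the bases also matches the last lines.
  This is the classical transitivity on projective frames.\<close>

lemma std_frame_orbit:
  assumes n: "n \<ge> 1"
  shows "diag_orbit n (n + 1) (std_frame n) = (general_position n (n + 1) :: 'k::field flag_point set)"
proof
  show "diag_orbit n (n + 1) (std_frame n) \<subseteq> (general_position n (n + 1) :: 'k flag_point set)"
  proof
    fix Y :: "'k flag_point" assume Y: "Y \<in> diag_orbit n (n + 1) (std_frame n)"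
    have "Y \<in> indep_at n (n + 1) S" if S: "S \<subseteq> {1..n + 1}" "card S = n" for S
    proof (rule indep_at_orbit[OF _ S(1) Y])
      show "std_frame n \<in> (indep_at n (n + 1) S :: 'k flag_point set)"
        using std_frame_general[OF n] S unfolding general_position_def by blast
    qed
    then show "Y \<in> general_position n (n + 1)"
      using diag_orbit_Fl[OF std_frame_Fl[OF n] Y] unfolding general_position_def by blast
  qed
  show "general_position n (n + 1) \<subseteq> diag_orbit n (n + 1) (std_frame n :: 'k flag_point)"
  proof
    fix X :: "'k flag_point" assume X: "X \<in> general_position n (n + 1)"
    then have XF: "X \<in> Fl n (n + 1)" unfolding general_position_def by blast
    obtain v where v: "represents n (n + 1) v X" using Fl_represents[OF XF] .
    note vK = representsD(1)[OF v]
    obtain a where a: "v (n + 1) = (\<Sum>i\<in>{1..n}. cscale (a i) (v i))" "\<And>i. i \<in> {1..n} \<Longrightarrow> a i \<noteq> 0"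
      using general_relation[OF general_position_indep[OF X v] vK] by blast
    \<comment> \<open>With this scaling \<open>v (n + 1)\<close> is the plain sum of the
      \<open>w i\<close>, and the nonzero coefficients keep the lines unchanged.\<close>
    define w where "w i = cscale (a i) (v i)" for i
    have iv: "indep_fam v {1..n}" by (rule general_position_indep[OF X v]) auto
    have iw: "indep_fam w {1..n}" unfolding w_def by (rule indep_fam_scale[OF iv _ a(2)]) simp_all
    have wK: "w i \<in> Kn n" if "i \<in> {1..n}" for i
      unfolding w_def by (rule coord.subspace_scale[OF subspace_Kn vK]) (use that in auto)
    obtain g :: "(nat \<Rightarrow> 'k) \<Rightarrow> nat \<Rightarrow> 'k" where g: "lin g" "\<And>i. i \<in> {1..n} \<Longrightarrow> g (evec i) = w i"
      using lin_extend_family[OF indep_fam_evec] by metis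
    have "(g \<circ> evec) ` {1..n} = w ` {1..n}" using g(2) by force
    then have ig: "indep_fam (g \<circ> evec) {1..n}"
      using iw by (simp only: indep_fam_iff_dim finite_atLeastAtMost)
    have "lin_iso (Kn n) (Kn n) g"
      by (rule lin_iso_KnI[OF g(1) indep_fam_evec _ _ evec_in_Kn ig]) (use g(2) wK in auto)
    then show "X \<in> diag_orbit n (n + 1) (std_frame n)"
    proof (rule diag_orbitI[OF std_frame_represents[OF n] v Fl_extensional[OF XF] g(1)])
      fix i assume i: "i \<in> {1..n + 1}"
      show "coord.span {g (frame_vec n i)} = coord.span {v i}"
      proof (cases "i \<le> n")
        case True
        then have i': "i \<in> {1..n}" using i by simp
        then have "g (frame_vec n i) = cscale (a i) (v i)" using True g(2)[OF i'] by (simp add: frame_vec_def w_def)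
        then have "coord.span {v i} = coord.span {g (frame_vec n i)}"
          using a(2)[OF i'] unfolding span_singleton_eq by blast
        then show ?thesis by simp
      next
        case False
        then have "i = n + 1" using i by simp
        moreover have "g (frame_vec n (n + 1)) = v (n + 1)"
          unfolding a(1) by (simp add: frame_vec_def coord2.linear_sum[OF g(1)] g(2) w_def del: One_nat_def)
        ultimately show ?thesis by simp
      qed
    qed
  qed
qed

text \<open>Every proper subfamily is independent, so a direct splitting of all \<open>n + 1\<close>
  vectors into two proper subfamilies would have rank \<open>n + 1\<close>, more than
  \<open>Kn n\<close> allows.\<close>

lemma conn_general:
  fixes v :: "nat \<Rightarrow> nat \<Rightarrow> 'k::field"
  assumes ind: "\<And>S. S \<subseteq> {1..n + 1} \<Longrightarrow> card S = n \<Longrightarrow> indep_fam v S"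
    and vK: "\<And>i. i \<in> {1..n + 1} \<Longrightarrow> v i \<in> Kn n"
  shows "conn v {1..n + 1}" "coord.dim (v ` {1..n + 1}) = n"
proof -
  have le: "coord.dim (v ` {1..n + 1}) \<le> n"
  proof -
    have "coord.dim (v ` {1..n + 1}) \<le> coord.dim (evec ` {1..n} :: (nat \<Rightarrow> 'k) set)"
      by (rule dim_mono_span) (use vK in \<open>auto simp: span_evec simp del: One_nat_def\<close>)
    also have "\<dots> = n" by (metis coord.dim_span dim_Kn span_evec)
    finally show ?thesis .
  qed
  have dimT: "coord.dim (v ` T) = card T" if T: "T \<subseteq> {1..n + 1}" "T \<noteq> {1..n + 1}" for T
  proof -
    obtain j where j: "j \<in> {1..n + 1}" "j \<notin> T" using T by blast
    have "indep_fam v ({1..n + 1} - {j})" by (rule ind) (use j in auto)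
    then have "indep_fam v T" by (rule indep_fam_mono) (use T j in blast)
    moreover have "finite T" using T(1) finite_subset by blast
    ultimately show ?thesis by (simp add: indep_fam_iff_dim)
  qed
  have "coord.dim (v ` {1..n}) = n" using dimT[of "{1..n}"] by auto
  moreover have "coord.dim (v ` {1..n}) \<le> coord.dim (v ` {1..n + 1})"
    by (rule dim_mono_span) (auto intro: coord.span_base)
  ultimately show "coord.dim (v ` {1..n + 1}) = n" using le by simp
  show "conn v {1..n + 1}"
    unfolding conn_def
  proof (intro conjI allI impI notI)
    show "{1..n + 1} = {} \<Longrightarrow> False" by simp
    fix T assume T: "T \<subseteq> {1..n + 1}" "T \<noteq> {}" "T \<noteq> {1..n + 1}"
      and 0: "coord.span (v ` T) \<inter> coord.span (v ` ({1..n + 1} - T)) = {0}"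
    have fin: "finite T" using T(1) finite_subset by blast
    have "coord.dim (v ` T \<union> v ` ({1..n + 1} - T)) = coord.dim (v ` T) + coord.dim (v ` ({1..n + 1} - T))"
      using fin by (intro dim_Un_direct[OF _ _ 0]) simp_all
    moreover have "v ` T \<union> v ` ({1..n + 1} - T) = v ` {1..n + 1}" using T(1) by blast
    moreover have "coord.dim (v ` T) = card T" by (rule dimT[OF T(1,3)])
    moreover have "coord.dim (v ` ({1..n + 1} - T)) = card ({1..n + 1} - T)" by (rule dimT) (use T in auto)
    moreover have "card T + card ({1..n + 1} - T) = n + 1"
      using card_Diff_subset[OF fin T(1)] card_mono[OF _ T(1)] by simp
    ultimately show False using le by simp
  qed
qed

text \<open>By connectivity the omitted vector lies in the span of the remaining \<open>n\<close>.
  These therefore still have rank \<open>n\<close>.\<close>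

lemma indep_of_conn:
  fixes v :: "nat \<Rightarrow> nat \<Rightarrow> 'k::field"
  assumes "n \<ge> 1" "conn v {1..n + 1}" "coord.dim (v ` {1..n + 1}) = n" "S \<subseteq> {1..n + 1}" "card S = n"
  shows "indep_fam v S"
proof -
  obtain j where j: "j \<in> {1..n + 1}" "S = {1..n + 1} - {j}" using card_n_subset[OF assms(4,5)] .
  have "{1..n + 1} \<noteq> {j}"
  proof
    assume "{1..n + 1} = {j}"
    then have "card {1..n + 1} = 1" by simp
    then show False using assms(1) by simp
  qed
  then have "v j \<in> coord.span (v ` S)" unfolding j(2) by (rule conn_in_span[OF assms(2) _ j(1)])
  then have "coord.dim (v ` S) = coord.dim (v ` {1..n + 1})"
    unfolding j(2) by (intro coord.span_eq_dim span_image_redundant[OF j(1), symmetric])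
  moreover have "finite S" using assms(4) finite_subset by blast
  ultimately show ?thesis using assms(3,5) by (simp add: indep_fam_iff_dim)
qed

text \<open>The bound \<open>n \<ge> 2\<close> gives the block at least three elements and rank
  different from 1, which places it in the second family and keeps it out of the first.\<close>

lemma std_frame_fibre:
  assumes n: "n \<ge> 2"
  defines "p \<equiv> ({}, {{1..n + 1}}, {})"
  shows "p \<in> Params n (n + 1)"
    and "orbit_fibre n (n + 1) p = {diag_orbit n (n + 1) (std_frame n :: 'k::field flag_point)}"
proof -
  have n1: "n \<ge> 1" using n by simp
  note F = std_frame_Fl[OF n1, where ?'k = 'k] and R = std_frame_represents[OF n1, where ?'k = 'k]
  note ind = general_position_indep[OF std_frame_general[OF n1, where ?'k = 'k] R]
  note c = conn_general[OF ind representsD(1)[OF R]]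
  note P = decomp_conn[OF c(1)]
  have p: "param_of (frame_vec n :: nat \<Rightarrow> nat \<Rightarrow> 'k) {{1..n + 1}} = p"
    unfolding param_of_def p_def using n c(2) by (auto simp del: atLeastAtMost_iff)
  show "p \<in> Params n (n + 1)"
    unfolding p[symmetric] by (rule param_of_in_Params[OF P representsD(2)[OF R] representsD(1)[OF R]])
  show "orbit_fibre n (n + 1) p = {diag_orbit n (n + 1) (std_frame n :: 'k flag_point)}"
  proof (rule orbit_fibre_eq[OF F])
    show "orbit_param n (n + 1) (diag_orbit n (n + 1) (std_frame n :: 'k flag_point)) = p"
      using orbit_param_eq[OF F R P] p by simp
    fix X :: "'k flag_point" and v Q
    assume X: "X \<in> Fl n (n + 1)" "represents n (n + 1) v X" "decomp v {1..n + 1} Q" "param_of v Q = p"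
    have "{K \<in> Q. card K \<ge> 3 \<and> coord.dim (v ` K) = card K - 1} = {{1..n + 1}}"
      using X(4) unfolding param_of_def p_def by simp
    then have K: "{1..n + 1} \<in> Q" "coord.dim (v ` {1..n + 1}) = card {1..n + 1} - 1" by blast+
    have con: "conn v {1..n + 1}" by (rule decompD(4)[OF X(3) K(1)])
    have d: "coord.dim (v ` {1..n + 1}) = n" using K(2) by simp
    have "X \<in> indep_at n (n + 1) S" if S: "S \<subseteq> {1..n + 1}" "card S = n" for S
      using indep_at_iff[OF X(1,2) S(1)] indep_of_conn[OF n1 con d S] by blast
    then have "X \<in> general_position n (n + 1)" using X(1) unfolding general_position_def by blast
    then show "X \<in> diag_orbit n (n + 1) (std_frame n)" unfolding std_frame_orbit[OF n1] .
  qed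
qed

lemma std_frame_eq:
  "(\<lambda>j\<in>{1..n + 1}. if j \<le> n then coord.span {evec j} else coord.span {\<Sum>i=1..n. evec i}) = std_frame n"
  unfolding std_frame_def frame_vec_def by (rule restrict_ext) simp

lemma D_rep_orbit:
  "flag_orbit n (n + 1) (D_rep {1..n + 1} :: (nat, 'k::field) flag) = diag_orbit n (n + 1) (std_frame n)"
proof -
  have w: "whole (D_rep {1..n + 1} :: (nat, 'k) flag) = Kn n" by (simp add: D_rep_def Let_def)
  have p: "part (D_rep {1..n + 1} :: (nat, 'k) flag) i = std_frame n i" if i: "i \<in> {1..n + 1}" for i
  proof -
    \<comment> \<open>In the full index set the position of \<open>i\<close> is \<open>i\<close>
      itself.\<close>
    have "{j \<in> {1..n + 1}. j \<le> i} = {1..i}" using i by auto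
    then have "card {j \<in> {1..n + 1}. j \<le> i} = i" by simp
    then show ?thesis using i unfolding D_rep_def Let_def std_frame_def frame_vec_def by simp
  qed
  have "(\<lambda>i\<in>{1..n + 1}. f ` part (D_rep {1..n + 1} :: (nat, 'k) flag) i) = (\<lambda>i\<in>{1..n + 1}. f ` std_frame n i)"
    for f :: "(nat \<Rightarrow> 'k) \<Rightarrow> nat \<Rightarrow> 'k"
    by (rule restrict_ext) (simp only: p)
  then show ?thesis unfolding diag_orbit_eq_flag_orbit flag_orbit_def w by simp
qed

section \<open>Open orbits\<close>

lemma continuous_cscale_left: "continuous_on UNIV (cscale c :: (nat \<Rightarrow> 'k::real_normed_field) \<Rightarrow> nat \<Rightarrow> 'k)"
  unfolding cscale_def by (intro continuous_intros continuous_on_product_coordinates)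

text \<open>The map from vectors to lines is open: the vectors lying on a line through
  \<open>A\<close> are the preimages of \<open>A\<close> under all nonzero scalings, a union of open
  sets.\<close>

lemma openin_lines:
  fixes A :: "(nat \<Rightarrow> 'k::real_normed_field) set"
  assumes "openin (top_of_set (Kn n - {0})) A"
  shows "openin (proj_topology n) ((\<lambda>x. coord.span {x}) ` A)"
  unfolding openin_proj_topology
proof
  obtain T where T: "open T" "A = (Kn n - {0}) \<inter> T" using assms unfolding openin_open by blast
  show "(\<lambda>x. coord.span {x}) ` A \<subseteq> Gr 1 (Kn n)"
  proof (rule image_subsetI)
    fix x assume "x \<in> A"
    then show "coord.span {x} \<in> Gr 1 (Kn n)"
      unfolding T(2) Gr_def by (simp add: coord.span_minimal dim_singleton)
  qed
  let ?P = "{x \<in> Kn n - {0}. coord.span {x} \<in> (\<lambda>x. coord.span {x}) ` A}"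
  have "?P = (Kn n - {0}) \<inter> (\<Union>c\<in>- {0}. cscale c -` T)"
  proof
    show "?P \<subseteq> (Kn n - {0}) \<inter> (\<Union>c\<in>- {0}. cscale c -` T)"
    proof
      fix x assume x: "x \<in> ?P"
      then obtain y where y: "y \<in> A" "coord.span {x} = coord.span {y}" by blast
      obtain c where c: "c \<noteq> 0" "y = cscale c x" using y(2) unfolding span_singleton_eq by blast
      then have "x \<in> cscale c -` T" using y(1) T(2) by simp
      then show "x \<in> (Kn n - {0}) \<inter> (\<Union>c\<in>- {0}. cscale c -` T)" using x c(1) by blast
    qed
    show "(Kn n - {0}) \<inter> (\<Union>c\<in>- {0}. cscale c -` T) \<subseteq> ?P"
    proof
      fix x assume "x \<in> (Kn n - {0}) \<inter> (\<Union>c\<in>- {0}. cscale c -` T)"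
      then obtain c where c: "x \<in> Kn n" "x \<noteq> 0" "c \<noteq> 0" "cscale c x \<in> T" by blast
      have "cscale c x \<in> A" using c coord.subspace_scale[OF subspace_Kn c(1)] by (simp add: T(2))
      moreover have "coord.span {x} = coord.span {cscale c x}"
        unfolding span_singleton_eq using c(3) by blast
      ultimately show "x \<in> ?P" using c(1,2) by blast
    qed
  qed
  moreover have "open (\<Union>c\<in>- {0}. cscale c -` T :: (nat \<Rightarrow> 'k) set)"
    by (intro open_UN ballI open_vimage[OF T(1)] continuous_cscale_left)
  ultimately show "openin (top_of_set (Kn n - {0})) ?P" unfolding openin_open by blast
qed

text \<open>A linear map on all of \<open>nat \<Rightarrow> 'k\<close> need not be continuous for
  the product topology. On \<open>Kn n\<close> it is a finite combination of coordinates.\<close>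

lemma continuous_lin_Kn:
  fixes g :: "(nat \<Rightarrow> 'k::real_normed_field) \<Rightarrow> nat \<Rightarrow> 'k"
  assumes "lin g"
  shows "continuous_on (Kn n) (\<lambda>x. g x j)"
proof -
  have "g x j = (\<Sum>i\<in>{1..n}. x i * g (evec i) j)" if "x \<in> Kn n" for x
  proof -
    have "g x = (\<Sum>i\<in>{1..n}. cscale (x i) (g (evec i)))"
      by (subst Kn_expand[OF that]) (simp only: coord2.linear_sum[OF assms] coord2.linear_scale[OF assms])
    then show ?thesis by (simp add: sum_fun_apply cscale_def)
  qed
  moreover have "continuous_on (Kn n) (\<lambda>x. \<Sum>i\<in>{1..n}. x i * g (evec i) j)"
    by (intro continuous_intros continuous_on_subset[OF continuous_on_product_coordinates]) simp
  ultimately show ?thesis by (simp cong: continuous_on_cong)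
qed

text \<open>Diagonal dominance. At an index \<open>j\<close> where \<open>norm (c j)\<close> is
  maximal, the equation for \<open>j\<close> bounds \<open>norm (c j)\<close> by the sum of
  \<open>card S\<close> errors, each at most \<open>norm (c j) / (card S + 1)\<close>. The total is
  strictly smaller than \<open>norm (c j)\<close> unless this is zero.\<close>

lemma near_identity_kernel:
  fixes a :: "'s \<Rightarrow> 's \<Rightarrow> 'k::real_normed_field"
  assumes "finite S" and near: "\<And>i j. i \<in> S \<Longrightarrow> j \<in> S \<Longrightarrow>
      norm (a i j - (if i = j then 1 else 0)) < 1 / (card S + 1)"
    and zero: "\<And>j. j \<in> S \<Longrightarrow> (\<Sum>i\<in>S. c i * a i j) = 0"
  shows "\<forall>i\<in>S. c i = 0"
proof (rule ccontr)
  assume "\<not> ?thesis"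
  then have ne: "S \<noteq> {}" and nz: "\<exists>i\<in>S. c i \<noteq> 0" by auto
  obtain j where j: "j \<in> S" "\<And>i. i \<in> S \<Longrightarrow> norm (c i) \<le> norm (c j)"
  proof -
    have "Max ((\<lambda>i. norm (c i)) ` S) \<in> (\<lambda>i. norm (c i)) ` S" using assms(1) ne by (intro Max_in) auto
    then obtain j where "j \<in> S" "norm (c j) = Max ((\<lambda>i. norm (c i)) ` S)" by force
    then show ?thesis using that[of j] assms(1) by simp
  qed
  obtain i where i: "i \<in> S" "c i \<noteq> 0" using nz by blast
  have "0 < norm (c i)" using i(2) by simp
  then have cj: "norm (c j) > 0" using j(2)[OF i(1)] by linarith
  let ?d = "\<lambda>i. if i = j then 1 else 0 :: 'k"
  have "(\<Sum>i\<in>S. c i * (a i j - ?d i)) = (\<Sum>i\<in>S. c i * a i j) - (\<Sum>i\<in>S. c i * ?d i)"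
    by (simp add: right_diff_distrib sum_subtractf)
  also have "(\<Sum>i\<in>S. c i * ?d i) = (\<Sum>i\<in>S. if i = j then c i else 0)" by (rule sum.cong) auto
  also have "\<dots> = c j" using assms(1) j(1) by simp
  finally have "norm (c j) = norm (\<Sum>i\<in>S. c i * (a i j - ?d i))" using zero[OF j(1)] by simp
  also have "\<dots> \<le> (\<Sum>i\<in>S. norm (c i * (a i j - ?d i)))" by (rule norm_sum)
  also have "\<dots> \<le> (\<Sum>i\<in>S. norm (c j) * (1 / (card S + 1)))"
  proof (rule sum_mono)
    fix i assume i: "i \<in> S"
    show "norm (c i * (a i j - ?d i)) \<le> norm (c j) * (1 / (card S + 1))"
      unfolding norm_mult by (intro mult_mono j(2)[OF i] less_imp_le[OF near[OF i j(1)]]) simp_all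
  qed
  also have "\<dots> = norm (c j) * (card S / (card S + 1))" by simp
  also have "\<dots> < norm (c j) * 1" using cj by (intro mult_strict_left_mono) simp_all
  finally show False by simp
qed

lemma indep_at_open:
  assumes S: "S \<subseteq> {1..m}"
  shows "openin (Fl_topology n m) (indep_at n m S :: 'k::real_normed_field flag_point set)"
  unfolding Fl_topology_def openin_product_topology_alt
proof
  fix X :: "'k flag_point" assume "X \<in> indep_at n m S"
  then obtain v where v: "X \<in> Fl n m" "represents n m v X" "indep_fam v S" unfolding indep_at_def by blast
  have fin: "finite S" using S finite_subset by blast
  txt \<open>\<open>\<Phi>\<close> collects the functionals dual to the vectors \<open>v j\<close>; the family stays independent as long as
    its image under \<open>\<Phi>\<close> is close to the identity matrix.\<close>
  obtain \<Phi> :: "(nat \<Rightarrow> 'k) \<Rightarrow> nat \<Rightarrow> 'k" where \<Phi>: "lin \<Phi>" "\<And>j. j \<in> S \<Longrightarrow> \<Phi> (v j) = evec j"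
    using lin_extend_family[OF v(3)] by metis
  \<comment> \<open>The tolerance is that of \<open>near_identity_kernel\<close>. The function
    \<open>h i\<close> sums a whole row of errors, so one inequality controls all its
    entries.\<close>
  define e :: real where "e = 1 / (card S + 1)"
  define h where "h i x = (\<Sum>j\<in>S. norm (\<Phi> x j - (if i = j then 1 else 0)))" for i x
  \<comment> \<open>Indices outside \<open>S\<close> are left unconstrained.\<close>
  define A where "A i = (if i \<in> S then (Kn n - {0}) \<inter> h i -` {..<e} else Kn n - {0})" for i
  define U where "U i = (\<lambda>x. coord.span {x}) ` A i" for i
  have "continuous_on (Kn n - {0}) (\<lambda>x. \<Phi> x j)" for j
    by (rule continuous_on_subset[OF continuous_lin_Kn[OF \<Phi>(1)]]) auto
  then have cont: "continuous_on (Kn n - {0}) (h i)" for i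
    unfolding h_def by (intro continuous_intros)
  have "openin (top_of_set (Kn n - {0})) (A i)" for i
    unfolding A_def using continuous_openin_preimage_gen[OF cont, of "{..<e}" i] by simp
  then have openU: "openin (proj_topology n) (U i)" for i unfolding U_def by (rule openin_lines)
  have XU: "X \<in> PiE {1..m} U"
  proof (rule PiE_I)
    fix i assume i: "i \<in> {1..m}"
    note r = representsD[OF v(2) i]
    have "v i \<in> A i"
    proof (cases "i \<in> S")
      case True
      have "h i (v i) = 0" unfolding h_def \<Phi>(2)[OF True] by (rule sum.neutral) (simp add: evec_def)
      then show ?thesis using True r(1,2) by (simp add: A_def e_def)
    next
      case False
      then show ?thesis using r(1,2) by (simp add: A_def)
    qed
    then show "X i \<in> U i" unfolding U_def r(3) by (rule imageI)
  next
    show "X i = undefined" if "i \<notin> {1..m}" for i using Fl_extensional[OF v(1)] that by (rule extensional_arb)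
  qed
  have "PiE {1..m} U \<subseteq> indep_at n m S"
  proof
    fix Y assume Y: "Y \<in> PiE {1..m} U"
    \<comment> \<open>The vector is chosen in \<open>A i\<close>; an arbitrary vector on the same
      line could be a multiple far from the required size.\<close>
    have "\<exists>w\<in>A i. Y i = coord.span {w}" if "i \<in> {1..m}" for i
      using PiE_mem[OF Y that] unfolding U_def by blast
    then obtain w where w: "\<And>i. i \<in> {1..m} \<Longrightarrow> w i \<in> A i" "\<And>i. i \<in> {1..m} \<Longrightarrow> Y i = coord.span {w i}" by metis
    have "w i \<in> Kn n - {0}" if "i \<in> {1..m}" for i
      using w(1)[OF that] by (auto simp: A_def split: if_splits)
    then have rw: "represents n m w Y" unfolding represents_def using w(2) by simp
    have near: "norm (\<Phi> (w i) j - (if i = j then 1 else 0)) < 1 / (card S + 1)" if "i \<in> S" "j \<in> S" for i j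
    proof -
      have "i \<in> {1..m}" using that(1) S by blast
      then have "h i (w i) < e" using w(1)[of i] that(1) by (simp add: A_def)
      moreover have "norm (\<Phi> (w i) j - (if i = j then 1 else 0)) \<le> h i (w i)"
        unfolding h_def by (rule member_le_sum[OF that(2)]) (use fin in simp_all)
      ultimately show ?thesis unfolding e_def by linarith
    qed
    have "indep_fam w S"
    proof (rule indep_famI[OF fin])
      fix c assume 0: "(\<Sum>i\<in>S. cscale (c i) (w i)) = 0"
      have "(\<Sum>i\<in>S. cscale (c i) (\<Phi> (w i))) = \<Phi> (\<Sum>i\<in>S. cscale (c i) (w i))"
        by (simp only: coord2.linear_sum[OF \<Phi>(1)] coord2.linear_scale[OF \<Phi>(1)])
      also have "\<dots> = 0" unfolding 0 by (rule coord2.linear_0[OF \<Phi>(1)])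
      finally have eq: "(\<Sum>i\<in>S. cscale (c i) (\<Phi> (w i))) = 0" .
      have zero: "(\<Sum>i\<in>S. c i * \<Phi> (w i) j) = 0" for j
      proof -
        have "(\<Sum>i\<in>S. c i * \<Phi> (w i) j) = (\<Sum>i\<in>S. cscale (c i) (\<Phi> (w i))) j"
          by (simp only: sum_fun_apply cscale_def)
        then show ?thesis unfolding eq by simp
      qed
      show "\<forall>i\<in>S. c i = 0"
        by (rule near_identity_kernel[where a = "\<lambda>i. \<Phi> (w i)", OF fin near zero])
    qed
    moreover have "Y \<in> Fl n m" by (rule represents_Fl[OF rw]) (use Y in \<open>simp add: PiE_def\<close>)
    ultimately show "Y \<in> indep_at n m S" using rw unfolding indep_at_def by blast
  qed
  then show "\<exists>U. finite {i \<in> {1..m}. U i \<noteq> topspace (proj_topology n)} \<and>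
      (\<forall>i\<in>{1..m}. openin (proj_topology n) (U i)) \<and> X \<in> PiE {1..m} U \<and> PiE {1..m} U \<subseteq> indep_at n m S"
    using openU XU by (intro exI[of _ U]) simp
qed

lemma general_position_open:
  assumes "n \<le> m"
  shows "openin (Fl_topology n m) (general_position n m :: 'k::real_normed_field flag_point set)"
proof -
  let ?I = "{S. S \<subseteq> {1..m} \<and> card S = n}"
  \<comment> \<open>There must be at least one condition: an empty intersection would not even be
    confined to \<open>Fl n m\<close>.\<close>
  have "{1..n} \<in> ?I" using assms by auto
  then have ne: "?I \<noteq> {}" by blast
  have fin: "finite ?I" by (rule finite_subset[of _ "Pow {1..m}"]) auto
  have "general_position n m = (\<Inter>S\<in>?I. indep_at n m S :: 'k flag_point set)"
  proof
    show "general_position n m \<subseteq> (\<Inter>S\<in>?I. indep_at n m S :: 'k flag_point set)"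
      unfolding general_position_def by blast
    show "(\<Inter>S\<in>?I. indep_at n m S :: 'k flag_point set) \<subseteq> general_position n m"
    proof
      fix X :: "'k flag_point" assume X: "X \<in> (\<Inter>S\<in>?I. indep_at n m S)"
      then have "X \<in> indep_at n m {1..n}" using \<open>{1..n} \<in> ?I\<close> by blast
      then have "X \<in> Fl n m" unfolding indep_at_def by blast
      then show "X \<in> general_position n m" using X unfolding general_position_def by blast
    qed
  qed
  moreover have "openin (Fl_topology n m) (\<Inter>S\<in>?I. indep_at n m S :: 'k flag_point set)"
    by (rule openin_INT2[OF fin ne]) (simp add: indep_at_open)
  ultimately show ?thesis by simp
qed

subsection \<open>Non-existence for many lines\<close>

text \<open>An open set contains a box around \<open>X\<close>, and the vectors whose line lies in
  its factor at \<open>j\<close> form a relatively open set around \<open>v j\<close>, so a short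
  step in the direction \<open>u\<close> stays inside. As \<open>u\<close> is off the line of
  \<open>v j\<close>, the new vector is nonzero and spans a different line.\<close>

lemma perturb_line:
  fixes \<Omega> :: "'k::real_normed_field flag_point set"
  assumes \<Omega>: "openin (Fl_topology n m) \<Omega>" and X: "X \<in> \<Omega>" and rep: "represents n m v X"
    and j: "j \<in> {1..m}" and u: "u \<in> Kn n" "u \<notin> coord.span {v j}"
  obtains c where "c \<noteq> 0" "X(j := coord.span {v j + cscale c u}) \<in> \<Omega>"
proof -
  have "\<exists>U. finite {i \<in> {1..m}. U i \<noteq> topspace (proj_topology n)} \<and>
      (\<forall>i\<in>{1..m}. openin (proj_topology n) (U i)) \<and> X \<in> PiE {1..m} U \<and> PiE {1..m} U \<subseteq> \<Omega>"
    using bspec[OF \<Omega>[unfolded Fl_topology_def openin_product_topology_alt] X] .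
  then obtain U where op: "\<forall>i\<in>{1..m}. openin (proj_topology n) (U i)"
    and U: "X \<in> PiE {1..m} U" "PiE {1..m} U \<subseteq> \<Omega>"
    by (elim exE conjE) (rule that)
  note r = representsD[OF rep j]
  obtain T where T: "open T" "{x \<in> Kn n - {0}. coord.span {x} \<in> U j} = (Kn n - {0}) \<inter> T"
    using bspec[OF op j] unfolding openin_proj_topology openin_open by blast
  have "X j \<in> U j" using PiE_mem[OF U(1) j] .
  then have "v j \<in> {x \<in> Kn n - {0}. coord.span {x} \<in> U j}" using r by simp
  then have vT: "v j \<in> T" unfolding T(2) by blast
  \<comment> \<open>A real parameter suffices for any scalar field in question, and
    \<open>f 0 = v j\<close>.\<close>
  define f :: "real \<Rightarrow> nat \<Rightarrow> 'k" where "f t = v j + cscale (of_real t) u" for t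
  have "continuous_on UNIV f"
  proof (rule continuous_on_coordinatewise_then_product)
    show "continuous_on UNIV (\<lambda>t. f t i)" for i
      unfolding f_def plus_fun_apply cscale_def by (intro continuous_intros)
  qed
  then have "open (f -` T)" by (rule open_vimage[OF T(1)])
  moreover have "0 \<in> f -` T" using vT by (simp add: f_def)
  ultimately obtain e where e: "e > 0" "ball 0 e \<subseteq> f -` T" using open_contains_ball by blast
  \<comment> \<open>A nonzero point of the ball, so that the step is nonzero.\<close>
  have "e / 2 \<in> ball 0 e" using e(1) by simp
  then have fT: "f (e / 2) \<in> T" using e(2) by blast
  define c :: 'k where "c = of_real (e / 2)"
  have c: "c \<noteq> 0" unfolding c_def of_real_eq_0_iff using e(1) by simp
  let ?w = "v j + cscale c u"
  have wT: "?w \<in> T" using fT unfolding f_def c_def .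
  have wK: "?w \<in> Kn n"
    by (rule coord.subspace_add[OF subspace_Kn r(1) coord.subspace_scale[OF subspace_Kn u(1)]])
  have "?w \<noteq> 0"
  proof
    assume "?w = 0"
    then have "cscale c u = - v j" by (simp only: eq_neg_iff_add_eq_0 add.commute)
    then have "cscale c u \<in> coord.span {v j}" by (simp add: coord.span_neg coord.span_base)
    then have "cscale (inverse c) (cscale c u) \<in> coord.span {v j}" by (rule coord.span_scale)
    then show False using u(2) c by simp
  qed
  then have "?w \<in> {x \<in> Kn n - {0}. coord.span {x} \<in> U j}" unfolding T(2) using wT wK by blast
  then have "coord.span {?w} \<in> U j" by blast
  then have "X(j := coord.span {?w}) \<in> PiE {1..m} U"
    using U(1) j by (auto simp: PiE_iff extensional_def)
  then show ?thesis using that[OF c] U(2) by blast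
qed

lemma Kn_not_subset_span:
  fixes B :: "(nat \<Rightarrow> 'k::field) set"
  assumes "finite B" "card B < n"
  obtains u where "u \<in> Kn n" "u \<notin> coord.span B"
proof -
  have "\<not> Kn n \<subseteq> coord.span B"
  proof
    assume "Kn n \<subseteq> coord.span B"
    then have "coord.dim (Kn n :: (nat \<Rightarrow> 'k) set) \<le> card B" using assms(1) by (rule coord.dim_le_card)
    then show False using assms(2) by simp
  qed
  then show ?thesis using that by blast
qed

text \<open>Fewer than \<open>n\<close> vectors leave a direction \<open>u\<close> outside their
  span. Moving the dependent vector along \<open>u\<close> stays in the orbit, so some
  \<open>g\<close> realizes the move and fixes the other lines of \<open>S\<close>. Such a
  \<open>g\<close> preserves the span of those lines, which contains \<open>v j\<close>, and so
  \<open>u\<close> would lie in that span.\<close>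

lemma open_orbit_general_position:
  fixes X :: "'k::real_normed_field flag_point"
  assumes op: "openin (Fl_topology n m) (diag_orbit n m X)" and X: "X \<in> Fl n m" and rep: "represents n m v X"
    and S: "S \<subseteq> {1..m}" "card S = n"
  shows "indep_fam v S"
  unfolding indep_fam_iff
proof (intro ballI notI)
  fix j assume j: "j \<in> S" and dep: "v j \<in> coord.span (v ` (S - {j}))"
  have fin: "finite S" using S(1) finite_subset by blast
  have jm: "j \<in> {1..m}" using j S(1) by blast
  have "card (v ` (S - {j})) \<le> card (S - {j})" by (rule card_image_le) (use fin in simp)
  also have "\<dots> < n" using card_Diff1_less[OF fin j] S(2) by simp
  finally obtain u where u: "u \<in> Kn n" "u \<notin> coord.span (v ` (S - {j}))"
    using Kn_not_subset_span[of "v ` (S - {j})" n] fin by blast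
  have "coord.span {v j} \<subseteq> coord.span (v ` (S - {j}))" using dep by (simp add: coord.span_minimal)
  then have u': "u \<notin> coord.span {v j}" using u(2) by blast
  obtain c where c: "c \<noteq> 0" "X(j := coord.span {v j + cscale c u}) \<in> diag_orbit n m X"
    using perturb_line[OF op diag_orbit_self[OF Fl_extensional[OF X]] rep jm u(1) u'] .
  let ?Y = "X(j := coord.span {v j + cscale c u})"
  obtain g where g: "lin g" "\<And>i. i \<in> {1..m} \<Longrightarrow> ?Y i = coord.span {g (v i)}"
    using diag_orbitE[OF c(2) rep] by metis
  have "g (v j) \<in> g ` coord.span (v ` (S - {j}))" using dep by (rule imageI)
  also have "\<dots> = coord.span (g ` v ` (S - {j}))" by (rule lin_span[OF g(1)])
  also have "\<dots> \<subseteq> coord.span (v ` (S - {j}))"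
  proof (rule coord.span_minimal)
    show "g ` v ` (S - {j}) \<subseteq> coord.span (v ` (S - {j}))"
    proof
      fix y assume "y \<in> g ` v ` (S - {j})"
      then obtain i where i: "i \<in> S" "i \<noteq> j" and y: "y = g (v i)" by blast
      then have im: "i \<in> {1..m}" using S(1) by blast
      have "coord.span {g (v i)} = coord.span {v i}" using g(2)[OF im] i(2) representsD(3)[OF rep im] by simp
      then have "g (v i) \<in> coord.span {v i}" using coord.span_base[of "g (v i)" "{g (v i)}"] by simp
      also have "\<dots> \<subseteq> coord.span (v ` (S - {j}))" by (rule coord.span_mono) (use i in blast)
      finally show "y \<in> coord.span (v ` (S - {j}))" unfolding y .
    qed
  qed simp
  \<comment> \<open>The moved line is \<open>g\<close> applied to the old one, hence still inside
    the span of the unmoved lines.\<close>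
  finally have gv: "coord.span {g (v j)} \<subseteq> coord.span (v ` (S - {j}))" by (simp add: coord.span_minimal)
  have "v j + cscale c u \<in> coord.span {g (v j)}"
    using g(2)[OF jm] coord.span_base[of "v j + cscale c u" "{v j + cscale c u}"] by simp
  then have "v j + cscale c u \<in> coord.span (v ` (S - {j}))" using gv by blast
  from coord.span_diff[OF this dep] have "cscale c u \<in> coord.span (v ` (S - {j}))"
    by (simp only: add_diff_cancel_left')
  then have "cscale (inverse c) (cscale c u) \<in> coord.span (v ` (S - {j}))" by (rule coord.span_scale)
  then show False using u(2) c(1) by simp
qed

text \<open>A map \<open>g\<close> realizing a move of line \<open>n + 2\<close> alone has the first
  \<open>n + 1\<close> vectors as eigenvectors. Applying \<open>g\<close> to the relation among them
  makes all eigenvalues equal, so \<open>g\<close> is a scalar on \<open>Kn n\<close> and moves no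
  line.\<close>

lemma no_open_orbit:
  fixes X :: "'k::real_normed_field flag_point"
  assumes n: "n \<ge> 2" and m: "m \<ge> n + 2" and X: "X \<in> Fl n m"
  shows "\<not> openin (Fl_topology n m) (diag_orbit n m X)"
proof
  assume op: "openin (Fl_topology n m) (diag_orbit n m X)"
  obtain v where rep: "represents n m v X" using Fl_represents[OF X] .
  let ?l = "n + 2"
  have l: "?l \<in> {1..m}" using m by simp
  have sub: "i \<in> {1..m}" if "i \<in> {1..n + 1}" for i using that m by simp
  \<comment> \<open>A single line is not all of \<open>Kn n\<close> because
    \<open>n \<ge> 2\<close>.\<close>
  obtain u where u: "u \<in> Kn n" "u \<notin> coord.span {v ?l}"
    using Kn_not_subset_span[of "{v ?l}" n] n by auto
  obtain c where c: "c \<noteq> 0" "X(?l := coord.span {v ?l + cscale c u}) \<in> diag_orbit n m X"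
    using perturb_line[OF op diag_orbit_self[OF Fl_extensional[OF X]] rep l u] .
  let ?Y = "X(?l := coord.span {v ?l + cscale c u})"
  obtain g where g: "lin g" "\<And>i. i \<in> {1..m} \<Longrightarrow> ?Y i = coord.span {g (v i)}"
    using diag_orbitE[OF c(2) rep] by metis
  have vK: "v i \<in> Kn n" if "i \<in> {1..n + 1}" for i by (rule representsD(1)[OF rep sub[OF that]])
  have ind: "indep_fam v S" if "S \<subseteq> {1..n + 1}" "card S = n" for S
    by (rule open_orbit_general_position[OF op X rep _ that(2)]) (use that(1) sub in blast)
  obtain a where a: "v (n + 1) = (\<Sum>i\<in>{1..n}. cscale (a i) (v i))" "\<And>i. i \<in> {1..n} \<Longrightarrow> a i \<noteq> 0"
    using general_relation[OF ind vK] by blast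
  have "\<exists>k. g (v i) = cscale k (v i)" if i: "i \<in> {1..n + 1}" for i
  proof -
    have "coord.span {g (v i)} = coord.span {v i}"
      using g(2)[OF sub[OF i]] representsD(3)[OF rep sub[OF i]] i by simp
    then have "g (v i) \<in> coord.span {v i}" using coord.span_base[of "g (v i)" "{g (v i)}"] by simp
    then show ?thesis unfolding coord.span_singleton by blast
  qed
  then obtain k where k: "\<And>i. i \<in> {1..n + 1} \<Longrightarrow> g (v i) = cscale (k i) (v i)" by metis
  have i0: "indep_fam v {1..n}" by (rule ind) auto
  have gl: "g (v (n + 1)) = (\<Sum>i\<in>{1..n}. cscale (a i * k i) (v i))"
  proof -
    have "g (v (n + 1)) = (\<Sum>i\<in>{1..n}. cscale (a i) (g (v i)))"
      unfolding a(1) by (simp only: coord2.linear_sum[OF g(1)] coord2.linear_scale[OF g(1)])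
    also have "\<dots> = (\<Sum>i\<in>{1..n}. cscale (a i * k i) (v i))" by (rule sum.cong) (simp_all add: k)
    finally show ?thesis .
  qed
  have gr: "g (v (n + 1)) = (\<Sum>i\<in>{1..n}. cscale (k (n + 1) * a i) (v i))"
  proof -
    have "g (v (n + 1)) = cscale (k (n + 1)) (v (n + 1))" by (rule k) simp
    then show ?thesis unfolding a(1) by (simp add: coord.scale_sum_right)
  qed
  \<comment> \<open>Two expansions of \<open>g (v (n + 1))\<close> in the basis \<open>v 1\<close>,
    ..., \<open>v n\<close> are subtracted.\<close>
  have "(\<Sum>i\<in>{1..n}. cscale (a i * k i - k (n + 1) * a i) (v i)) = 0"
    using gl gr by (simp add: coord.scale_left_diff_distrib sum_subtractf)
  then have "a i * k i - k (n + 1) * a i = 0" if "i \<in> {1..n}" for i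
    using indep_famD[OF i0 _ _ that, of "\<lambda>i. a i * k i - k (n + 1) * a i"] by simp
  \<comment> \<open>Cancellation of \<open>a i\<close> is legitimate because general position makes
    every coefficient nonzero.\<close>
  then have ki: "k i = k (n + 1)" if "i \<in> {1..n}" for i using that a(2) by (simp add: mult.commute)
  have spanK: "coord.span (v ` {1..n}) = Kn n" by (rule indep_fam_span_Kn[OF i0]) (use vK in auto)
  have "v ?l \<in> coord.span (v ` {1..n})" using representsD(1)[OF rep l] by (simp only: spanK)
  then obtain b where b: "v ?l = (\<Sum>i\<in>{1..n}. cscale (b i) (v i))"
    using in_span_image_finite[of "{1..n}"] by blast
  have "g (v ?l) = (\<Sum>i\<in>{1..n}. cscale (b i) (g (v i)))"
    unfolding b by (simp only: coord2.linear_sum[OF g(1)] coord2.linear_scale[OF g(1)])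
  also have "\<dots> = (\<Sum>i\<in>{1..n}. cscale (k (n + 1)) (cscale (b i) (v i)))"
    by (rule sum.cong) (simp_all add: k ki mult.commute)
  also have "\<dots> = cscale (k (n + 1)) (v ?l)" unfolding b by (simp only: coord.scale_sum_right)
  finally have "g (v ?l) \<in> coord.span {v ?l}" by (simp add: coord.span_base coord.span_scale)
  then have "coord.span {g (v ?l)} \<subseteq> coord.span {v ?l}" by (simp add: coord.span_minimal)
  moreover have "v ?l + cscale c u \<in> coord.span {g (v ?l)}"
    using g(2)[OF l] coord.span_base[of "v ?l + cscale c u" "{v ?l + cscale c u}"] by simp
  ultimately have "v ?l + cscale c u \<in> coord.span {v ?l}" by blast
  moreover have "v ?l \<in> coord.span {v ?l}" by (simp add: coord.span_base)
  ultimately have "(v ?l + cscale c u) - v ?l \<in> coord.span {v ?l}" by (rule coord.span_diff)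
  then have "cscale c u \<in> coord.span {v ?l}" by (simp only: add_diff_cancel_left')
  then have "cscale (inverse c) (cscale c u) \<in> coord.span {v ?l}" by (rule coord.span_scale)
  then show False using u(2) c(1) by simp
qed

theorem corollary4p2:
  fixes n m :: nat
  assumes "n \<ge> 2" and "m \<ge> 1"
  shows "((\<exists>\<Omega> \<in> (diag_orbits n m :: 'k::{real_normed_field, euclidean_space} flag_point set set).
            openin (Fl_topology n m) \<Omega>) \<longleftrightarrow> n + 1 \<ge> m) \<and>
    (n \<ge> m \<longrightarrow>
      (let p\<^sub>o = ((\<lambda>j. {j}) ` {1..m}, {}, {});
           \<Omega> = flag_orbit n m
                 (flag_Sum {1..n - m} (\<lambda>_. F_rep {}) \<oplus>\<^sub>F flag_Sum {1..m} (\<lambda>j. F_rep {j} :: (nat, 'k) flag))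
       in p\<^sub>o \<in> Params n m \<and>
          orbit_fibre n m p\<^sub>o = {\<Omega>} \<and>
          \<Omega> = diag_orbit n m (\<lambda>j\<in>{1..m}. coord.span {evec j}) \<and>
          openin (Fl_topology n m) \<Omega>)) \<and>
    (n + 1 = m \<longrightarrow>
      (let p\<^sub>o = ({}, {{1..m}}, {});
           \<Omega> = flag_orbit n m (D_rep {1..m} :: (nat, 'k) flag)
       in p\<^sub>o \<in> Params n m \<and>
          orbit_fibre n m p\<^sub>o = {\<Omega>} \<and>
          \<Omega> = diag_orbit n m
                 (\<lambda>j\<in>{1..m}. if j \<le> n then coord.span {evec j} else coord.span {\<Sum>i=1..n. evec i}) \<and>
          openin (Fl_topology n m) \<Omega>))"
proof -
  have n1: "n \<ge> 1" using assms(1) by simp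
  \<comment> \<open>Both orbits have been identified with loci of independence conditions, and
    openness is read off from there.\<close>
  have op1: "openin (Fl_topology n m) (diag_orbit n m (std_lines m :: 'k flag_point))" if "m \<le> n"
    unfolding std_lines_orbit[OF that] by (rule indep_at_open) simp
  have op2: "openin (Fl_topology n (n + 1)) (diag_orbit n (n + 1) (std_frame n :: 'k flag_point))"
    unfolding std_frame_orbit[OF n1] by (rule general_position_open) simp
  show ?thesis
  proof (intro conjI impI)
    show "(\<exists>\<Omega> \<in> (diag_orbits n m :: 'k flag_point set set). openin (Fl_topology n m) \<Omega>) \<longleftrightarrow> n + 1 \<ge> m"
    proof
      assume "\<exists>\<Omega> \<in> (diag_orbits n m :: 'k flag_point set set). openin (Fl_topology n m) \<Omega>"
      then obtain X :: "'k flag_point" where "X \<in> Fl n m" "openin (Fl_topology n m) (diag_orbit n m X)"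
        unfolding diag_orbits_def by blast
      then have "\<not> m \<ge> n + 2" using no_open_orbit[OF assms(1)] by blast
      then show "n + 1 \<ge> m" by simp
    next
      assume "n + 1 \<ge> m"
      then consider "m \<le> n" | "m = n + 1" by linarith
      then show "\<exists>\<Omega> \<in> (diag_orbits n m :: 'k flag_point set set). openin (Fl_topology n m) \<Omega>"
      proof cases
        case 1
        have "diag_orbit n m (std_lines m :: 'k flag_point) \<in> diag_orbits n m"
          unfolding diag_orbits_def by (rule imageI[OF std_lines_Fl[OF 1]])
        then show ?thesis using op1[OF 1] by (rule rev_bexI)
      next
        case 2
        have "diag_orbit n (n + 1) (std_frame n :: 'k flag_point) \<in> diag_orbits n (n + 1)"
          unfolding diag_orbits_def by (rule imageI[OF std_frame_Fl[OF n1]])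
        then show ?thesis unfolding 2 using op2 by (rule rev_bexI)
      qed
    qed
  next
    assume le: "m \<le> n"
    show "let p\<^sub>o = ((\<lambda>j. {j}) ` {1..m}, {}, {});
           \<Omega> = flag_orbit n m
                 (flag_Sum {1..n - m} (\<lambda>_. F_rep {}) \<oplus>\<^sub>F flag_Sum {1..m} (\<lambda>j. F_rep {j} :: (nat, 'k) flag))
       in p\<^sub>o \<in> Params n m \<and>
          orbit_fibre n m p\<^sub>o = {\<Omega>} \<and>
          \<Omega> = diag_orbit n m (\<lambda>j\<in>{1..m}. coord.span {evec j}) \<and>
          openin (Fl_topology n m) \<Omega>"
      unfolding Let_def F_rep_sum_orbit[OF le]
      using std_lines_fibre[OF le] op1[OF le] by (intro conjI) (simp_all only: std_lines_def)
  next
    assume m: "n + 1 = m"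
    show "let p\<^sub>o = ({}, {{1..m}}, {});
           \<Omega> = flag_orbit n m (D_rep {1..m} :: (nat, 'k) flag)
       in p\<^sub>o \<in> Params n m \<and>
          orbit_fibre n m p\<^sub>o = {\<Omega>} \<and>
          \<Omega> = diag_orbit n m
                 (\<lambda>j\<in>{1..m}. if j \<le> n then coord.span {evec j} else coord.span {\<Sum>i=1..n. evec i}) \<and>
          openin (Fl_topology n m) \<Omega>"
      unfolding Let_def m[symmetric] D_rep_orbit std_frame_eq
      using std_frame_fibre[OF assms(1)] op2 by (intro conjI refl)
  qed
qed

end
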